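(* Let $H$ be an ordered graph with $m$ edges and no isolated vertices. Then \[ r_<(H) \leq e^{10^9 \sqrt{m} (\log \log m)^{3/2}}. \]
   Context: An ordered graph on $n$ vertices is a graph whose vertex set is $\{1,\dots,n\}$ with its natural order. An ordered graph $G$ on $[N]$ contains an ordered graph $H$ on $[n]$ if there is a map $\phi:[n]\to[N]$ with $\phi(i)<\phi(j)$ for all $1\le i<j\le n$ and $\phi(i)\phi(j)\in E(G)$ whenever $ij\in E(H)$. The ordered Ramsey number $r_<(H)$ is the minimum $N$ such that every 2-coloring of the edges of the complete ordered graph on $[N]$ contains a monochromatic (ordered) copy of $H$. All logarithms are natural.
   Formalization: The bound is stated for m ≥ 3: for m = 0 or 1 the quantity log log m is undefined, and for m = 2 it is negative, so (log log m)^{3/2} is not a real number. *)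

theory Defs
  imports Complex_Main "HOL-Library.Ramsey"
begin

text \<open>
  An ordered graph is given by its number of vertices \<open>n\<close> and its edge set \<open>E\<close>; its vertex set is
  \<open>{1..n}\<close> with the order of the natural numbers, and edges are two-element sets of vertices.
\<close>

definition ordered_graph :: "nat \<Rightarrow> nat set set \<Rightarrow> bool" where
  "ordered_graph n E \<longleftrightarrow> E \<subseteq> nsets {1..n} 2"

definition no_isolated_vertices :: "nat \<Rightarrow> nat set set \<Rightarrow> bool" where
  "no_isolated_vertices n E \<longleftrightarrow> (\<forall>v\<in>{1..n}. \<exists>e\<in>E. v \<in> e)"

text \<open>\<open>ordered_contains N F n E\<close>: the ordered graph \<open>(N, F)\<close> contains the ordered graph \<open>(n, E)\<close>.\<close>

definition ordered_contains :: "nat \<Rightarrow> nat set set \<Rightarrow> nat \<Rightarrow> nat set set \<Rightarrow> bool" where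
  "ordered_contains N F n E \<longleftrightarrow>
     (\<exists>\<phi>. \<phi> \<in> {1..n} \<rightarrow> {1..N} \<and>
          (\<forall>i\<in>{1..n}. \<forall>j\<in>{1..n}. i < j \<longrightarrow> \<phi> i < \<phi> j) \<and>
          (\<forall>i\<in>{1..n}. \<forall>j\<in>{1..n}. {i, j} \<in> E \<longrightarrow> {\<phi> i, \<phi> j} \<in> F))"

text \<open>
  A two-colouring is a function into \<open>bool\<close>, of which only the values on the edges of the complete
  graph matter; a monochromatic copy is a copy in one of the two colour classes.
\<close>

definition ordered_ramsey_property :: "nat \<Rightarrow> nat set set \<Rightarrow> nat \<Rightarrow> bool" where
  "ordered_ramsey_property n E N \<longleftrightarrow>
     (\<forall>c :: nat set \<Rightarrow> bool. \<exists>b. ordered_contains N {e \<in> nsets {1..N} 2. c e = b} n E)"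

definition ordered_ramsey_number :: "nat \<Rightarrow> nat set set \<Rightarrow> nat" where
  "ordered_ramsey_number n E = (LEAST N. ordered_ramsey_property n E N)"

text \<open>The minimum is attained, by Ramsey's theorem.\<close>

lemma ordered_ramsey_property_exists:
  assumes "ordered_graph n E"
  shows "\<exists>N. ordered_ramsey_property n E N"
proof -
  obtain N :: nat where N: "partn_lst {..<N} [n, n] 2"
    using ramsey_full by blast
  have "\<exists>b. ordered_contains N {e \<in> nsets {1..N} 2. c e = b} n E" for c :: "nat set \<Rightarrow> bool"
  proof -
    define f where "f e = (if c (Suc ` e) then 1 else 0 :: nat)" for e
    have "f \<in> nsets {..<N} 2 \<rightarrow> {..<2}"
      by (auto simp: f_def)
    then obtain i H where "i < 2" and H: "H \<in> nsets {..<N} ([n, n] ! i)" and fH: "f ` nsets H 2 \<subseteq> {i}"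
      using partn_lstE[OF N, of f 2] by (auto simp: numeral_2_eq_2)
    have "[n, n] ! i = n"
      using \<open>i < 2\<close> by (auto simp: less_2_cases_iff)
    with H have H: "H \<subseteq> {..<N}" "finite H" "card H = n"
      by (auto simp: nsets_def)
    define \<phi> where "\<phi> k = Suc (enumerate H (k - 1))" for k
    have inH: "enumerate H (k - 1) \<in> H" if "k \<in> {1..n}" for k
      using that H finite_enumerate_in_set[of H "k - 1"] by auto
    have mono: "enumerate H (k - 1) < enumerate H (l - 1)" if "k \<in> {1..n}" "l \<in> {1..n}" "k < l" for k l
      using that H by (intro finite_enumerate_mono) auto
    have edge: "{\<phi> k, \<phi> l} \<in> nsets {1..N} 2 \<and> c {\<phi> k, \<phi> l} = (i = 1)"
      if kl: "k \<in> {1..n}" "l \<in> {1..n}" "{k, l} \<in> E" for k l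
    proof -
      have "k \<noteq> l"
        using kl(3) assms by (auto simp: ordered_graph_def nsets_def)
      then have ne: "enumerate H (k - 1) \<noteq> enumerate H (l - 1)"
        using mono[of k l] mono[of l k] kl by (metis linorder_neq_iff)
      then have "{enumerate H (k - 1), enumerate H (l - 1)} \<in> nsets H 2"
        using inH kl by (auto simp: nsets_def)
      then have "f {enumerate H (k - 1), enumerate H (l - 1)} = i"
        using fH by blast
      then have "c {\<phi> k, \<phi> l} = (i = 1)"
        by (auto simp: f_def \<phi>_def split: if_splits)
      moreover have "{\<phi> k, \<phi> l} \<in> nsets {1..N} 2"
        using inH[OF kl(1)] inH[OF kl(2)] H(1) ne by (auto simp: nsets_def \<phi>_def Suc_le_eq)
      ultimately show ?thesis by simp
    qed
    have "\<phi> \<in> {1..n} \<rightarrow> {1..N}"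
      using inH H(1) by (force simp: \<phi>_def Suc_le_eq)
    moreover have "\<phi> k < \<phi> l" if "k \<in> {1..n}" "l \<in> {1..n}" "k < l" for k l
      using mono[OF that] by (simp add: \<phi>_def)
    ultimately have "ordered_contains N {e \<in> nsets {1..N} 2. c e = (i = 1)} n E"
      unfolding ordered_contains_def using edge by (intro exI[of _ \<phi>]) blast
    then show ?thesis ..
  qed
  then show ?thesis
    unfolding ordered_ramsey_property_def by blast
qed

end

theory Submission
  imports Defs
begin

text \<open>
  Let \<open>L = ln m\<close>. A greedy embedding of an ordered graph whose back-degrees (in the order of
  decreasing degree) are at most \<open>D\<close> either succeeds in a given colour, or produces two large sets
  \<open>X\<close>, \<open>Y\<close>, one to the left of the other, whose density in that colour is below \<open>p\<close>; the price is a
  factor \<open>p ^ D\<close>. Splitting the target of the other colour into a left and a right part, to be placed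
  in \<open>X\<close> and \<open>Y\<close>, gives a recursion on pairs of targets. The targets are measured by the weight
  \<open>\<Sum> min (deg v) (sqrt (2 m))\<close>, which bounds the square of the back-degrees and can be halved up to a
  constant. Always paying for the target of smaller weight and halving the other one makes the total
  price a geometric series, controlled by the potential \<open>(w1 * w2) powr (1/4)\<close>.

  If \<open>p\<close> is of order \<open>1 / n\<close>, the edges between the two parts take care of themselves, but the price
  is \<open>exp (sqrt m * L\<^sup>2)\<close>. To save the logarithms, \<open>p\<close> is only taken to be a power of \<open>1 / L\<close>, and
  dependent random choice is used to make all small subsets of \<open>X\<close> have a large common
  neighbourhood in \<open>Y\<close>; this is good enough for the vertices of degree at least \<open>sqrt m / L ^ 5\<close>.
  For the remaining vertices one first passes to a set without pairs of density below \<open>1 / (2 n)\<close> in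
  either colour. There one may keep, for each low degree vertex and each block of a fine partition
  into intervals, a large set of candidates, whatever happens to the other vertices. If no
  such set exists, a pair of density below \<open>1 / (2 n)\<close> halves one of the targets, and the same
  potential controls this outer recursion. Altogether the exponent is of order \<open>sqrt m * ln L\<close>.
\<close>

section \<open>Intervals of finite sets of natural numbers\<close>

text \<open>Paying for the lighter target costs back-degree \<open>sqrt w1\<close>, at most
  \<open>(w1 * w2) powr (1/4)\<close>, and cutting a target into parts of at most three quarters of
  its weight shrinks this potential by a fixed factor; so the first step dominates the whole price.
  Dependent random choice limits the number t of vertices that can be handled with a polylogarithmic
  \<open>p\<close>. A sample of about \<open>\<theta> / p\<close> points, with common neighbourhoods
  down to a proportion \<open>exp (- \<theta>)\<close>, rules out all bad t-tuples only if t times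
  the logarithm of the ambient size is below about \<open>\<theta> ^ 2 / p\<close>. That logarithm
  is itself \<open>sqrt m\<close> up to powers of \<open>L\<close>, so t may only be
  \<open>sqrt m\<close> up to powers of \<open>L\<close>. This suffices for the vertices of degree
  above \<open>sqrt m / L ^ 5\<close>, while \<open>n\<close> can be as large as
  \<open>2 * m\<close>. The other degrees are so small that a loss of \<open>1 / (2 n)\<close> per
  neighbour is affordable: \<open>L * sqrt m / L ^ 5\<close> is far below
  \<open>sqrt m\<close>.\<close>

definition before :: "nat set \<Rightarrow> nat set \<Rightarrow> bool" where
  "before X Y \<longleftrightarrow> (\<forall>x\<in>X. \<forall>y\<in>Y. x < y)"

lemma before_subset: "before X Y \<Longrightarrow> X' \<subseteq> X \<Longrightarrow> Y' \<subseteq> Y \<Longrightarrow> before X' Y'"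
  unfolding before_def by blast

definition rank_in :: "nat set \<Rightarrow> nat \<Rightarrow> nat" where
  "rank_in Z x = card {y \<in> Z. y < x}"

lemma rank_in_mono: "finite Z \<Longrightarrow> x \<le> y \<Longrightarrow> rank_in Z x \<le> rank_in Z y"
  unfolding rank_in_def by (rule card_mono) auto

lemma rank_in_strict_mono:
  assumes "finite Z" "x \<in> Z" "x < y"
  shows "rank_in Z x < rank_in Z y"
  unfolding rank_in_def by (rule psubset_card_mono) (use assms in auto)

lemma bij_betw_rank_in:
  assumes "finite Z"
  shows "bij_betw (rank_in Z) Z {..<card Z}"
proof -
  have inj: "inj_on (rank_in Z) Z"
    by (rule inj_onI) (metis assms linorder_neqE_nat rank_in_strict_mono nat_neq_iff)
  have "rank_in Z ` Z \<subseteq> {..<card Z}"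
  proof
    fix k assume "k \<in> rank_in Z ` Z"
    then obtain x where x: "x \<in> Z" "k = rank_in Z x" by blast
    have "rank_in Z x < card Z"
      unfolding rank_in_def by (rule psubset_card_mono) (use assms x in auto)
    then show "k \<in> {..<card Z}" using x by simp
  qed
  then have "rank_in Z ` Z = {..<card Z}"
    by (intro card_subset_eq) (auto simp: card_image[OF inj])
  with inj show ?thesis by (simp add: bij_betw_def)
qed

text \<open>Dividing ranks by \<open>a\<close> cuts \<open>Z\<close> into consecutive runs of length
  \<open>a\<close>, with at most one shorter run at the end; the side condition of the second claim
  leaves that remainder out.\<close>

lemma card_rank_block:
  assumes "finite Z" "0 < a"
  shows "card {x \<in> Z. rank_in Z x div a = k} \<le> a"
    and "(k + 1) * a \<le> card Z \<Longrightarrow> card {x \<in> Z. rank_in Z x div a = k} = a"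
proof -
  let ?B = "{x \<in> Z. rank_in Z x div a = k}"
  have bij: "bij_betw (rank_in Z) Z {..<card Z}" by (rule bij_betw_rank_in[OF assms(1)])
  have inj: "inj_on (rank_in Z) ?B"
    using bij by (auto simp: bij_betw_def intro: inj_on_subset)
  have eq: "rank_in Z ` ?B = {i \<in> {..<card Z}. i div a = k}"
    using bij by (auto simp: bij_betw_def)
  have sub: "{i. i div a = k} = {k * a..<(k + 1) * a}"
    using assms(2) by (auto simp: dividend_less_times_div div_nat_eqI mult.commute)
  have card_eq: "card ?B = card {i \<in> {..<card Z}. i div a = k}"
    using card_image[OF inj] eq by simp
  have "card {i \<in> {..<card Z}. i div a = k} \<le> card {k * a..<(k + 1) * a}"
    by (rule card_mono) (use sub in auto)
  then show "card ?B \<le> a" using card_eq by simp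
  assume le: "(k + 1) * a \<le> card Z"
  have "{i \<in> {..<card Z}. i div a = k} = {k * a..<(k + 1) * a}"
    using sub le by auto
  then show "card ?B = a" using card_eq by simp
qed

lemma rank_block_before:
  assumes "finite Z" "k < l"
  shows "before {x \<in> Z. rank_in Z x div a = k} {x \<in> Z. rank_in Z x div a = l}"
  unfolding before_def
proof (intro ballI, rule ccontr)
  fix x y assume x: "x \<in> {x \<in> Z. rank_in Z x div a = k}" and y: "y \<in> {x \<in> Z. rank_in Z x div a = l}"
    and "\<not> x < y"
  then have "rank_in Z y \<le> rank_in Z x" using rank_in_mono[OF assms(1), of y x] by simp
  then have "l \<le> k" using div_le_mono[of "rank_in Z y" "rank_in Z x" a] x y by simp
  then show False using assms(2) by simp
qed

text \<open>The piece of \<open>v\<close> is the block numbered by the rank of \<open>v\<close> in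
  \<open>U\<close>, which turns the order of the vertices into the order of the blocks. Rounding
  \<open>card Z / n\<close> down costs at most a factor 2, because the quotient is at least
  1.\<close>

lemma ordered_pieces:
  fixes Z U :: "nat set"
  assumes "finite Z" "finite U" "card U \<le> n" "1 \<le> n" "2 * n \<le> card Z"
  obtains C where "\<And>v. v \<in> U \<Longrightarrow> C v \<subseteq> Z"
    and "\<And>v. v \<in> U \<Longrightarrow> real (card Z) / (2 * real n) \<le> real (card (C v))"
    and "\<And>u v. u \<in> U \<Longrightarrow> v \<in> U \<Longrightarrow> u < v \<Longrightarrow> before (C u) (C v)"
proof -
  define a where "a = card Z div n"
  have a: "0 < a" using assms unfolding a_def by (simp add: div_greater_zero_iff)
  have na: "n * a \<le> card Z" unfolding a_def by simp
  define C where "C v = {x \<in> Z. rank_in Z x div a = rank_in U v}" for v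
  have less: "rank_in U v < n" if "v \<in> U" for v
    using bij_betwE[OF bij_betw_rank_in[OF assms(2)]] that assms(3) by fastforce
  show ?thesis
  proof (rule that[of C])
    show "C v \<subseteq> Z" for v unfolding C_def by auto
    fix v assume v: "v \<in> U"
    have "(rank_in U v + 1) * a \<le> n * a" using less[OF v] by (intro mult_right_mono) auto
    then have "card (C v) = a"
      unfolding C_def using card_rank_block(2)[OF assms(1) a] na by simp
    moreover have "real (card Z) / (2 * real n) \<le> real a"
    proof -
      have "card Z < n * a + n"
        unfolding a_def using assms(4) by (metis add.commute dividend_less_times_div mult.commute less_le_trans zero_less_one)
      then have "real (card Z) \<le> real n * real a + real n"
        by (metis of_nat_add of_nat_mult of_nat_le_iff less_imp_le)
      also have "\<dots> \<le> real n * real a + real n * real a"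
        using a by (intro add_left_mono) (metis mult.right_neutral mult_left_mono of_nat_0_le_iff of_nat_1 of_nat_le_iff Suc_leI One_nat_def)
      finally show ?thesis using assms(4) by (simp add: field_simps)
    qed
    ultimately show "real (card Z) / (2 * real n) \<le> real (card (C v))" by simp
  next
    fix u v assume "u \<in> U" "v \<in> U" "u < v"
    then show "before (C u) (C v)"
      unfolding C_def using rank_in_strict_mono[OF assms(2)] rank_block_before[OF assms(1)] by blast
  qed
qed

lemma split_at_card:
  fixes J :: "nat set"
  assumes "finite J" "k \<le> card J"
  obtains L R where "J = L \<union> R" "before L R" "card L = k" "card R = card J - k"
proof -
  define L where "L = {x \<in> J. rank_in J x < k}"
  have bij: "bij_betw (rank_in J) J {..<card J}" by (rule bij_betw_rank_in[OF assms(1)])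
  have "rank_in J ` L = {..<k}"
    using bij assms(2) unfolding L_def bij_betw_def by (auto simp: image_iff set_eq_iff)
      (metis lessThan_iff less_le_trans)
  moreover have "inj_on (rank_in J) L" using bij unfolding L_def bij_betw_def by (auto intro: inj_on_subset)
  ultimately have cL: "card L = k" by (metis card_image card_lessThan)
  have "before L (J - L)"
    unfolding before_def L_def using rank_in_mono[OF assms(1)] by (auto simp: not_less) (meson leD leI le_less_trans)
  moreover have "card (J - L) = card J - k"
    using cL card_Diff_subset[of L J] assms(1) unfolding L_def by auto
  ultimately show ?thesis using that[of L "J - L"] cL unfolding L_def by blast
qed

text \<open>The density is small at every point of \<open>X\<close>, not just on average, so that
  any few points of \<open>X\<close> can be treated by a union bound. The strict inequality makes a
  nonempty \<open>X\<close> force a nonempty \<open>Y\<close>.\<close>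

definition sparse :: "(nat set \<Rightarrow> bool) \<Rightarrow> bool \<Rightarrow> real \<Rightarrow> nat set \<Rightarrow> nat set \<Rightarrow> bool" where
  "sparse c col p X Y \<longleftrightarrow> (\<forall>x\<in>X. real (card {y \<in> Y. c {x, y} = col}) < p * real (card Y))"

section \<open>Good copies and the greedy embedding\<close>

text \<open>
  The predicate \<open>Good\<close> singles out the admissible partial embeddings of the vertex set \<open>U\<close>; all that
  matters is that an admissible embedding has few inadmissible extensions by one vertex.
\<close>

locale colouring =
  fixes c :: "nat set \<Rightarrow> bool" and E :: "nat set set" and V U :: "nat set" and n :: nat
    and Good :: "bool \<Rightarrow> nat set \<Rightarrow> (nat \<Rightarrow> nat) \<Rightarrow> bool" and \<delta> :: real
  assumes fin_V: "finite V" and fin_U: "finite U" and card_U: "card U \<le> n" and n_pos: "1 \<le> n"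
    and edge: "\<And>e. e \<in> E \<Longrightarrow> card e = 2"
    and delta_nonneg: "0 \<le> \<delta>"
    and Good_insert: "\<And>col A \<phi> u. Good col A \<phi> \<Longrightarrow> A \<subseteq> U \<Longrightarrow> u \<in> U - A \<Longrightarrow>
      real (card {x \<in> V. \<not> Good col (insert u A) (\<phi>(u := x))}) \<le> \<delta>"
begin

text \<open>Nothing is asked of the order or the edges between \<open>A\<close> and
  \<open>I\<close>: when the parts of a split target are glued, both are supplied by the pair
  \<open>X\<close>, \<open>Y\<close>. The earlier part restricts the later one only through
  \<open>Good\<close> and through the choice of \<open>Z\<close>.\<close>

definition copy :: "bool \<Rightarrow> nat set \<Rightarrow> nat set \<Rightarrow> (nat \<Rightarrow> nat) \<Rightarrow> nat set \<Rightarrow> (nat \<Rightarrow> nat) \<Rightarrow> bool" where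
  "copy col I A \<phi> Z \<psi> \<longleftrightarrow>
     (\<forall>a\<in>A. \<psi> a = \<phi> a) \<and> (\<forall>u\<in>I. \<psi> u \<in> Z) \<and> (\<forall>u\<in>I. \<forall>v\<in>I. u < v \<longrightarrow> \<psi> u < \<psi> v) \<and>
     (\<forall>u\<in>I. \<forall>v\<in>I. {u, v} \<in> E \<longrightarrow> c {\<psi> u, \<psi> v} = col) \<and> Good col (A \<union> I) \<psi>"

lemma edge_ne: "{u, v} \<in> E \<Longrightarrow> u \<noteq> v"
  using edge[of "{u, v}"] by auto

text \<open>Vertices are embedded in the order of decreasing \<open>d\<close>, so \<open>v\<close>
  has at most \<open>D\<close> neighbours embedded before it, and its candidate set loses a factor
  \<open>p\<close> at most \<open>D\<close> times. The points that would cost another vertex more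
  than a factor \<open>p\<close> form, with the candidates of that vertex, a sparse pair;
  \<open>no_sparse\<close> bounds their number.\<close>

lemma greedy_embedding:
  fixes p a :: real and C :: "nat \<Rightarrow> nat set" and d :: "nat \<Rightarrow> nat"
  assumes I: "I \<subseteq> U" "A \<subseteq> U" "I \<inter> A = {}" and good: "Good col A \<phi>"
    and CV: "\<And>v. v \<in> I \<Longrightarrow> C v \<subseteq> V"
    and Ca: "\<And>v. v \<in> I \<Longrightarrow> a \<le> real (card (C v))"
    and Cord: "\<And>u v. u \<in> I \<Longrightarrow> v \<in> I \<Longrightarrow> u < v \<Longrightarrow> before (C u) (C v)"
    and p: "0 < p" "p \<le> 1"
    and D: "\<And>v. v \<in> I \<Longrightarrow> card {u \<in> I. d v \<le> d u \<and> {u, v} \<in> E} \<le> D"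
    and large: "\<delta> < p ^ D * a"
    and no_sparse: "\<And>u v X Y. u \<in> I \<Longrightarrow> v \<in> I \<Longrightarrow> u \<noteq> v \<Longrightarrow> X \<subseteq> C u \<Longrightarrow> Y \<subseteq> C v \<Longrightarrow>
      p ^ D * a \<le> real (card Y) \<Longrightarrow> (p ^ D * a - \<delta>) / real n \<le> real (card X) \<Longrightarrow> \<not> sparse c col p X Y"
  shows "\<exists>\<psi>. copy col I A \<phi> V \<psi> \<and> (\<forall>v\<in>I. \<psi> v \<in> C v)"
proof -
  have finI: "finite I" using I(1) fin_U finite_subset by blast
  have cardI: "card I \<le> n" using card_mono[OF fin_U I(1)] card_U by simp
  have finC: "finite (C v)" if "v \<in> I" for v using CV[OF that] fin_V finite_subset by blast
  have a_pos: "0 < a" using large delta_nonneg p(1)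
    by (metis less_le_trans linorder_not_less mult_nonneg_nonpos not_less_iff_gr_or_eq order_less_trans zero_less_power
        less_eq_real_def zero_le_power)
  define cand where "cand K \<psi> v = {y \<in> C v. \<forall>u\<in>K. {u, v} \<in> E \<longrightarrow> c {\<psi> u, y} = col}" for K \<psi> v
  define inv where "inv K \<psi> \<longleftrightarrow> K \<subseteq> I \<and> copy col K A \<phi> V \<psi> \<and> (\<forall>v\<in>K. \<psi> v \<in> C v) \<and>
     (\<forall>v\<in>K. \<forall>u\<in>I - K. d u \<le> d v) \<and>
     (\<forall>v\<in>I - K. p ^ card {u \<in> K. {u, v} \<in> E} * a \<le> real (card (cand K \<psi> v)))" for K \<psi>
  have step: "\<exists>v\<in>I - K. \<exists>\<psi>'. inv (insert v K) \<psi>'" if K: "inv K \<psi>" and ne: "K \<noteq> I" for K \<psi>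
  proof -
    have KI: "K \<subseteq> I" using K unfolding inv_def by blast
    have finK: "finite K" using KI finI finite_subset by blast
    have "finite (I - K)" "I - K \<noteq> {}" using finI KI ne by auto
    then obtain v where v: "v \<in> I - K" "\<And>u. u \<in> I - K \<Longrightarrow> d u \<le> d v"
      using obtains_MAX[of "I - K" d] by (metis Max_ge finite_imageI imageI)
    have size: "p ^ D * a \<le> real (card (cand K \<psi> u))" if u: "u \<in> I - K" for u
    proof -
      have "{w \<in> K. {w, u} \<in> E} \<subseteq> {w \<in> I. d u \<le> d w \<and> {w, u} \<in> E}"
        using K u unfolding inv_def by blast
      then have "card {w \<in> K. {w, u} \<in> E} \<le> card {w \<in> I. d u \<le> d w \<and> {w, u} \<in> E}"
        using finI by (intro card_mono) auto
      also have "\<dots> \<le> D" using D u by blast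
      finally have "card {w \<in> K. {w, u} \<in> E} \<le> D" .
      then have "p ^ D * a \<le> p ^ card {w \<in> K. {w, u} \<in> E} * a"
        using p a_pos by (intro mult_right_mono power_decreasing) auto
      also have "\<dots> \<le> real (card (cand K \<psi> u))" using K u unfolding inv_def by blast
      finally show ?thesis .
    qed
    define bad where "bad u = {x \<in> cand K \<psi> v. real (card {y \<in> cand K \<psi> u. c {x, y} = col}) < p * real (card (cand K \<psi> u))}" for u
    define nongood where "nongood = {x \<in> V. \<not> Good col (insert v (A \<union> K)) (\<psi>(v := x))}"
    define O' where "O' = I - K - {v}"
    have finO: "finite O'" unfolding O'_def using finI by simp
    have candsub: "cand K \<psi> u \<subseteq> C u" for u unfolding cand_def by auto
    have fincand: "finite (cand K \<psi> u)" if "u \<in> I" for u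
      using finC[OF that] candsub finite_subset by blast
    have badle: "real (card (bad u)) \<le> (p ^ D * a - \<delta>) / real n" if u: "u \<in> O'" for u
    proof (rule ccontr)
      assume "\<not> ?thesis"
      then have "\<not> sparse c col p (bad u) (cand K \<psi> u)"
        using no_sparse[of v u "bad u" "cand K \<psi> u"] u v size[of u] candsub
        unfolding O'_def bad_def by fastforce
      then show False unfolding sparse_def bad_def by auto
    qed
    have ng: "real (card nongood) \<le> \<delta>"
      unfolding nongood_def
    proof (rule Good_insert)
      show "Good col (A \<union> K) \<psi>" using K unfolding inv_def copy_def by blast
      show "A \<union> K \<subseteq> U" "v \<in> U - (A \<union> K)" using I KI v(1) by auto
    qed
    \<comment> \<open>At most \<open>n - 1\<close> vertices are still to be protected, since
      \<open>v\<close> is not among them; this makes the union bound below strict and leaves a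
      usable point.\<close>
    have "card O' \<le> n - 1"
    proof -
      have "card O' \<le> card (I - {v})" unfolding O'_def by (rule card_mono) (use finI in auto)
      also have "\<dots> = card I - 1" using v(1) finI by simp
      finally show ?thesis using cardI by linarith
    qed
    then have cO: "real (card O') \<le> real n - 1" using n_pos by linarith
    have finbad: "finite (bad u)" for u unfolding bad_def using fincand[of v] v(1) by auto
    have "real (card (nongood \<union> (\<Union>u\<in>O'. bad u))) \<le> real (card nongood) + real (card (\<Union>u\<in>O'. bad u))"
      using card_Un_le by (metis of_nat_add of_nat_le_iff)
    also have "real (card (\<Union>u\<in>O'. bad u)) \<le> (\<Sum>u\<in>O'. real (card (bad u)))"
      using card_UN_le[OF finO] by (metis of_nat_le_iff of_nat_sum)
    also have "\<dots> \<le> real (card O') * ((p ^ D * a - \<delta>) / real n)"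
      using sum_bounded_above[of O' "\<lambda>u. real (card (bad u))"] badle by blast
    also have "\<dots> \<le> (real n - 1) * ((p ^ D * a - \<delta>) / real n)"
      using cO large n_pos by (intro mult_right_mono) auto
    also have "\<dots> < p ^ D * a - \<delta>"
      using large n_pos by (simp add: field_simps)
    finally have "real (card (nongood \<union> (\<Union>u\<in>O'. bad u))) < p ^ D * a"
      using ng by linarith
    also have "\<dots> \<le> real (card (cand K \<psi> v))" using size v(1) by blast
    finally have "card (nongood \<union> (\<Union>u\<in>O'. bad u)) < card (cand K \<psi> v)" by simp
    moreover have "finite (nongood \<union> (\<Union>u\<in>O'. bad u))"
      unfolding nongood_def using fin_V finO finbad by auto
    note card_mono[OF this, of "cand K \<psi> v"]
    ultimately have "\<not> cand K \<psi> v \<subseteq> nongood \<union> (\<Union>u\<in>O'. bad u)"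
      by linarith
    then obtain x where x: "x \<in> cand K \<psi> v" "x \<notin> nongood" "\<And>u. u \<in> O' \<Longrightarrow> x \<notin> bad u"
      by blast
    define \<psi>' where "\<psi>' = \<psi>(v := x)"
    have vK: "v \<notin> K" "v \<in> I" "v \<notin> A" using v(1) I by auto
    have same: "\<psi>' u = \<psi> u" if "u \<in> K \<union> A" for u using that vK unfolding \<psi>'_def by auto
    have xC: "x \<in> C v" using x(1) candsub by blast
    have xV: "x \<in> V" using xC CV vK by blast
    have KC: "\<And>u. u \<in> K \<Longrightarrow> \<psi> u \<in> C u" using K unfolding inv_def by blast
    have cp: "copy col K A \<phi> V \<psi>" using K unfolding inv_def by blast
    have "copy col (insert v K) A \<phi> V \<psi>'"
      unfolding copy_def
    proof (intro conjI ballI impI)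
      show "\<psi>' a = \<phi> a" if "a \<in> A" for a using cp that same unfolding copy_def by auto
      show "\<psi>' u \<in> V" if "u \<in> insert v K" for u
        using cp that same xV unfolding copy_def \<psi>'_def by auto
      show "\<psi>' u < \<psi>' w" if "u \<in> insert v K" "w \<in> insert v K" "u < w" for u w
      proof -
        have "\<psi>' u \<in> C u" "\<psi>' w \<in> C w" using that xC KC unfolding \<psi>'_def by auto
        moreover have "before (C u) (C w)" using Cord[of u w] that vK KI by auto
        ultimately show ?thesis unfolding before_def by blast
      qed
      show "c {\<psi>' u, \<psi>' w} = col" if h: "u \<in> insert v K" "w \<in> insert v K" "{u, w} \<in> E" for u w
      proof -
        have "u \<noteq> w" using edge_ne h(3) by blast
        then consider "u = v" "w \<in> K" | "w = v" "u \<in> K" | "u \<in> K" "w \<in> K" using h by blast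
        then show ?thesis
        proof cases
          case 1
          then show ?thesis using x(1) h(3) same[of w] unfolding cand_def \<psi>'_def by (auto simp: insert_commute)
        next
          case 2
          then show ?thesis using x(1) h(3) same[of u] unfolding cand_def \<psi>'_def by auto
        next
          case 3
          then show ?thesis using cp h(3) same unfolding copy_def by auto
        qed
      qed
      show "Good col (A \<union> insert v K) \<psi>'"
        using x(2) xV unfolding nongood_def \<psi>'_def by simp
    qed
    moreover have "\<forall>u\<in>insert v K. \<psi>' u \<in> C u" using xC KC same unfolding \<psi>'_def by auto
    moreover have "\<forall>w\<in>insert v K. \<forall>u\<in>I - insert v K. d u \<le> d w"
      using K v(2) unfolding inv_def by auto
    moreover have "p ^ card {w \<in> insert v K. {w, u} \<in> E} * a \<le> real (card (cand (insert v K) \<psi>' u))"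
      if u: "u \<in> I - insert v K" for u
    proof (cases "{v, u} \<in> E")
      case False
      have "{w \<in> insert v K. {w, u} \<in> E} = {w \<in> K. {w, u} \<in> E}" using False by auto
      moreover have "cand (insert v K) \<psi>' u = cand K \<psi> u"
        unfolding cand_def using False same by auto
      ultimately show ?thesis using K u unfolding inv_def by auto
    next
      case True
      have uO: "u \<in> O'" using u unfolding O'_def by auto
      have "{w \<in> insert v K. {w, u} \<in> E} = insert v {w \<in> K. {w, u} \<in> E}" using True by auto
      then have e: "card {w \<in> insert v K. {w, u} \<in> E} = Suc (card {w \<in> K. {w, u} \<in> E})"
        using vK finK by simp
      have "cand (insert v K) \<psi>' u = {y \<in> cand K \<psi> u. c {x, y} = col}"
        unfolding cand_def using True same unfolding \<psi>'_def by auto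
      moreover have "p * real (card (cand K \<psi> u)) \<le> real (card {y \<in> cand K \<psi> u. c {x, y} = col})"
        using x(1) x(3)[OF uO] unfolding bad_def by auto
      moreover have "p * (p ^ card {w \<in> K. {w, u} \<in> E} * a) \<le> p * real (card (cand K \<psi> u))"
        using K u p(1) unfolding inv_def by (intro mult_left_mono) auto
      ultimately show ?thesis using e by (simp add: mult.assoc)
    qed
    ultimately have "inv (insert v K) \<psi>'" unfolding inv_def using KI vK by auto
    then show ?thesis using v(1) by blast
  qed
  have base: "inv {} \<phi>"
    unfolding inv_def copy_def cand_def using good Ca by auto
  have "\<exists>K \<psi>. inv K \<psi> \<and> card K = k" if "k \<le> card I" for k
    using that
  proof (induction k)
    case 0
    then show ?case using base by (intro exI[of _ "{}"] exI[of _ \<phi>]) simp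
  next
    case (Suc k)
    then obtain K \<psi> where K: "inv K \<psi>" "card K = k" by auto
    then have "K \<noteq> I" using Suc.prems by auto
    then obtain v \<psi>' where v: "v \<in> I - K" "inv (insert v K) \<psi>'" using step K(1) by blast
    have "finite K" using K(1) finI finite_subset unfolding inv_def by blast
    then show ?case using v K(2) by (intro exI[of _ "insert v K"] exI[of _ \<psi>']) simp
  qed
  then obtain K \<psi> where K: "inv K \<psi>" "card K = card I" by blast
  then have "K = I" using finI card_subset_eq unfolding inv_def by blast
  then show ?thesis using K(1) unfolding inv_def by blast
qed

text \<open>Contrapositive of the greedy embedding into ordered pieces of size at least
  \<open>a = card Z / (2 n)\<close>. The second bound in \<open>large\<close> says
  \<open>2 * \<delta> \<le> p ^ D * a\<close>, so at least half of a candidate set is admissible,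
  and some bad set has size at least \<open>p ^ D * a / (2 n)\<close>, which is the stated
  bound.\<close>

lemma sparse_pair:
  fixes p :: real and d :: "nat \<Rightarrow> nat"
  assumes I: "I \<subseteq> U" "A \<subseteq> U" "I \<inter> A = {}" and good: "Good col A \<phi>" and Z: "Z \<subseteq> V"
    and p: "0 < p" "p \<le> 1"
    and D: "\<And>v. v \<in> I \<Longrightarrow> card {u \<in> I. d v \<le> d u \<and> {u, v} \<in> E} \<le> D"
    and large: "2 * real n \<le> real (card Z)" "4 * real n * \<delta> \<le> p ^ D * real (card Z)"
    and no_copy: "\<not> (\<exists>\<psi>. copy col I A \<phi> Z \<psi>)"
  obtains X Y where "X \<subseteq> Z" "Y \<subseteq> Z" "before X Y \<or> before Y X" "sparse c col p X Y"
    "p ^ D * real (card Z) / (4 * real n ^ 2) \<le> real (card X)"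
    "p ^ D * real (card Z) / (4 * real n ^ 2) \<le> real (card Y)"
proof -
  have finZ: "finite Z" using Z fin_V finite_subset by blast
  have finI: "finite I" using I(1) fin_U finite_subset by blast
  have cardI: "card I \<le> n" using card_mono[OF fin_U I(1)] card_U by simp
  have nZ: "2 * n \<le> card Z" using large(1) by linarith
  obtain C where C: "\<And>v. v \<in> I \<Longrightarrow> C v \<subseteq> Z"
    "\<And>v. v \<in> I \<Longrightarrow> real (card Z) / (2 * real n) \<le> real (card (C v))"
    "\<And>u v. u \<in> I \<Longrightarrow> v \<in> I \<Longrightarrow> u < v \<Longrightarrow> before (C u) (C v)"
    using ordered_pieces[OF finZ finI cardI n_pos nZ] by metis
  define a where "a = real (card Z) / (2 * real n)"
  have n1: "1 \<le> real n" using n_pos by simp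
  have Zpos: "0 < real (card Z)" using large(1) n1 by linarith
  have a: "0 < a" unfolding a_def using Zpos n1 by simp
  have da: "2 * \<delta> \<le> p ^ D * a" unfolding a_def using large(2) n1 by (simp add: field_simps)
  have pa: "0 < p ^ D * a" using p a by simp
  have "\<exists>u\<in>I. \<exists>v\<in>I. \<exists>X Y. u \<noteq> v \<and> X \<subseteq> C u \<and> Y \<subseteq> C v \<and> p ^ D * a \<le> real (card Y) \<and>
    (p ^ D * a - \<delta>) / real n \<le> real (card X) \<and> sparse c col p X Y"
  proof (rule ccontr)
    assume no: "\<not> ?thesis"
    have "\<exists>\<psi>. copy col I A \<phi> V \<psi> \<and> (\<forall>v\<in>I. \<psi> v \<in> C v)"
    proof (rule greedy_embedding[where a = a and p = p and D = D and d = d, OF I good])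
      show "C v \<subseteq> V" if "v \<in> I" for v using C(1)[OF that] Z by blast
      show "a \<le> real (card (C v))" if "v \<in> I" for v using C(2)[OF that] unfolding a_def .
      show "\<delta> < p ^ D * a" using da pa by linarith
    qed (use C(3) p D no in blast)+
    then obtain \<psi> where "copy col I A \<phi> V \<psi>" "\<forall>v\<in>I. \<psi> v \<in> C v" by blast
    then have "copy col I A \<phi> Z \<psi>" unfolding copy_def using C(1) by blast
    then show False using no_copy by blast
  qed
  then obtain u v X Y where h: "u \<in> I" "v \<in> I" "u \<noteq> v" "X \<subseteq> C u" "Y \<subseteq> C v" "p ^ D * a \<le> real (card Y)"
    "(p ^ D * a - \<delta>) / real n \<le> real (card X)" "sparse c col p X Y" by blast
  show ?thesis
  proof (rule that[of X Y])
    show "X \<subseteq> Z" "Y \<subseteq> Z" using h C(1) by blast+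
    show "before X Y \<or> before Y X"
      using h C(3)[of u v] C(3)[of v u] before_subset by (metis linorder_neqE_nat)
    show "sparse c col p X Y" by fact
    have "p ^ D * real (card Z) / (4 * real n ^ 2) = (p ^ D * a / 2) / real n"
      unfolding a_def by (simp add: power2_eq_square)
    also have "\<dots> \<le> (p ^ D * a - \<delta>) / real n"
      using da n1 by (intro divide_right_mono) linarith+
    finally show 1: "p ^ D * real (card Z) / (4 * real n ^ 2) \<le> real (card X)" using h(7) by linarith
    have "(p ^ D * a / 2) / real n \<le> p ^ D * a / 1"
      using less_imp_le[OF pa] n1 by (intro frac_le) linarith+
    then show "p ^ D * real (card Z) / (4 * real n ^ 2) \<le> real (card Y)"
      using h(6) \<open>p ^ D * real (card Z) / (4 * real n ^ 2) = (p ^ D * a / 2) / real n\<close> by linarith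
  qed
qed

text \<open>
  Copies have to extend prescribed good embeddings \<open>\<phi>\<close>, \<open>\<chi>\<close> of other vertices, since a target that was
  split is embedded one part after the other.
\<close>

definition ram :: "bool \<Rightarrow> nat set \<Rightarrow> nat set \<Rightarrow> real \<Rightarrow> bool" where
  "ram col I J N \<longleftrightarrow> (\<forall>Z A \<phi> B \<chi>. Z \<subseteq> V \<longrightarrow> N \<le> real (card Z) \<longrightarrow> A \<subseteq> U \<longrightarrow> B \<subseteq> U \<longrightarrow>
     I \<inter> A = {} \<longrightarrow> J \<inter> B = {} \<longrightarrow> Good col A \<phi> \<longrightarrow> Good (\<not> col) B \<chi> \<longrightarrow>
     (\<exists>\<psi>. copy col I A \<phi> Z \<psi>) \<or> (\<exists>\<psi>. copy (\<not> col) J B \<chi> Z \<psi>))"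

lemma ram_swap: "ram col I J N \<Longrightarrow> ram (\<not> col) J I N"
  unfolding ram_def by simp blast

lemma ram_mono: "ram col I J N \<Longrightarrow> N \<le> N' \<Longrightarrow> ram col I J N'"
  unfolding ram_def by (meson order_trans)

lemma copy_mono: "copy col I A \<phi> Z \<psi> \<Longrightarrow> Z \<subseteq> Z' \<Longrightarrow> copy col I A \<phi> Z' \<psi>"
  unfolding copy_def by blast

section \<open>Gluing the two parts of a target along a pair of sets\<close>

lemma copy_union:
  assumes P: "copy col P B \<chi> X \<psi>" and Q: "copy col Q (B \<union> P) \<psi> Y \<psi>'"
    and cross: "\<And>x y. x \<in> \<psi> ` P \<Longrightarrow> y \<in> Y \<Longrightarrow> c {x, y} = col"
    and ord: "\<And>u v. u \<in> P \<Longrightarrow> v \<in> Q \<Longrightarrow> (u < v \<and> before X Y) \<or> (v < u \<and> before Y X)"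
  shows "copy col (P \<union> Q) B \<chi> (X \<union> Y) \<psi>'"
proof -
  have same: "\<psi>' u = \<psi> u" if "u \<in> B \<union> P" for u using Q that unfolding copy_def by blast
  have PX: "\<psi>' u \<in> X" if "u \<in> P" for u using P that same unfolding copy_def by auto
  have QY: "\<psi>' v \<in> Y" if "v \<in> Q" for v using Q that unfolding copy_def by auto
  show ?thesis
    unfolding copy_def
  proof (intro conjI ballI impI)
    show "\<psi>' a = \<chi> a" if "a \<in> B" for a using that same P unfolding copy_def by auto
    show "\<psi>' u \<in> X \<union> Y" if "u \<in> P \<union> Q" for u using that PX QY by blast
    show "\<psi>' u < \<psi>' v" if h: "u \<in> P \<union> Q" "v \<in> P \<union> Q" "u < v" for u v
    proof -
      consider "u \<in> P" "v \<in> P" | "u \<in> Q" "v \<in> Q" | "u \<in> P" "v \<in> Q" | "u \<in> Q" "v \<in> P" using h by blast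
      then show ?thesis
      proof cases
        case 1 then show ?thesis using P h(3) same unfolding copy_def by auto
      next
        case 2 then show ?thesis using Q h(3) unfolding copy_def by auto
      next
        case 3 then show ?thesis using ord[OF 3] h(3) PX QY unfolding before_def by (metis order_less_asym)
      next
        case 4 then show ?thesis using ord[OF 4(2,1)] h(3) PX QY unfolding before_def by (metis order_less_asym)
      qed
    qed
    show "c {\<psi>' u, \<psi>' v} = col" if h: "u \<in> P \<union> Q" "v \<in> P \<union> Q" "{u, v} \<in> E" for u v
    proof -
      consider "u \<in> P" "v \<in> P" | "u \<in> Q" "v \<in> Q" | "u \<in> P" "v \<in> Q" | "u \<in> Q" "v \<in> P" using h by blast
      then show ?thesis
      proof cases
        case 1 then show ?thesis using P h(3) same unfolding copy_def by auto
      next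
        case 2 then show ?thesis using Q h(3) unfolding copy_def by auto
      next
        case 3 then show ?thesis using cross[of "\<psi> u" "\<psi>' v"] same[of u] QY by auto
      next
        case 4 then show ?thesis using cross[of "\<psi> v" "\<psi>' u"] same[of v] QY by (auto simp: insert_commute)
      qed
    qed
    show "Good col (B \<union> (P \<union> Q)) \<psi>'" using Q unfolding copy_def by (simp add: Un_assoc)
  qed
qed

text \<open>\<open>P\<close> is placed in \<open>X\<close> first, and \<open>Q\<close> then in the
  common neighbourhood in \<open>Y\<close> of the image of \<open>P\<close>, so all edges between
  the parts get the right colour. In either step the alternative, a copy of \<open>I\<close>, would
  already be a copy in \<open>Z\<close>.\<close>

lemma ram_pair_aux:
  assumes ram: "ram col I P N" "ram col I Q N"
    and sub: "P \<subseteq> U" "Q \<subseteq> U" "P \<inter> Q = {}" and Z: "Z \<subseteq> V" "X \<subseteq> Z" "Y \<subseteq> Z"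
    and ord: "\<And>u v. u \<in> P \<Longrightarrow> v \<in> Q \<Longrightarrow> (u < v \<and> before X Y) \<or> (v < u \<and> before Y X)"
    and X: "N \<le> real (card X)"
    and T: "\<And>T. T \<subseteq> X \<Longrightarrow> card T \<le> card P \<Longrightarrow> N \<le> real (card {y \<in> Y. \<forall>x\<in>T. c {x, y} = (\<not> col)})"
    and AB: "A \<subseteq> U" "B \<subseteq> U" "I \<inter> A = {}" "(P \<union> Q) \<inter> B = {}" "Good col A \<phi>" "Good (\<not> col) B \<chi>"
  shows "(\<exists>\<psi>. copy col I A \<phi> Z \<psi>) \<or> (\<exists>\<psi>. copy (\<not> col) (P \<union> Q) B \<chi> Z \<psi>)"
proof (cases "\<exists>\<psi>. copy col I A \<phi> Z \<psi>")
  case no: False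
  have "(\<exists>\<psi>. copy col I A \<phi> X \<psi>) \<or> (\<exists>\<psi>. copy (\<not> col) P B \<chi> X \<psi>)"
    using ram(1)[unfolded ram_def, rule_format, of X A B \<phi> \<chi>] X Z AB by blast
  then obtain \<psi> where \<psi>: "copy (\<not> col) P B \<chi> X \<psi>" using no copy_mono Z(2) by blast
  define Y' where "Y' = {y \<in> Y. \<forall>x\<in>\<psi> ` P. c {x, y} = (\<not> col)}"
  have finP: "finite P" using sub(1) fin_U finite_subset by blast
  have "N \<le> real (card Y')"
    unfolding Y'_def using \<psi> card_image_le[OF finP] by (intro T) (auto simp: copy_def)
  moreover have "Y' \<subseteq> Z" unfolding Y'_def using Z by auto
  moreover have "Good (\<not> col) (B \<union> P) \<psi>" using \<psi> unfolding copy_def by blast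
  moreover have "B \<union> P \<subseteq> U" "Q \<inter> (B \<union> P) = {}" "Y' \<subseteq> V" using AB sub Z \<open>Y' \<subseteq> Z\<close> by auto
  ultimately have "(\<exists>\<psi>'. copy col I A \<phi> Y' \<psi>') \<or> (\<exists>\<psi>'. copy (\<not> col) Q (B \<union> P) \<psi> Y' \<psi>')"
    using ram(2)[unfolded ram_def, rule_format, of Y' A "B \<union> P" \<phi> \<psi>] AB by blast
  then obtain \<psi>' where \<psi>': "copy (\<not> col) Q (B \<union> P) \<psi> Y' \<psi>'" using no copy_mono \<open>Y' \<subseteq> Z\<close> by blast
  have "copy (\<not> col) (P \<union> Q) B \<chi> (X \<union> Y') \<psi>'"
  proof (rule copy_union[OF \<psi> \<psi>'])
    show "c {x, y} = (\<not> col)" if "x \<in> \<psi> ` P" "y \<in> Y'" for x y using that unfolding Y'_def by blast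
    show "(u < v \<and> before X Y') \<or> (v < u \<and> before Y' X)" if "u \<in> P" "v \<in> Q" for u v
      using ord[OF that] unfolding Y'_def before_def by auto
  qed
  then have "copy (\<not> col) (P \<union> Q) B \<chi> Z \<psi>'" using copy_mono Z(2) \<open>Y' \<subseteq> Z\<close> by blast
  then show ?thesis by blast
qed blast

text \<open>The pair is one-sided: \<open>X\<close> has to be filled first, whichever side it lies
  on. So the left part of the target goes first if \<open>X\<close> precedes \<open>Y\<close>, and
  the right part otherwise.\<close>

lemma ram_pair:
  assumes ram: "ram col I L N" "ram col I R N"
    and sub: "L \<subseteq> U" "R \<subseteq> U" "before L R" and Z: "Z \<subseteq> V" "X \<subseteq> Z" "Y \<subseteq> Z"
    and XY: "before X Y \<or> before Y X"
    and X: "N \<le> real (card X)"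
    and T: "\<And>T. T \<subseteq> X \<Longrightarrow> card T \<le> card (L \<union> R) \<Longrightarrow> N \<le> real (card {y \<in> Y. \<forall>x\<in>T. c {x, y} = (\<not> col)})"
    and AB: "A \<subseteq> U" "B \<subseteq> U" "I \<inter> A = {}" "(L \<union> R) \<inter> B = {}" "Good col A \<phi>" "Good (\<not> col) B \<chi>"
  shows "(\<exists>\<psi>. copy col I A \<phi> Z \<psi>) \<or> (\<exists>\<psi>. copy (\<not> col) (L \<union> R) B \<chi> Z \<psi>)"
proof -
  have fin: "finite (L \<union> R)" using sub fin_U finite_subset by (metis finite_Un)
  have disj: "L \<inter> R = {}" using sub(3) unfolding before_def by auto
  have le: "card L \<le> card (L \<union> R)" "card R \<le> card (L \<union> R)" using fin by (auto intro: card_mono)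
  show ?thesis
  proof (cases "before X Y")
    case True
    show ?thesis
    proof (rule ram_pair_aux[OF ram sub(1,2) disj Z])
      show "u < v \<and> before X Y \<or> v < u \<and> before Y X" if "u \<in> L" "v \<in> R" for u v
        using that sub(3) True unfolding before_def[of L] by blast
      show "N \<le> real (card {y \<in> Y. \<forall>x\<in>T. c {x, y} = (\<not> col)})" if "T \<subseteq> X" "card T \<le> card L" for T
        using T[OF that(1)] that(2) le by simp
    qed (use X AB in auto)
  next
    case False
    then have YX: "before Y X" using XY by blast
    have "(\<exists>\<psi>. copy col I A \<phi> Z \<psi>) \<or> (\<exists>\<psi>. copy (\<not> col) (R \<union> L) B \<chi> Z \<psi>)"
    proof (rule ram_pair_aux[OF ram(2,1) sub(2,1) _ Z])
      show "R \<inter> L = {}" using disj by blast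
      show "u < v \<and> before X Y \<or> v < u \<and> before Y X" if "u \<in> R" "v \<in> L" for u v
        using that sub(3) YX unfolding before_def[of L] by blast
      show "N \<le> real (card {y \<in> Y. \<forall>x\<in>T. c {x, y} = (\<not> col)})" if "T \<subseteq> X" "card T \<le> card R" for T
        using T[OF that(1)] that(2) le by simp
    qed (use X AB in auto)
    then show ?thesis by (simp add: Un_commute)
  qed
qed

lemma ram_trivial:
  assumes "J \<subseteq> U" "card J \<le> 1" "\<delta> < N"
  shows "ram col I J N"
  unfolding ram_def
proof (intro allI impI)
  fix Z A \<phi> B \<chi>
  assume h: "Z \<subseteq> V" "N \<le> real (card Z)" "A \<subseteq> U" "B \<subseteq> U" "I \<inter> A = {}" "J \<inter> B = {}" "Good col A \<phi>" "Good (\<not> col) B \<chi>"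
  have "finite J" using assms(1) fin_U finite_subset by blast
  then consider "J = {}" | v where "J = {v}" using assms(2) by (metis card_0_eq card_1_singletonE le_eq_less_or_eq less_one)
  then have "\<exists>\<psi>. copy (\<not> col) J B \<chi> Z \<psi>"
  proof cases
    case 1
    then have "copy (\<not> col) J B \<chi> Z \<chi>" using h(8) unfolding copy_def by auto
    then show ?thesis by blast
  next
    case 2
    define bad where "bad = {x \<in> V. \<not> Good (\<not> col) (insert v B) (\<chi>(v := x))}"
    have vB: "v \<in> U - B" using 2 h assms(1) by auto
    have "real (card bad) \<le> \<delta>" unfolding bad_def using Good_insert[OF h(8,4) vB] .
    then have "card bad < card Z" using h(2) assms(3) by linarith
    moreover have "finite bad" unfolding bad_def using fin_V by simp
    note card_mono[OF this, of Z]
    ultimately have "\<not> Z \<subseteq> bad" by linarith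
    then obtain x where x: "x \<in> Z" "x \<notin> bad" by blast
    have "copy (\<not> col) J B \<chi> Z (\<chi>(v := x))"
      unfolding copy_def 2 using x h(1) vB edge_ne[of v v] unfolding bad_def by auto
    then show ?thesis by blast
  qed
  then show "(\<exists>\<psi>. copy col I A \<phi> Z \<psi>) \<or> (\<exists>\<psi>. copy (\<not> col) J B \<chi> Z \<psi>)" by blast
qed

lemma sparse_common:
  assumes sp: "sparse c col p X Y" "finite Y" "T \<subseteq> X" "finite T"
  shows "(1 - real (card T) * p) * real (card Y) \<le> real (card {y \<in> Y. \<forall>x\<in>T. c {x, y} = (\<not> col)})"
proof -
  let ?b = "\<lambda>x. {y \<in> Y. c {x, y} = col}"
  let ?G = "{y \<in> Y. \<forall>x\<in>T. c {x, y} = (\<not> col)}"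
  have "Y \<subseteq> ?G \<union> (\<Union>x\<in>T. ?b x)" "finite (?G \<union> (\<Union>x\<in>T. ?b x))" using assms(2,4) by auto
  then have "card Y \<le> card (?G \<union> (\<Union>x\<in>T. ?b x))" by (intro card_mono)
  also have "\<dots> \<le> card ?G + card (\<Union>x\<in>T. ?b x)" by (rule card_Un_le)
  also have "card (\<Union>x\<in>T. ?b x) \<le> (\<Sum>x\<in>T. card (?b x))" by (rule card_UN_le[OF assms(4)])
  finally have 1: "real (card Y) \<le> real (card {y \<in> Y. \<forall>x\<in>T. c {x, y} = (\<not> col)}) + (\<Sum>x\<in>T. real (card (?b x)))"
    unfolding of_nat_sum[symmetric] of_nat_add[symmetric] of_nat_le_iff by simp
  have "(\<Sum>x\<in>T. real (card (?b x))) \<le> real (card T) * (p * real (card Y))"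
    using sp(1,3) unfolding sparse_def by (intro sum_bounded_above) (auto intro: less_imp_le)
  then show ?thesis using 1 by (simp add: algebra_simps)
qed

text \<open>With \<open>p = 1 / (2 n)\<close> any at most \<open>n\<close> points of
  \<open>X\<close> keep half of \<open>Y\<close> as a common neighbourhood, by a plain union bound.
  Only \<open>J\<close> is halved, by number of vertices, and each of the \<open>k\<close> rounds
  pays \<open>(2 n) ^ D\<close> for \<open>I\<close> and \<open>8 * n ^ 2\<close>, the loss in
  \<open>sparse_pair\<close> times 2 for the half of \<open>Y\<close>. The last factor keeps the
  sets large enough for \<open>sparse_pair\<close> in every round. This bound ends both recursions
  and also serves alone for small \<open>m\<close>.\<close>

lemma crude_ram:
  fixes d :: "nat \<Rightarrow> nat"
  assumes I: "I \<subseteq> U"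
    and D: "\<And>v. v \<in> I \<Longrightarrow> card {u \<in> I. d v \<le> d u \<and> {u, v} \<in> E} \<le> D"
    and J: "J \<subseteq> U" "card J \<le> 2 ^ k"
  shows "ram col I J ((8 * real n ^ 2 * (2 * real n) ^ D) ^ k * (4 * real n * (\<delta> + 1) * (2 * real n) ^ D))"
  using J
proof (induction k arbitrary: J)
  case 0
  have "\<delta> + 1 \<le> 4 * real n * (\<delta> + 1) * (2 * real n) ^ D"
  proof -
    have D1: "1 \<le> (2 * real n) ^ D" using n_pos by (intro one_le_power) simp
    have "\<delta> + 1 = 1 * (\<delta> + 1) * 1" by simp
    also have "\<dots> \<le> 4 * real n * (\<delta> + 1) * (2 * real n) ^ D"
      using delta_nonneg n_pos D1 by (intro mult_mono mult_nonneg_nonneg) auto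
    finally show ?thesis .
  qed
  then show ?case using 0 by (intro ram_trivial) auto
next
  case (Suc k)
  define M where "M = (8 * real n ^ 2 * (2 * real n) ^ D) ^ k * (4 * real n * (\<delta> + 1) * (2 * real n) ^ D)"
  define Q where "Q = (2 * real n) ^ D"
  have finJ: "finite J" using Suc.prems fin_U finite_subset by blast
  have "card J div 2 \<le> card J" by simp
  from split_at_card[OF finJ this]
  obtain L R where LR: "J = L \<union> R" "before L R" "card L = card J div 2" "card R = card J - card J div 2" by metis
  have "card L \<le> 2 ^ k" "card R \<le> 2 ^ k" using LR Suc.prems(2) by auto
  then have ram: "ram col I L M" "ram col I R M"
    unfolding M_def using Suc.IH LR(1) Suc.prems(1) by auto
  have n1: "1 \<le> real n" using n_pos by simp
  have Q1: "1 \<le> Q" unfolding Q_def using n1 by (intro one_le_power) simp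
  have M1: "4 * real n * (\<delta> + 1) * Q \<le> M"
  proof -
    have "1 \<le> real n ^ 2" using n1 by (rule one_le_power)
    then have "1 * 1 \<le> (8 * real n ^ 2) * Q" using Q1 by (intro mult_mono) auto
    then have "1 \<le> (8 * real n ^ 2 * Q) ^ k" by (intro one_le_power) simp
    then have "1 * (4 * real n * (\<delta> + 1) * Q) \<le> (8 * real n ^ 2 * Q) ^ k * (4 * real n * (\<delta> + 1) * Q)"
      using delta_nonneg n1 Q1 by (intro mult_right_mono) auto
    then show ?thesis unfolding M_def Q_def by simp
  qed
  have "0 < 4 * real n * (\<delta> + 1) * Q" using n1 delta_nonneg Q1 by (intro mult_pos_pos) auto
  then have Mpos: "0 < M" using M1 by linarith
  have goal: "ram col I J (8 * real n ^ 2 * Q * M)"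
    unfolding ram_def
  proof (intro allI impI)
    fix Z A \<phi> B \<chi>
    assume h: "Z \<subseteq> V" "8 * real n ^ 2 * Q * M \<le> real (card Z)" "A \<subseteq> U" "B \<subseteq> U" "I \<inter> A = {}" "J \<inter> B = {}" "Good col A \<phi>" "Good (\<not> col) B \<chi>"
    show "(\<exists>\<psi>. copy col I A \<phi> Z \<psi>) \<or> (\<exists>\<psi>. copy (\<not> col) J B \<chi> Z \<psi>)"
    proof (cases "\<exists>\<psi>. copy col I A \<phi> Z \<psi>")
      case False
      have p: "0 < 1 / (2 * real n)" "1 / (2 * real n) \<le> 1" using n1 by (auto simp: field_simps)
      have pD: "(1 / (2 * real n)) ^ D = 1 / Q" unfolding Q_def by (simp add: power_one_over)
      have n2: "1 \<le> real n ^ 2" using n1 by (rule one_le_power)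
      have c1: "M \<le> real (card Z)"
      proof -
        have "1 * 1 \<le> 8 * real n ^ 2 * Q" using n2 Q1 by (intro mult_mono) auto
        then have "1 * M \<le> 8 * real n ^ 2 * Q * M" using Mpos by (intro mult_right_mono) auto
        then show ?thesis using h(2) by simp
      qed
      have c2: "2 * real n \<le> real (card Z)"
      proof -
        have "2 * real n = 2 * real n * 1 * 1" by simp
        also have "\<dots> \<le> 4 * real n * (\<delta> + 1) * Q"
          using n1 delta_nonneg Q1 by (intro mult_mono) auto
        finally show ?thesis using M1 c1 by linarith
      qed
      have c3: "4 * real n * \<delta> \<le> (1 / (2 * real n)) ^ D * real (card Z)"
      proof -
        have "4 * real n * \<delta> * Q \<le> 4 * real n * (\<delta> + 1) * Q"
          using n1 Q1 by (intro mult_right_mono mult_left_mono) auto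
        then have "4 * real n * \<delta> * Q \<le> real (card Z)" using M1 c1 by linarith
        then show ?thesis using pD Q1 by (simp add: field_simps)
      qed
      obtain X Y where XY: "X \<subseteq> Z" "Y \<subseteq> Z" "before X Y \<or> before Y X" "sparse c col (1 / (2 * real n)) X Y"
        "(1 / (2 * real n)) ^ D * real (card Z) / (4 * real n ^ 2) \<le> real (card X)"
        "(1 / (2 * real n)) ^ D * real (card Z) / (4 * real n ^ 2) \<le> real (card Y)"
        using sparse_pair[OF I h(3,5,7,1) p D c2 c3 False] by metis
      have "0 < Q * (4 * real n ^ 2)" using Q1 n1 by (intro mult_pos_pos) auto
      then have "2 * M \<le> real (card Z) / (Q * (4 * real n ^ 2))"
        using h(2) by (subst pos_le_divide_eq) (auto simp: algebra_simps)
      then have "2 * M \<le> (1 / (2 * real n)) ^ D * real (card Z) / (4 * real n ^ 2)"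
        unfolding pD by simp
      then have big: "2 * M \<le> real (card X)" "2 * M \<le> real (card Y)" using XY(5,6) by linarith+
      have finZ: "finite Z" using h(1) fin_V finite_subset by blast
      have "(\<exists>\<psi>. copy col I A \<phi> Z \<psi>) \<or> (\<exists>\<psi>. copy (\<not> col) (L \<union> R) B \<chi> Z \<psi>)"
      proof (rule ram_pair[OF ram _ _ LR(2) h(1) XY(1-3)])
        show "M \<le> real (card X)" using big Mpos by linarith
        fix T assume T: "T \<subseteq> X" "card T \<le> card (L \<union> R)"
        have "card J \<le> n" using card_mono[OF fin_U Suc.prems(1)] card_U by simp
        then have "real (card T) * (1 / (2 * real n)) \<le> 1 / 2"
          using T(2) LR(1) n1 by (simp add: field_simps)
        then have half: "(1 - 1 / 2) * real (card Y) \<le> (1 - real (card T) * (1 / (2 * real n))) * real (card Y)"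
          by (intro mult_right_mono) auto
        have "finite Y" "finite T" using XY(1,2) T(1) finZ by (meson finite_subset subset_trans)+
        then have "(1 - real (card T) * (1 / (2 * real n))) * real (card Y)
            \<le> real (card {y \<in> Y. \<forall>x\<in>T. c {x, y} = (\<not> col)})"
          using XY(4) T(1) by (intro sparse_common)
        with half have "(1 - 1 / 2) * real (card Y) \<le> real (card {y \<in> Y. \<forall>x\<in>T. c {x, y} = (\<not> col)})"
          by (rule order_trans)
        then show "M \<le> real (card {y \<in> Y. \<forall>x\<in>T. c {x, y} = (\<not> col)})" using big(2) by simp
      qed (use LR Suc.prems h in auto)
      then show ?thesis using LR(1) by simp
    qed blast
  qed
  then show ?case unfolding M_def Q_def by (simp add: mult.assoc)
qed

end

section \<open>Dependent random choice\<close>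

lemma sum_card_swap:
  assumes "finite A" "finite B"
  shows "(\<Sum>b\<in>B. real (card {a \<in> A. P a b})) = (\<Sum>a\<in>A. real (card {b \<in> B. P a b}))"
proof -
  have 1: "real (card {a \<in> A. P a b}) = (\<Sum>a\<in>A. if P a b then 1 else 0)" for b
    using assms(1) by (simp add: sum.If_cases Int_def)
  have 2: "real (card {b \<in> B. P a b}) = (\<Sum>b\<in>B. if P a b then 1 else 0)" for a
    using assms(2) by (simp add: sum.If_cases Int_def)
  show ?thesis unfolding 1 2 by (rule sum.swap)
qed

text \<open>Averaging over \<open>r\<close> points of \<open>Y\<close>, drawn with repetition. The
  common neighbourhood of the sample has expected size at least \<open>(1 - p) ^ r * card X\<close>
  and contains on average at most one bad t-tuple: a bad tuple survives with probability at most
  \<open>\<beta> ^ r\<close>, and there are at most \<open>card X ^ t\<close> of them. Deleting the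
  first entry of each surviving bad tuple thus costs at most 1 on average. Lists in place of sets
  turn all these counts into powers.\<close>

lemma dependent_random_choice:
  fixes R :: "'a \<Rightarrow> 'b \<Rightarrow> bool" and p \<beta> :: real
  assumes fin: "finite X" "finite Y"
    and deg: "\<And>x. x \<in> X \<Longrightarrow> (1 - p) * real (card Y) \<le> real (card {y \<in> Y. R x y})"
    and p: "p \<le> 1" and beta: "0 \<le> \<beta>" "\<beta> \<le> 1" and few: "real (card X) ^ t * \<beta> ^ r \<le> 1"
    and ne: "Y \<noteq> {}"
  obtains X' where "X' \<subseteq> X" "(1 - p) ^ r * real (card X) - 1 \<le> real (card X')"
    "\<And>T. T \<subseteq> X' \<Longrightarrow> card T \<le> t \<Longrightarrow> \<beta> * real (card Y) \<le> real (card {y \<in> Y. \<forall>x\<in>T. R x y})"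
proof -
  define YS where "YS = {ys. set ys \<subseteq> Y \<and> length ys = r}"
  define XS where "XS = {xs. set xs \<subseteq> X \<and> length xs = t}"
  define bad where "bad = {xs \<in> XS. real (card {y \<in> Y. \<forall>x\<in>set xs. R x y}) < \<beta> * real (card Y)}"
  define F where "F ys = {x \<in> X. \<forall>y\<in>set ys. R x y}" for ys
  define G where "G ys = {xs \<in> bad. \<forall>y\<in>set ys. \<forall>x\<in>set xs. R x y}" for ys
  have finYS: "finite YS" unfolding YS_def using fin(2) by (rule finite_lists_length_eq)
  have finXS: "finite XS" unfolding XS_def using fin(1) by (rule finite_lists_length_eq)
  have finbad: "finite bad" unfolding bad_def using finXS by simp
  have cYS: "card YS = card Y ^ r" unfolding YS_def using fin(2) by (rule card_lists_length_eq)
  have cXS: "card XS = card X ^ t" unfolding XS_def using fin(1) by (rule card_lists_length_eq)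
  have Ypos: "0 < real (card Y)" using ne fin(2) by (simp add: card_gt_0_iff)
  have lists: "card {ys \<in> YS. \<forall>y\<in>set ys. Q y} = card {y \<in> Y. Q y} ^ r" for Q
  proof -
    have "{ys \<in> YS. \<forall>y\<in>set ys. Q y} = {ys. set ys \<subseteq> {y \<in> Y. Q y} \<and> length ys = r}"
      unfolding YS_def by auto
    then show ?thesis using card_lists_length_eq[of "{y \<in> Y. Q y}" r] fin(2) by simp
  qed
  have "real (card X) * ((1 - p) * real (card Y)) ^ r \<le> (\<Sum>x\<in>X. real (card {ys \<in> YS. \<forall>y\<in>set ys. R x y}))"
    unfolding lists of_nat_power
    using deg p by (intro sum_bounded_below power_mono) auto
  also have "\<dots> = (\<Sum>ys\<in>YS. real (card (F ys)))"
    unfolding F_def by (rule sum_card_swap[OF fin(1) finYS, symmetric])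
  finally have sumF: "real (card X) * ((1 - p) * real (card Y)) ^ r \<le> (\<Sum>ys\<in>YS. real (card (F ys)))" .
  have "(\<Sum>ys\<in>YS. real (card (G ys))) = (\<Sum>xs\<in>bad. real (card {ys \<in> YS. \<forall>y\<in>set ys. \<forall>x\<in>set xs. R x y}))"
    unfolding G_def by (rule sum_card_swap[OF finbad finYS])
  also have "\<dots> \<le> real (card bad) * (\<beta> * real (card Y)) ^ r"
    unfolding lists of_nat_power bad_def
    by (intro sum_bounded_above power_mono) auto
  also have "\<dots> \<le> real (card X) ^ t * (\<beta> * real (card Y)) ^ r"
  proof (rule mult_right_mono)
    have "card bad \<le> card XS" unfolding bad_def using finXS by (intro card_mono) auto
    then show "real (card bad) \<le> real (card X) ^ t" using cXS by (metis of_nat_le_iff of_nat_power)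
  qed (use beta in simp)
  also have "\<dots> = (real (card X) ^ t * \<beta> ^ r) * real (card Y) ^ r" by (simp add: power_mult_distrib)
  also have "\<dots> \<le> 1 * real (card Y) ^ r" using few by (intro mult_right_mono) auto
  finally have sumG: "(\<Sum>ys\<in>YS. real (card (G ys))) \<le> real (card Y) ^ r" by simp
  have "\<exists>ys\<in>YS. (1 - p) ^ r * real (card X) - 1 \<le> real (card (F ys)) - real (card (G ys))"
  proof (rule ccontr)
    assume "\<not> ?thesis"
    then have less: "real (card (F ys)) - real (card (G ys)) < (1 - p) ^ r * real (card X) - 1" if "ys \<in> YS" for ys
      using that by (meson linorder_not_le)
    have "YS \<noteq> {}" using cYS Ypos by (metis card.empty of_nat_0_less_iff power_eq_0_iff less_numeral_extra(3))
    then have "(\<Sum>ys\<in>YS. real (card (F ys)) - real (card (G ys))) < (\<Sum>ys\<in>YS. (1 - p) ^ r * real (card X) - 1)"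
      using less finYS by (intro sum_strict_mono) auto
    also have "\<dots> = real (card Y) ^ r * ((1 - p) ^ r * real (card X) - 1)" using cYS by simp
    finally have "(\<Sum>ys\<in>YS. real (card (F ys))) < real (card X) * ((1 - p) * real (card Y)) ^ r"
      unfolding power_mult_distrib using sumG by (simp add: sum_subtractf right_diff_distrib mult.commute mult.left_commute)
    then show False using sumF by linarith
  qed
  then obtain ys where ys: "ys \<in> YS" "(1 - p) ^ r * real (card X) - 1 \<le> real (card (F ys)) - real (card (G ys))" by blast
  define X' where "X' = F ys - hd ` G ys"
  have finG: "finite (G ys)" unfolding G_def using finbad by simp
  have finF: "finite (F ys)" unfolding F_def using fin(1) by simp
  show ?thesis
  proof (rule that[of X'])
    show "X' \<subseteq> X" unfolding X'_def F_def by auto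
    have "card (F ys) \<le> card X' + card (hd ` G ys)"
      unfolding X'_def using finF finG diff_card_le_card_Diff[of "hd ` G ys" "F ys"] by simp
    moreover have "card (hd ` G ys) \<le> card (G ys)" using finG by (rule card_image_le)
    ultimately show "(1 - p) ^ r * real (card X) - 1 \<le> real (card X')" using ys(2) by linarith
    fix T assume T: "T \<subseteq> X'" "card T \<le> t"
    show "\<beta> * real (card Y) \<le> real (card {y \<in> Y. \<forall>x\<in>T. R x y})"
    proof (rule ccontr)
      assume not: "\<not> ?thesis"
      have "T \<noteq> {}"
      proof
        assume "T = {}"
        moreover have "\<beta> * real (card Y) \<le> 1 * real (card Y)" using beta by (intro mult_right_mono) auto
        ultimately show False using not by simp
      qed
      moreover have finT: "finite T" using T(1) finF finite_subset unfolding X'_def by blast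
      ultimately obtain x0 where x0: "x0 \<in> T" by blast
      obtain zs where zs: "set zs = T" "length zs = card T" using finT finite_distinct_list distinct_card by metis
      \<comment> \<open>Bad tuples all have length \<open>t\<close>, so a smaller \<open>T\<close>
        is padded by repeating one of its points, which leaves the common neighbourhood
        unchanged.\<close>
      define xs where "xs = zs @ replicate (t - card T) x0"
      have xs: "set xs = T" "length xs = t" unfolding xs_def using zs x0 T(2) by auto
      have TF: "T \<subseteq> F ys" using T(1) unfolding X'_def by blast
      have "xs \<in> bad" unfolding bad_def XS_def using xs not TF unfolding F_def by auto
      then have "xs \<in> G ys" unfolding G_def using xs TF unfolding F_def by auto
      then have "hd xs \<in> hd ` G ys" by blast
      moreover have "hd xs \<in> T" using xs x0 by (metis empty_iff hd_in_set list.set(1))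
      ultimately show False using T(1) unfolding X'_def by blast
    qed
  qed
qed

text \<open>The cut is made just before the vertex at which the prefix weight first exceeds one
  half. The left part weighs at most a half, and at least a quarter because that one vertex carries
  at most a quarter.\<close>

lemma split_by_weight:
  fixes w :: "nat \<Rightarrow> nat"
  assumes fin: "finite J" and w: "\<And>v. v \<in> J \<Longrightarrow> 4 * w v \<le> sum w J" and pos: "0 < sum w J"
  obtains L R where "J = L \<union> R" "before L R" "4 * sum w L \<le> 3 * sum w J" "4 * sum w R \<le> 3 * sum w J"
proof -
  define f where "f k = sum w {v \<in> J. v < k}" for k
  have "{v \<in> J. v < Suc (Max J)} = J" using fin by (auto simp: less_Suc_eq_le)
  then have ex: "sum w J < 2 * f (Suc (Max J))" unfolding f_def using pos by simp
  define k0 where "k0 = (LEAST k. sum w J < 2 * f k)"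
  have k0: "sum w J < 2 * f k0" unfolding k0_def using ex by (rule LeastI)
  have "f 0 = 0" unfolding f_def by simp
  then have "k0 \<noteq> 0" using k0 by (metis mult_0_right not_less0)
  then obtain k where k: "k0 = Suc k" using not0_implies_Suc by blast
  then have nk: "\<not> sum w J < 2 * f k" unfolding k0_def using not_less_Least[of k "\<lambda>k. sum w J < 2 * f k"] by simp
  have f_Suc: "f (Suc k) \<le> f k + (if k \<in> J then w k else 0)"
  proof (cases "k \<in> J")
    case True
    have "{v \<in> J. v < Suc k} = insert k {v \<in> J. v < k}" using True by auto
    then show ?thesis unfolding f_def using fin True by simp
  next
    case False
    have "{v \<in> J. v < Suc k} = {v \<in> J. v < k}" using False by (auto simp: less_Suc_eq)
    then show ?thesis unfolding f_def by simp
  qed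
  have "4 * (if k \<in> J then w k else 0) \<le> sum w J" using w by auto
  \<comment> \<open>Between natural numbers the \<open>+ 1\<close> makes this the statement that the
    left part has at least a quarter of the weight.\<close>
  then have fk: "sum w J < 4 * f k + 1" using k0 f_Suc unfolding k by linarith
  define L where "L = {v \<in> J. v < k}"
  have LJ: "L \<subseteq> J" unfolding L_def by auto
  have tot: "sum w J = sum w (J - L) + sum w L" by (rule sum.subset_diff[OF LJ fin])
  have fL: "f k = sum w L" unfolding f_def L_def ..
  show ?thesis
  proof (rule that[of L "J - L"])
    show "J = L \<union> (J - L)" using LJ by auto
    show "before L (J - L)" unfolding before_def L_def by auto
    show "4 * sum w L \<le> 3 * sum w J" using nk fL by linarith
    show "4 * sum w (J - L) \<le> 3 * sum w J" using fk fL tot by linarith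
  qed
qed

section \<open>The inner recursion\<close>

text \<open>\<open>47 / 50\<close> is a convenient rational above the fourth root of
  \<open>3 / 4\<close>. The constants of both recursions come from the remaining proportion
  \<open>3 / 50\<close>.\<close>

lemma sqrt_sqrt_shrink:
  fixes x y :: real
  assumes "0 \<le> x" "y \<le> 3 / 4 * x"
  shows "sqrt (sqrt y) \<le> 47 / 50 * sqrt (sqrt x)"
proof -
  have "y \<le> (47 / 50) ^ 4 * x"
    by (rule order_trans[OF assms(2)]) (use assms(1) in \<open>intro mult_right_mono, auto simp: power4_eq_xxxx\<close>)
  then have "sqrt (sqrt y) \<le> sqrt (sqrt ((47 / 50) ^ 4 * x))" by simp
  also have "(47 / 50 :: real) ^ 4 = ((47 / 50)\<^sup>2)\<^sup>2" by simp
  also have "sqrt (sqrt (((47 / 50)\<^sup>2)\<^sup>2 * x)) = 47 / 50 * sqrt (sqrt x)"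
    unfolding real_sqrt_mult real_sqrt_abs by simp
  finally show ?thesis .
qed

context colouring
begin

context
  notes of_nat_sum [simp del]
begin

text \<open>Let \<open>x\<close> be the fourth root of the product of the weights. Splitting the
  heavier target lowers \<open>50 * lam * x\<close> to at most \<open>47 * lam * x\<close>. The
  three units \<open>lam * x\<close> released pay for one step: \<open>p ^ D\<close> with
  \<open>p = exp (- lam)\<close> and \<open>D \<le> x\<close> for the greedy embedding of the
  lighter target, \<open>8 * n ^ 2 \<le> exp \<theta>\<close> for the pieces, and
  \<open>exp \<theta>\<close> for dependent random choice. Here \<open>\<theta> \<le> x\<close>, as
  long as both weights exceed \<open>\<theta> ^ 2\<close>; otherwise \<open>base\<close> takes
  over.\<close>

lemma inner_ram:
  fixes w d :: "nat \<Rightarrow> nat" and lam \<theta> \<Lambda> N :: real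
  assumes degen: "\<And>I v. I \<subseteq> U \<Longrightarrow> v \<in> I \<Longrightarrow> (card {u \<in> I. d v \<le> d u \<and> {u, v} \<in> E})\<^sup>2 \<le> sum w I"
    and w: "\<And>v. v \<in> U \<Longrightarrow> 4 * real (w v) \<le> \<theta>\<^sup>2"
    and lam: "1 \<le> lam" and theta: "1 \<le> \<theta>" "8 * real n ^ 2 \<le> exp \<theta>"
    and V: "real (card V) \<le> exp \<Lambda>" "0 \<le> \<Lambda>"
    and drc: "4 * (real (card U) * \<Lambda> + 1) \<le> \<theta>\<^sup>2 * exp lam"
    and N: "4 * real n * (\<delta> + 1) \<le> N"
    and base: "\<And>col I J. I \<subseteq> U \<Longrightarrow> J \<subseteq> U \<Longrightarrow> real (sum w I) \<le> \<theta>\<^sup>2 \<Longrightarrow> ram col I J N"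
    and IJ: "I \<subseteq> U" "J \<subseteq> U"
  shows "ram col I J (N * exp (50 * lam * sqrt (sqrt (real (sum w I) * real (sum w J)))))"
  using IJ
proof (induction "sum w I + sum w J" arbitrary: col I J rule: less_induct)
  case less
  have n1: "1 \<le> real n" using n_pos by simp
  have N1: "1 \<le> N"
  proof -
    have "1 * 1 \<le> 4 * real n * (\<delta> + 1)" using n1 delta_nonneg by (intro mult_mono) auto
    then show ?thesis using N by simp
  qed
  have step: "ram col I J (N * exp (50 * lam * sqrt (sqrt (real (sum w I) * real (sum w J)))))"
    if sub: "I \<subseteq> U" "J \<subseteq> U" and wI: "\<theta>\<^sup>2 < real (sum w I)" and le: "sum w I \<le> sum w J"
      and IH: "\<And>J'. J' \<subseteq> U \<Longrightarrow> sum w J' < sum w J \<Longrightarrow>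
        ram col I J' (N * exp (50 * lam * sqrt (sqrt (real (sum w I) * real (sum w J')))))" for col I J
  proof -
    define x where "x = sqrt (sqrt (real (sum w I) * real (sum w J)))"
    define D where "D = nat \<lfloor>x\<rfloor>"
    have xI: "sqrt (real (sum w I)) \<le> x"
    proof -
      have "real (sum w I) ^ 2 \<le> real (sum w I) * real (sum w J)"
        unfolding power2_eq_square using le by (intro mult_left_mono) auto
      then have "real (sum w I) \<le> sqrt (real (sum w I) * real (sum w J))" by (rule real_le_rsqrt)
      then show ?thesis unfolding x_def by (rule real_sqrt_le_mono)
    qed
    have xt: "\<theta> \<le> x"
    proof -
      have "\<theta> = sqrt (\<theta>\<^sup>2)" using theta by simp
      also have "\<dots> \<le> sqrt (real (sum w I))" using wI by (intro real_sqrt_le_mono) simp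
      finally show ?thesis using xI by linarith
    qed
    have x0: "1 \<le> x" using xt theta by linarith
    have Dx: "real D \<le> x" unfolding D_def using x0 by linarith
    have finJ: "finite J" "finite I" using sub fin_U finite_subset by blast+
    have wJ: "4 * w v \<le> sum w J" if "v \<in> J" for v
    proof -
      have "4 * real (w v) \<le> real (sum w J)" using w[of v] that sub wI le by fastforce
      then show ?thesis by linarith
    qed
    have posJ: "0 < sum w J"
    proof -
      have "0 < real (sum w I)" using wI theta by (smt (verit) zero_le_power2)
      then show ?thesis using le by linarith
    qed
    obtain L R where LR: "J = L \<union> R" "before L R" "4 * sum w L \<le> 3 * sum w J" "4 * sum w R \<le> 3 * sum w J"
      using split_by_weight[OF finJ(1) wJ posJ] by metis
    define M where "M = N * exp (47 * lam * x)"
    have ramM: "ram col I J' M" if J': "J' \<subseteq> U" "4 * sum w J' \<le> 3 * sum w J" for J'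
    proof (rule ram_mono)
      show "ram col I J' (N * exp (50 * lam * sqrt (sqrt (real (sum w I) * real (sum w J')))))"
        using IH[OF J'(1)] J'(2) posJ by linarith
      have "4 * real (sum w J') \<le> 3 * real (sum w J)" using J'(2) by linarith
      then have "real (sum w I) * (4 * real (sum w J')) \<le> real (sum w I) * (3 * real (sum w J))"
        by (intro mult_left_mono) auto
      then have "sqrt (sqrt (real (sum w I) * real (sum w J'))) \<le> 47 / 50 * x"
        unfolding x_def by (intro sqrt_sqrt_shrink) (auto simp: algebra_simps)
      then have "50 * lam * sqrt (sqrt (real (sum w I) * real (sum w J'))) \<le> 50 * lam * (47 / 50 * x)"
        using lam by (intro mult_left_mono) auto
      then show "N * exp (50 * lam * sqrt (sqrt (real (sum w I) * real (sum w J')))) \<le> M"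
        unfolding M_def using N1 by (intro mult_left_mono) auto
    qed
    have LU: "L \<subseteq> U" "R \<subseteq> U" using LR(1) sub by auto
    have Mpos: "N \<le> M" unfolding M_def using N1 lam x0 by (simp add: mult_le_cancel_left1)
    define p where "p = exp (- lam)"
    have p: "0 < p" "p \<le> 1 / 2"
    proof -
      show "0 < p" unfolding p_def by simp
      have "exp (- lam) \<le> exp (- 1)" using lam by simp
      also have "\<dots> \<le> 1 / 2" using exp_ge_add_one_self[of 1] by (simp add: exp_minus field_simps)
      finally show "p \<le> 1 / 2" unfolding p_def .
    qed
    have pD: "exp (- lam * x) \<le> p ^ D"
    proof -
      have "p ^ D = exp (- lam * real D)" unfolding p_def by (simp add: exp_of_nat_mult[symmetric] mult.commute)
      then show ?thesis using Dx lam by simp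
    qed
    show ?thesis
      unfolding ram_def x_def[symmetric]
    proof (intro allI impI)
      fix Z A \<phi> B \<chi>
      assume h: "Z \<subseteq> V" "N * exp (50 * lam * x) \<le> real (card Z)" "A \<subseteq> U" "B \<subseteq> U" "I \<inter> A = {}" "J \<inter> B = {}"
        "Good col A \<phi>" "Good (\<not> col) B \<chi>"
      have finZ: "finite Z" using h(1) fin_V finite_subset by blast
      show "(\<exists>\<psi>. copy col I A \<phi> Z \<psi>) \<or> (\<exists>\<psi>. copy (\<not> col) J B \<chi> Z \<psi>)"
      proof (cases "\<exists>\<psi>. copy col I A \<phi> Z \<psi>")
        case False
        have pDZ: "M * exp (2 * lam * x) \<le> p ^ D * real (card Z)"
        proof -
          have "M * exp (2 * lam * x) = exp (- lam * x) * (N * exp (50 * lam * x))"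
            unfolding M_def by (simp add: exp_add[symmetric] algebra_simps)
          also have "\<dots> \<le> p ^ D * real (card Z)"
            using pD h(2) p N1 by (intro mult_mono) auto
          finally show ?thesis .
        qed
        have N_le: "N \<le> p ^ D * real (card Z)"
        proof -
          have "N * 1 \<le> M * exp (2 * lam * x)" using Mpos lam x0 N1 by (intro mult_mono) auto
          then show ?thesis using pDZ by simp
        qed
        have pD1: "p ^ D \<le> 1" using p by (intro power_le_one) auto
        have "p ^ D * real (card Z) \<le> 1 * real (card Z)" using pD1 by (intro mult_right_mono) auto
        then have NZ: "N \<le> real (card Z)" using N_le by linarith
        have c1: "2 * real n \<le> real (card Z)"
        proof -
          have "2 * real n = 2 * real n * 1" by simp
          also have "\<dots> \<le> 4 * real n * (\<delta> + 1)" using n1 delta_nonneg by (intro mult_mono) auto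
          finally show ?thesis using N NZ by linarith
        qed
        have c2: "4 * real n * \<delta> \<le> p ^ D * real (card Z)"
        proof -
          have "4 * real n * \<delta> \<le> 4 * real n * (\<delta> + 1)" using n1 by (intro mult_left_mono) auto
          then show ?thesis using N N_le by linarith
        qed
        have deg: "card {u \<in> I. d v \<le> d u \<and> {u, v} \<in> E} \<le> D" if "v \<in> I" for v
        proof -
          have "(card {u \<in> I. d v \<le> d u \<and> {u, v} \<in> E})\<^sup>2 \<le> sum w I" by (rule degen[OF sub(1) that])
          then have "real (card {u \<in> I. d v \<le> d u \<and> {u, v} \<in> E}) ^ 2 \<le> real (sum w I)"
            by (metis of_nat_le_iff of_nat_power)
          then have "real (card {u \<in> I. d v \<le> d u \<and> {u, v} \<in> E}) \<le> sqrt (real (sum w I))" by (rule real_le_rsqrt)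
          then have "real (card {u \<in> I. d v \<le> d u \<and> {u, v} \<in> E}) \<le> x" using xI by linarith
          then show ?thesis unfolding D_def by (simp add: le_nat_floor)
        qed
        have p1: "p \<le> 1" using p by simp
        obtain X Y where XY: "X \<subseteq> Z" "Y \<subseteq> Z" "before X Y \<or> before Y X" "sparse c col p X Y"
          "p ^ D * real (card Z) / (4 * real n ^ 2) \<le> real (card X)"
          "p ^ D * real (card Z) / (4 * real n ^ 2) \<le> real (card Y)"
          using sparse_pair[OF sub(1) h(3,5,7,1) p(1) p1 deg c1 c2 False] by metis
        have fin: "finite X" "finite Y" using XY finZ finite_subset by blast+
        have "2 * M * exp \<theta> \<le> p ^ D * real (card Z) / (4 * real n ^ 2)"
        proof -
          have "2 * M * exp \<theta> * (4 * real n ^ 2) = M * exp \<theta> * (8 * real n ^ 2)" by simp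
          also have "\<dots> \<le> M * exp \<theta> * exp \<theta>" using theta Mpos N1 by (intro mult_left_mono) auto
          also have "\<dots> = M * exp (2 * \<theta>)" by (simp add: exp_add[symmetric])
          also have "\<dots> \<le> M * exp (2 * lam * x)"
          proof (intro mult_left_mono)
            have "1 * \<theta> \<le> lam * x" using xt theta lam by (intro mult_mono) auto
            then show "exp (2 * \<theta>) \<le> exp (2 * lam * x)" by simp
          qed (use Mpos N1 in auto)
          finally show ?thesis using pDZ n1 by (subst pos_le_divide_eq) auto
        qed
        then have big: "2 * M * exp \<theta> \<le> real (card X)" "2 * M * exp \<theta> \<le> real (card Y)" using XY(5,6) by linarith+
        \<comment> \<open>As \<open>1 - p \<ge> exp (- 2 p)\<close> for
          \<open>p \<le> 1 / 2\<close>, a sample of this size keeps a proportion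
          \<open>exp (- \<theta>)\<close> of \<open>X\<close>; it is the largest size for which this
          estimate works.\<close>
        define r where "r = nat \<lfloor>\<theta> / (2 * p)\<rfloor>"
        have tp: "0 \<le> \<theta> / (2 * p)" using theta p by simp
        have r: "real r \<le> \<theta> / (2 * p)" "\<theta> / (2 * p) - 1 \<le> real r" unfolding r_def using tp by linarith+
        have "\<exists>X'. X' \<subseteq> X \<and> (1 - p) ^ r * real (card X) - 1 \<le> real (card X') \<and>
          (\<forall>T. T \<subseteq> X' \<longrightarrow> card T \<le> card U \<longrightarrow> exp (- \<theta>) * real (card Y) \<le> real (card {y \<in> Y. \<forall>x\<in>T. c {x, y} = (\<not> col)}))"
        proof (rule dependent_random_choice[of X Y p "\<lambda>x y. c {x, y} = (\<not> col)" "exp (- \<theta>)" "card U" r])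
          show "(1 - p) * real (card Y) \<le> real (card {y \<in> Y. c {x, y} = (\<not> col)})" if "x \<in> X" for x
            using sparse_common[OF XY(4) fin(2), of "{x}"] that by simp
          show "real (card X) ^ card U * exp (- \<theta>) ^ r \<le> 1"
          proof -
            have "card X \<le> card V" using XY h(1) fin_V by (intro card_mono) auto
            then have "real (card X) \<le> exp \<Lambda>" using V(1) by linarith
            then have "real (card X) ^ card U \<le> exp \<Lambda> ^ card U" by (intro power_mono) auto
            also have "\<dots> = exp (real (card U) * \<Lambda>)" by (simp add: exp_of_nat_mult)
            finally have "real (card X) ^ card U * exp (- \<theta>) ^ r \<le> exp (real (card U) * \<Lambda>) * exp (- \<theta>) ^ r"
              by (intro mult_right_mono) auto
            also have "\<dots> = exp (real (card U) * \<Lambda> - real r * \<theta>)"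
              by (simp add: exp_of_nat_mult[symmetric] exp_add[symmetric])
            also have "\<dots> \<le> 1"
            proof -
              have e: "exp lam = 1 / p" unfolding p_def by (simp add: exp_minus field_simps)
              \<comment> \<open>Of the \<open>\<theta> ^ 2 / (2 p)\<close> available in the
                exponent, one half absorbs the number of tuples by \<open>drc\<close>, and the other
                half, with the summand 1 in \<open>drc\<close>, the rounding of
                \<open>r\<close>.\<close>
              have "(\<theta> / (2 * p) - 1) * \<theta> \<le> real r * \<theta>" using r(2) theta by (intro mult_right_mono) auto
              moreover have "(\<theta> / (2 * p) - 1) * \<theta> = \<theta>\<^sup>2 * exp lam / 4 + (\<theta>\<^sup>2 / (4 * p) - \<theta>)"
                unfolding e using p(1) by (simp add: field_simps power2_eq_square)
              moreover have "\<theta> \<le> \<theta>\<^sup>2 / (4 * p) + 1"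
              proof -
                have "\<theta>\<^sup>2 / (4 * (1/2)) \<le> \<theta>\<^sup>2 / (4 * p)" using p theta by (intro divide_left_mono) auto
                moreover have "0 \<le> (\<theta> - 1)\<^sup>2" by simp
                ultimately show ?thesis by (simp add: power2_diff)
              qed
              moreover have "real (card U) * \<Lambda> + 1 \<le> \<theta>\<^sup>2 * exp lam / 4" using drc by simp
              ultimately have "real (card U) * \<Lambda> - real r * \<theta> \<le> 0" by linarith
              then show ?thesis by simp
            qed
            finally show ?thesis .
          qed
          show "Y \<noteq> {}"
          proof
            assume "Y = {}"
            then have "2 * M * exp \<theta> \<le> 0" using big(2) by simp
            moreover have "0 < 2 * M * exp \<theta>" using Mpos N1 by (intro mult_pos_pos) auto
            ultimately show False by linarith
          qed
        qed (use fin p1 theta in auto)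
        then obtain X' where X': "X' \<subseteq> X" "(1 - p) ^ r * real (card X) - 1 \<le> real (card X')"
          "\<And>T. T \<subseteq> X' \<Longrightarrow> card T \<le> card U \<Longrightarrow> exp (- \<theta>) * real (card Y) \<le> real (card {y \<in> Y. \<forall>x\<in>T. c {x, y} = (\<not> col)})"
          by blast
        have pr: "exp (- \<theta>) \<le> (1 - p) ^ r"
        proof -
          have 1: "exp (- (2 * p)) \<le> 1 - p"
          proof -
            have "1 / (1 - p) = 1 + p / (1 - p)" using p by (simp add: field_simps)
            also have "\<dots> \<le> 1 + 2 * p" using p by (simp add: field_simps)
            also have "\<dots> \<le> exp (2 * p)" by (rule exp_ge_add_one_self)
            finally have "1 / (1 - p) \<le> exp (2 * p)" .
            then show ?thesis using p by (simp add: exp_minus field_simps)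
          qed
          have "real r * (2 * p) \<le> \<theta>" using r(1) p(1) by (simp add: field_simps)
          then have "exp (- \<theta>) \<le> exp (real r * (- (2 * p)))" by simp
          also have "\<dots> = exp (- (2 * p)) ^ r" by (rule exp_of_nat_mult)
          also have "\<dots> \<le> (1 - p) ^ r" using 1 by (intro power_mono) auto
          finally show ?thesis .
        qed
        have big': "2 * M \<le> exp (- \<theta>) * real (card X)" "2 * M \<le> exp (- \<theta>) * real (card Y)"
          using big by (simp_all add: exp_minus field_simps)
        have "(\<exists>\<psi>. copy col I A \<phi> Z \<psi>) \<or> (\<exists>\<psi>. copy (\<not> col) (L \<union> R) B \<chi> Z \<psi>)"
        proof (rule ram_pair[OF ramM ramM LU LR(2) h(1) _ XY(2)])
          show "L \<subseteq> U" "R \<subseteq> U" "4 * sum w L \<le> 3 * sum w J" "4 * sum w R \<le> 3 * sum w J" using LR LU by auto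
          show "X' \<subseteq> Z" using X' XY by blast
          show "before X' Y \<or> before Y X'" using XY(3) X'(1) before_subset by blast
          have "exp (- \<theta>) * real (card X) \<le> (1 - p) ^ r * real (card X)" using pr by (intro mult_right_mono) auto
          then show "M \<le> real (card X')" using X'(2) big'(1) Mpos N1 by linarith
          fix T assume T: "T \<subseteq> X'" "card T \<le> card (L \<union> R)"
          have "card (L \<union> R) \<le> card U" using LU fin_U by (intro card_mono) auto
          then have "exp (- \<theta>) * real (card Y) \<le> real (card {y \<in> Y. \<forall>x\<in>T. c {x, y} = (\<not> col)})"
            using X'(3)[OF T(1)] T(2) by linarith
          then show "M \<le> real (card {y \<in> Y. \<forall>x\<in>T. c {x, y} = (\<not> col)})" using big'(2) Mpos N1 by linarith
        qed (use h LR in auto)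
        then show ?thesis using LR(1) by simp
      qed blast
    qed
  qed
  have ge: "N \<le> N * exp (50 * lam * sqrt (sqrt (real (sum w I) * real (sum w J))))"
    using N1 lam by (simp add: mult_le_cancel_left1)
  consider "real (sum w I) \<le> \<theta>\<^sup>2" | "real (sum w J) \<le> \<theta>\<^sup>2" |
    "\<theta>\<^sup>2 < real (sum w I)" "sum w I \<le> sum w J" | "\<theta>\<^sup>2 < real (sum w J)" "sum w J \<le> sum w I"
    by linarith
  then show ?case
  proof cases
    case 1
    then show ?thesis using base[OF less.prems 1] ge ram_mono by blast
  next
    case 2
    then show ?thesis using ram_swap[OF base[OF less.prems(2,1) 2, of "\<not> col"]] ge ram_mono by simp
  next
    case 3
    show ?thesis
      by (rule step[OF less.prems 3]) (use less.hyps less.prems in auto)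
  next
    case 4
    have "ram (\<not> col) J I (N * exp (50 * lam * sqrt (sqrt (real (sum w J) * real (sum w I)))))"
      by (rule step[OF less.prems(2,1) 4]) (use less.hyps less.prems in auto)
    from ram_swap[OF this] show ?thesis by (simp add: mult.commute)
  qed
qed

end

end

section \<open>Low degree vertices\<close>

text \<open>
  The set \<open>S\<close> consists of \<open>M\<close> consecutive blocks of length \<open>len\<close>, and \<open>C b w\<close> is reserved for the low
  degree vertex \<open>w\<close> in block \<open>b\<close>. Which block \<open>w\<close> ends up in is only known after the high degree
  vertices have been embedded, so candidates are maintained in all blocks.
\<close>

locale robust_blocks =
  fixes c :: "nat set \<Rightarrow> bool" and E :: "nat set set" and S Vs W :: "nat set" and n \<Delta> M len :: nat
    and C :: "nat \<Rightarrow> nat \<Rightarrow> nat set" and a \<tau> q :: real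
  assumes fin_S: "finite S" and fin_Vs: "finite Vs" and card_Vs: "card Vs \<le> n" and n_ge: "1 \<le> n"
    and edge_card: "\<And>e. e \<in> E \<Longrightarrow> card e = 2" and W: "W \<subseteq> Vs"
    and low: "\<And>w. w \<in> W \<Longrightarrow> card {u \<in> Vs. {u, w} \<in> E} \<le> \<Delta>"
    and q: "0 < q" "q \<le> 1" and len: "0 < len" and M_pos: "0 < M" and card_S: "card S = M * len" and a_pos: "0 < a"
    and C_block: "\<And>b w. b < M \<Longrightarrow> w \<in> Vs \<Longrightarrow> C b w \<subseteq> {x \<in> S. rank_in S x div len = b}"
    and C_card: "\<And>b w. b < M \<Longrightarrow> w \<in> Vs \<Longrightarrow> a \<le> real (card (C b w))"
    and C_before: "\<And>b v w. b < M \<Longrightarrow> v \<in> Vs \<Longrightarrow> w \<in> Vs \<Longrightarrow> v < w \<Longrightarrow> before (C b v) (C b w)"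
    and tau: "0 < \<tau>" "\<tau> \<le> q ^ (2 * \<Delta>) * a / real n"
    and robust: "\<And>col X Y. X \<subseteq> S \<Longrightarrow> Y \<subseteq> S \<Longrightarrow> before X Y \<or> before Y X \<Longrightarrow>
      \<tau> \<le> real (card X) \<Longrightarrow> \<tau> \<le> real (card Y) \<Longrightarrow> \<not> sparse c col q X Y"
begin

abbreviation blk :: "nat \<Rightarrow> nat" where
  "blk x \<equiv> rank_in S x div len"

definition cand :: "bool \<Rightarrow> nat set \<Rightarrow> (nat \<Rightarrow> nat) \<Rightarrow> nat \<Rightarrow> nat \<Rightarrow> nat set" where
  "cand col A \<phi> b w = {y \<in> C b w. \<forall>u\<in>A. {u, w} \<in> E \<longrightarrow> c {\<phi> u, y} = col}"

definition Good :: "bool \<Rightarrow> nat set \<Rightarrow> (nat \<Rightarrow> nat) \<Rightarrow> bool" where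
  "Good col A \<phi> \<longleftrightarrow>
     (\<forall>u\<in>A. \<phi> u \<in> S \<and> 0 < blk (\<phi> u) \<and> blk (\<phi> u) + 1 < M) \<and>
     (\<forall>u\<in>A. \<forall>v\<in>A. u \<noteq> v \<longrightarrow> blk (\<phi> u) + 2 \<le> blk (\<phi> v) \<or> blk (\<phi> v) + 2 \<le> blk (\<phi> u)) \<and>
     (\<forall>b<M. b \<notin> (blk \<circ> \<phi>) ` A \<longrightarrow>
        (\<forall>w\<in>W. q ^ card {u \<in> A. {u, w} \<in> E} * a \<le> real (card (cand col A \<phi> b w))))"

lemma Good_empty: "Good col {} \<phi>"
  unfolding Good_def cand_def using C_card W by auto

lemma blk_less: "x \<in> S \<Longrightarrow> blk x < M"
  using bij_betwE[OF bij_betw_rank_in[OF fin_S]] card_S len by (simp add: less_mult_imp_div_less)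

lemma blk_mono: "x \<le> y \<Longrightarrow> blk x \<le> blk y"
  using rank_in_mono[OF fin_S] by (simp add: div_le_mono)

lemma blk_less_imp: "blk x < blk y \<Longrightarrow> x < y"
  using blk_mono[of y x] by (meson leD le_less_linear)

lemma before_blk:
  assumes "\<And>x. x \<in> X \<Longrightarrow> blk x < b" "\<And>y. y \<in> Y \<Longrightarrow> blk y = b"
  shows "before X Y"
  unfolding before_def using assms blk_less_imp by metis

lemma before_blk':
  assumes "\<And>x. x \<in> X \<Longrightarrow> blk x = b" "\<And>y. y \<in> Y \<Longrightarrow> b < blk y"
  shows "before X Y"
  unfolding before_def using assms blk_less_imp by metis

lemma card_blk: "card {x \<in> S. blk x = b} \<le> len"
  by (rule card_rank_block(1)[OF fin_S len])

text \<open>Counts the points that a new vertex has to avoid: the two end blocks, three blocks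
  around each occupied one, and, for each of at most \<open>M * n\<close> pairs of a block and a low
  degree vertex, fewer than \<open>\<tau>\<close> points on either side of the block. The sum
  \<open>2 * len + 3 * n * len\<close> is rounded up to \<open>5 * n * len\<close>.\<close>

definition \<delta> :: real where
  "\<delta> = 5 * real n * real len + 2 * real M * real n * \<tau>"

lemma Good_insert_block:
  assumes good: "Good col A \<phi>" and A: "A \<subseteq> Vs - W" and u: "u \<in> Vs - W - A"
  shows "real (card {x \<in> S. \<not> Good col (insert u A) (\<phi>(u := x))}) \<le> \<delta>"
proof -
  have finA: "finite A" using A fin_Vs finite_subset by blast
  have cA: "card A \<le> n" using card_mono[OF fin_Vs, of A] A card_Vs by fastforce
  have finW: "finite W" using W fin_Vs finite_subset by blast
  have cW: "card W \<le> n" using card_mono[OF fin_Vs W] card_Vs by simp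
  define free where "free b \<longleftrightarrow> b < M \<and> b \<notin> (blk \<circ> \<phi>) ` A" for b
  define B1 where "B1 = {x \<in> S. blk x = 0}"
  define B2 where "B2 = {x \<in> S. blk x = M - 1}"
  define B3 where "B3 v = {x \<in> S. blk x = blk (\<phi> v) - 1} \<union> {x \<in> S. blk x = blk (\<phi> v)} \<union> {x \<in> S. blk x = blk (\<phi> v) + 1}" for v
  define B4 where "B4 b w = {x \<in> S. free b \<and> blk x \<noteq> b \<and>
    real (card {y \<in> cand col A \<phi> b w. c {x, y} = col}) < q * real (card (cand col A \<phi> b w))}" for b w
  have Bsub: "{x \<in> S. \<not> Good col (insert u A) (\<phi>(u := x))} \<subseteq> B1 \<union> B2 \<union> (\<Union>v\<in>A. B3 v) \<union> (\<Union>(b, w)\<in>{..<M} \<times> W. B4 b w)"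
  proof (rule subsetI, rule ccontr)
    fix x assume x: "x \<in> {x \<in> S. \<not> Good col (insert u A) (\<phi>(u := x))}"
      and "x \<notin> B1 \<union> B2 \<union> (\<Union>v\<in>A. B3 v) \<union> (\<Union>(b, w)\<in>{..<M} \<times> W. B4 b w)"
    then have nx: "x \<notin> B1" "x \<notin> B2" "\<And>v. v \<in> A \<Longrightarrow> x \<notin> B3 v" "\<And>b w. b < M \<Longrightarrow> w \<in> W \<Longrightarrow> x \<notin> B4 b w" by auto
    have xS: "x \<in> S" using x by blast
    have same: "(\<phi>(u := x)) v = \<phi> v" if "v \<in> A" for v using that u by auto
    have x1: "0 < blk x" "blk x + 1 < M"
      using nx(1,2) xS blk_less[OF xS] unfolding B1_def B2_def by auto
    have sep: "blk x + 2 \<le> blk (\<phi> v) \<or> blk (\<phi> v) + 2 \<le> blk x" if "v \<in> A" for v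
      using nx(3)[OF that] xS unfolding B3_def by auto
    have "Good col (insert u A) (\<phi>(u := x))"
      unfolding Good_def
    proof (intro conjI ballI allI impI)
      fix v assume v: "v \<in> insert u A"
      show "(\<phi>(u := x)) v \<in> S" "0 < blk ((\<phi>(u := x)) v)" "blk ((\<phi>(u := x)) v) + 1 < M"
        using v good xS x1 same unfolding Good_def by (cases "v = u"; auto)+
    next
      fix v w assume vw: "v \<in> insert u A" "w \<in> insert u A" "v \<noteq> w"
      consider "v = u" "w \<in> A" | "w = u" "v \<in> A" | "v \<in> A" "w \<in> A" using vw by blast
      then show "blk ((\<phi>(u := x)) v) + 2 \<le> blk ((\<phi>(u := x)) w) \<or> blk ((\<phi>(u := x)) w) + 2 \<le> blk ((\<phi>(u := x)) v)"
      proof cases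
        case 1
        then show ?thesis using sep[of w] same[of w] by simp
      next
        case 2
        then show ?thesis using sep[of v] same[of v] by auto
      next
        case 3
        then show ?thesis using same vw(3) good unfolding Good_def by auto
      qed
    next
      fix b w assume b: "b < M" "b \<notin> (blk \<circ> \<phi>(u := x)) ` insert u A" and w: "w \<in> W"
      have bx: "b \<noteq> blk x" using b(2) by auto
      have bA: "b \<notin> (blk \<circ> \<phi>) ` A" using b(2) same by (auto simp: image_iff)
      then have fb: "free b" using b(1) unfolding free_def by simp
      have old: "q ^ card {v \<in> A. {v, w} \<in> E} * a \<le> real (card (cand col A \<phi> b w))"
        using good b(1) bA w unfolding Good_def by blast
      show "q ^ card {v \<in> insert u A. {v, w} \<in> E} * a \<le> real (card (cand col (insert u A) (\<phi>(u := x)) b w))"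
      proof (cases "{u, w} \<in> E")
        case False
        have "{v \<in> insert u A. {v, w} \<in> E} = {v \<in> A. {v, w} \<in> E}" using False by auto
        moreover have "cand col (insert u A) (\<phi>(u := x)) b w = cand col A \<phi> b w"
          unfolding cand_def using False same by auto
        ultimately show ?thesis using old by simp
      next
        case True
        have "{v \<in> insert u A. {v, w} \<in> E} = insert u {v \<in> A. {v, w} \<in> E}" using True by auto
        then have e: "card {v \<in> insert u A. {v, w} \<in> E} = Suc (card {v \<in> A. {v, w} \<in> E})"
          using u finA by simp
        have "cand col (insert u A) (\<phi>(u := x)) b w = {y \<in> cand col A \<phi> b w. c {x, y} = col}"
          unfolding cand_def using True same by auto
        moreover have "q * real (card (cand col A \<phi> b w)) \<le> real (card {y \<in> cand col A \<phi> b w. c {x, y} = col})"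
          using nx(4)[OF b(1) w] xS fb bx unfolding B4_def by auto
        moreover have "q * (q ^ card {v \<in> A. {v, w} \<in> E} * a) \<le> q * real (card (cand col A \<phi> b w))"
          using old q by (intro mult_left_mono) auto
        ultimately show ?thesis using e by (simp add: mult.assoc)
      qed
    qed
    then show False using x by blast
  qed
  have c1: "card B1 \<le> len" "card B2 \<le> len" unfolding B1_def B2_def by (rule card_blk)+
  have c3: "card (B3 v) \<le> 3 * len" for v
  proof -
    have "card (B3 v) \<le> card {x \<in> S. blk x = blk (\<phi> v) - 1} + card {x \<in> S. blk x = blk (\<phi> v)} + card {x \<in> S. blk x = blk (\<phi> v) + 1}"
      unfolding B3_def by (meson add_le_mono1 card_Un_le order_trans)
    then show ?thesis using card_blk[of "blk (\<phi> v) - 1"] card_blk[of "blk (\<phi> v)"] card_blk[of "blk (\<phi> v) + 1"] by linarith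
  qed
  have c4: "real (card (B4 b w)) \<le> 2 * \<tau>" if w: "w \<in> W" for b w
  proof (cases "free b")
    case False
    then have "B4 b w = {}" unfolding B4_def by auto
    then show ?thesis using tau by simp
  next
    case fb: True
    let ?Y = "cand col A \<phi> b w"
    have bM: "b < M" using fb unfolding free_def by simp
    have wV: "w \<in> Vs" using w W by blast
    have Yb: "?Y \<subseteq> {x \<in> S. blk x = b}" using C_block[OF bM wV] unfolding cand_def by blast
    have "card {v \<in> A. {v, w} \<in> E} \<le> card {v \<in> Vs. {v, w} \<in> E}"
      using fin_Vs A by (intro card_mono) auto
    then have "card {v \<in> A. {v, w} \<in> E} \<le> 2 * \<Delta>" using low[OF w] by linarith
    then have "q ^ (2 * \<Delta>) * a \<le> q ^ card {v \<in> A. {v, w} \<in> E} * a"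
      using q a_pos by (intro mult_right_mono power_decreasing) auto
    also have "\<dots> \<le> real (card ?Y)" using good fb w unfolding Good_def free_def by blast
    finally have Y1: "q ^ (2 * \<Delta>) * a \<le> real (card ?Y)" .
    have "q ^ (2 * \<Delta>) * a / real n \<le> q ^ (2 * \<Delta>) * a / 1"
      using q a_pos n_ge by (intro divide_left_mono) auto
    then have Y2: "\<tau> \<le> real (card ?Y)" using Y1 tau by simp
    \<comment> \<open>\<open>robust\<close> speaks of pairs with one set before the other, hence the
      separation of the points that hurt the candidates of \<open>w\<close> in block
      \<open>b\<close> into those before and those after the block.\<close>
    define X1 where "X1 = {x \<in> B4 b w. blk x < b}"
    define X2 where "X2 = {x \<in> B4 b w. b < blk x}"
    have sp: "sparse c col q X ?Y" if "X \<subseteq> B4 b w" for X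
      unfolding sparse_def using that unfolding B4_def by auto
    have XS: "X1 \<subseteq> S" "X2 \<subseteq> S" "?Y \<subseteq> S" using Yb unfolding X1_def X2_def B4_def by auto
    have "before X1 ?Y" using Yb unfolding X1_def by (intro before_blk[of _ b]) auto
    then have 1: "real (card X1) < \<tau>"
      using robust[of X1 ?Y col] XS Y2 sp[of X1] unfolding X1_def by force
    have "before ?Y X2" using Yb unfolding X2_def by (intro before_blk'[of _ b]) auto
    then have 2: "real (card X2) < \<tau>"
      using robust[of X2 ?Y col] XS Y2 sp[of X2] unfolding X2_def by force
    have "B4 b w = X1 \<union> X2" unfolding X1_def X2_def B4_def by auto
    then have "card (B4 b w) \<le> card X1 + card X2" using card_Un_le by metis
    then show ?thesis using 1 2 by linarith
  qed
  have finB4: "finite (\<Union>(b, w)\<in>{..<M} \<times> W. B4 b w)" unfolding B4_def using fin_S finW by auto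
  have fin3: "finite (\<Union>v\<in>A. B3 v)" unfolding B3_def using fin_S finA by auto
  have "card {x \<in> S. \<not> Good col (insert u A) (\<phi>(u := x))}
      \<le> card (B1 \<union> B2 \<union> (\<Union>v\<in>A. B3 v) \<union> (\<Union>(b, w)\<in>{..<M} \<times> W. B4 b w))"
    using Bsub finB4 fin3 fin_S unfolding B1_def B2_def by (intro card_mono) auto
  also have "\<dots> \<le> card B1 + card B2 + card (\<Union>v\<in>A. B3 v) + card (\<Union>(b, w)\<in>{..<M} \<times> W. B4 b w)"
    by (meson add_le_mono1 card_Un_le order_trans)
  finally have tot: "card {x \<in> S. \<not> Good col (insert u A) (\<phi>(u := x))}
      \<le> card B1 + card B2 + card (\<Union>v\<in>A. B3 v) + card (\<Union>(b, w)\<in>{..<M} \<times> W. B4 b w)" .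
  have "card (\<Union>v\<in>A. B3 v) \<le> (\<Sum>v\<in>A. card (B3 v))" by (rule card_UN_le[OF finA])
  also have "\<dots> \<le> (\<Sum>v\<in>A. 3 * len)" by (rule sum_mono) (rule c3)
  also have "\<dots> \<le> n * (3 * len)" using cA by simp
  finally have t3: "card (\<Union>v\<in>A. B3 v) \<le> 3 * (n * len)" by simp
  have "real (card (\<Union>(b, w)\<in>{..<M} \<times> W. B4 b w)) \<le> real (\<Sum>bw\<in>{..<M} \<times> W. card (case bw of (b, w) \<Rightarrow> B4 b w))"
    unfolding of_nat_le_iff using finW by (intro card_UN_le) auto
  also have "\<dots> = (\<Sum>bw\<in>{..<M} \<times> W. real (card (case bw of (b, w) \<Rightarrow> B4 b w)))" by simp
  also have "\<dots> \<le> real (card ({..<M} \<times> W)) * (2 * \<tau>)"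
    using c4 by (intro sum_bounded_above) auto
  also have "\<dots> \<le> (real M * real n) * (2 * \<tau>)"
    using cW tau(1) by (intro mult_right_mono) (auto simp: card_cartesian_product simp del: of_nat_mult simp flip: of_nat_mult)
  finally have t4: "real (card (\<Union>(b, w)\<in>{..<M} \<times> W. B4 b w)) \<le> 2 * real M * real n * \<tau>" by simp
  have "real (card (\<Union>v\<in>A. B3 v)) \<le> real (3 * (n * len))" unfolding of_nat_le_iff by (rule t3)
  then have t3': "real (card (\<Union>v\<in>A. B3 v)) \<le> 3 * (real n * real len)" by simp
  note tot' = of_nat_mono[OF tot, where 'a = real, unfolded of_nat_add]
  have "real (card {x \<in> S. \<not> Good col (insert u A) (\<phi>(u := x))}) \<le>
    real len + real len + 3 * (real n * real len) + 2 * real M * real n * \<tau>"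
    using tot' t3' t4 of_nat_mono[OF c1(1), where 'a = real] of_nat_mono[OF c1(2), where 'a = real] by linarith
  moreover have "1 * real len \<le> real n * real len" using n_ge by (intro mult_right_mono) auto
  ultimately show ?thesis unfolding \<delta>_def by (simp add: algebra_simps)
qed

sublocale high: colouring c E S "Vs - W" n Good \<delta>
proof
  show "card (Vs - W) \<le> n" using card_mono[OF fin_Vs, of "Vs - W"] card_Vs by auto
  show "0 \<le> \<delta>" unfolding \<delta>_def using tau by simp
qed (use fin_S fin_Vs n_ge edge_card Good_insert_block in auto)

sublocale low: colouring c E S W n "\<lambda>_ _ _. True" 0
proof
  show "card W \<le> n" using card_mono[OF fin_Vs W] card_Vs by simp
qed (use fin_S fin_Vs n_ge edge_card W finite_subset in auto)

lemma complete_copy: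
  assumes J: "J \<subseteq> Vs" and cp: "high.copy col (J - W) {} \<phi> S \<psi>"
  obtains \<psi>' where "\<And>u. u \<in> J \<Longrightarrow> \<psi>' u \<in> S" "\<And>u v. u \<in> J \<Longrightarrow> v \<in> J \<Longrightarrow> u < v \<Longrightarrow> \<psi>' u < \<psi>' v"
    "\<And>u v. u \<in> J \<Longrightarrow> v \<in> J \<Longrightarrow> {u, v} \<in> E \<Longrightarrow> c {\<psi>' u, \<psi>' v} = col"
proof -
  define A where "A = J - W"
  have finA: "finite A" using J fin_Vs finite_subset unfolding A_def by blast
  have good: "Good col A \<psi>" using cp unfolding high.copy_def A_def by simp
  have A_S: "\<psi> u \<in> S" if "u \<in> A" for u using cp that unfolding high.copy_def A_def by blast
  have A_mono: "\<psi> u < \<psi> v" if "u \<in> A" "v \<in> A" "u < v" for u v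
    using cp that unfolding high.copy_def A_def by blast
  have A_col: "c {\<psi> u, \<psi> v} = col" if "u \<in> A" "v \<in> A" "{u, v} \<in> E" for u v
    using cp that unfolding high.copy_def A_def by blast
  have blk0: "0 < blk (\<psi> u)" "blk (\<psi> u) + 1 < M" if "u \<in> A" for u using good that unfolding Good_def by auto
  have sep: "blk (\<psi> u) + 2 \<le> blk (\<psi> v)" if "u \<in> A" "v \<in> A" "u < v" for u v
  proof -
    have "blk (\<psi> u) + 2 \<le> blk (\<psi> v) \<or> blk (\<psi> v) + 2 \<le> blk (\<psi> u)"
      using good that unfolding Good_def by (metis less_irrefl)
    moreover have "blk (\<psi> u) \<le> blk (\<psi> v)" using A_mono[OF that] by (intro blk_mono) simp
    ultimately show ?thesis by linarith
  qed
  define below where "below w = {u \<in> A. u < w}" for w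
  define pos where "pos w = (if below w = {} then 0 else blk (\<psi> (Max (below w))) + 1)" for w
  have finb: "finite (below w)" for w unfolding below_def using finA by simp
  have Maxb: "Max (below w) \<in> A" "Max (below w) < w" if "below w \<noteq> {}" for w
    using Max_in[OF finb that] unfolding below_def by auto
  have pos_left: "blk (\<psi> u) < pos w" if "u \<in> A" "u < w" for u w
  proof -
    have ub: "u \<in> below w" using that unfolding below_def by simp
    then have ne: "below w \<noteq> {}" by blast
    have "u \<le> Max (below w)" using ub finb by simp
    then have "blk (\<psi> u) \<le> blk (\<psi> (Max (below w)))"
      using sep[OF that(1) Maxb(1)[OF ne]] by (cases "u = Max (below w)") auto
    then show ?thesis unfolding pos_def using ne by simp
  qed
  have pos_right: "pos w < blk (\<psi> u)" if "u \<in> A" "w \<le> u" for u w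
  proof (cases "below w = {}")
    case True
    then show ?thesis unfolding pos_def using blk0(1)[OF that(1)] by simp
  next
    case False
    then show ?thesis unfolding pos_def using sep[OF Maxb(1)[OF False] that(1)] Maxb(2)[OF False] that(2) by simp
  qed
  have pos_free: "pos w \<notin> (blk \<circ> \<psi>) ` A" for w
  proof
    assume "pos w \<in> (blk \<circ> \<psi>) ` A"
    then obtain u where u: "u \<in> A" "pos w = blk (\<psi> u)" by auto
    then show False using pos_left[of u w] pos_right[of u w] by (metis less_irrefl not_le)
  qed
  have pos_mono: "pos v \<le> pos w" if "v \<le> w" for v w
  proof (cases "below v = {}")
    case False
    have "blk (\<psi> (Max (below v))) < pos w" using pos_left[of "Max (below v)" w] Maxb[OF False] that by simp
    then show ?thesis unfolding pos_def[of v] using False by simp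
  qed (simp add: pos_def)
  have pos_less: "pos w < M" for w
    unfolding pos_def using blk0(2)[OF Maxb(1)] M_pos by auto
  define C' where "C' w = cand col A \<psi> (pos w) w" for w
  have C'_sub: "C' w \<subseteq> C (pos w) w" for w unfolding C'_def cand_def by auto
  have C'_blk: "C' w \<subseteq> {x \<in> S. blk x = pos w}" if "w \<in> Vs" for w
    using C'_sub C_block[OF pos_less that] by blast
  have C'_card: "q ^ \<Delta> * a \<le> real (card (C' w))" if w: "w \<in> J \<inter> W" for w
  proof -
    have wW: "w \<in> W" using w by blast
    have "card {u \<in> A. {u, w} \<in> E} \<le> card {u \<in> Vs. {u, w} \<in> E}"
      using fin_Vs J unfolding A_def by (intro card_mono) auto
    then have "card {u \<in> A. {u, w} \<in> E} \<le> \<Delta>" using low[OF wW] by linarith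
    then have "q ^ \<Delta> * a \<le> q ^ card {u \<in> A. {u, w} \<in> E} * a"
      using q a_pos by (intro mult_right_mono power_decreasing) auto
    also have "\<dots> \<le> real (card (C' w))"
      using good pos_less pos_free wW unfolding Good_def C'_def by blast
    finally show ?thesis .
  qed
  \<comment> \<open>Low degree vertices falling between the same two high degree vertices share a
    block; there the order comes from the pieces \<open>C b w\<close>.\<close>
  have C'_before: "before (C' v) (C' w)" if "v \<in> J \<inter> W" "w \<in> J \<inter> W" "v < w" for v w
  proof (cases "pos v = pos w")
    case True
    then show ?thesis using C_before[OF pos_less, of v w v] that W C'_sub before_subset by (metis IntD2 subsetD)
  next
    case ne: False
    then have "pos v < pos w" using pos_mono[of v w] that by simp
    moreover have "v \<in> Vs" "w \<in> Vs" using that W by auto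
    ultimately show ?thesis using C'_blk[of v] C'_blk[of w]
      by (intro before_blk'[of _ "pos v"]) auto
  qed
  have twice: "q ^ \<Delta> * (q ^ \<Delta> * a) = q ^ (2 * \<Delta>) * a" by (simp add: power_add[symmetric] mult_2)
  have q2: "0 < q ^ (2 * \<Delta>) * a" using q a_pos by simp
  \<comment> \<open>Low degrees are at most \<open>\<Delta>\<close>, so any order of embedding works
    and \<open>d\<close> may be constant.\<close>
  have "\<exists>\<psi>'. low.copy col (J \<inter> W) {} \<psi> S \<psi>' \<and> (\<forall>v\<in>J \<inter> W. \<psi>' v \<in> C' v)"
  proof (rule low.greedy_embedding[where a = "q ^ \<Delta> * a" and p = q and D = \<Delta> and d = "\<lambda>_. 0"])
    show "C' v \<subseteq> S" if "v \<in> J \<inter> W" for v using C'_blk[of v] that J by auto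
    show "card {u \<in> J \<inter> W. 0 \<le> (0::nat) \<and> {u, v} \<in> E} \<le> \<Delta>" if "v \<in> J \<inter> W" for v
    proof -
      have "card {u \<in> J \<inter> W. 0 \<le> (0::nat) \<and> {u, v} \<in> E} \<le> card {u \<in> Vs. {u, v} \<in> E}"
        using fin_Vs J by (intro card_mono) auto
      then show ?thesis using low[of v] that by simp
    qed
    show "0 < q ^ \<Delta> * (q ^ \<Delta> * a)" unfolding twice by (rule q2)
    fix u v X Y
    assume h: "u \<in> J \<inter> W" "v \<in> J \<inter> W" "u \<noteq> v" "X \<subseteq> C' u" "Y \<subseteq> C' v" "q ^ \<Delta> * (q ^ \<Delta> * a) \<le> real (card Y)"
      "(q ^ \<Delta> * (q ^ \<Delta> * a) - 0) / real n \<le> real (card X)"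
    have "X \<subseteq> S" "Y \<subseteq> S" using h C'_blk[of u] C'_blk[of v] J by auto
    moreover have "before X Y \<or> before Y X"
      using h C'_before[of u v] C'_before[of v u] before_subset by (metis linorder_neqE_nat)
    moreover have "\<tau> \<le> real (card X)" using h(7) tau(2) twice by simp
    moreover have "\<tau> \<le> real (card Y)"
    proof -
      have "q ^ (2 * \<Delta>) * a / real n \<le> q ^ (2 * \<Delta>) * a / 1"
        using q a_pos n_ge by (intro divide_left_mono) auto
      then show ?thesis using h(6) twice tau(2) by simp
    qed
    ultimately show "\<not> sparse c col q X Y" by (intro robust)
  qed (use C'_card C'_before q in auto)
  then obtain \<psi>0 where \<psi>0: "low.copy col (J \<inter> W) {} \<psi> S \<psi>0" "\<And>v. v \<in> J \<inter> W \<Longrightarrow> \<psi>0 v \<in> C' v" by blast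
  define \<psi>' where "\<psi>' u = (if u \<in> W then \<psi>0 u else \<psi> u)" for u
  have W_blk: "\<psi>' w \<in> S" "blk (\<psi>' w) = pos w" if "w \<in> J \<inter> W" for w
    using \<psi>0(2)[OF that] C'_blk[of w] that J unfolding \<psi>'_def by auto
  have A_eq: "\<psi>' u = \<psi> u" if "u \<in> A" for u using that unfolding \<psi>'_def A_def by auto
  have split: "u \<in> A \<or> u \<in> J \<inter> W" if "u \<in> J" for u using that unfolding A_def by auto
  show ?thesis
  proof (rule that[of \<psi>'])
    show "\<psi>' u \<in> S" if "u \<in> J" for u using split[OF that] A_eq A_S W_blk by metis
    show "\<psi>' u < \<psi>' v" if h: "u \<in> J" "v \<in> J" "u < v" for u v
    proof -
      consider "u \<in> A" "v \<in> A" | "u \<in> A" "v \<in> J \<inter> W" | "u \<in> J \<inter> W" "v \<in> A" | "u \<in> J \<inter> W" "v \<in> J \<inter> W"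
        using split[OF h(1)] split[OF h(2)] by blast
      then show ?thesis
      proof cases
        case 1
        then show ?thesis using A_mono h(3) A_eq by simp
      next
        case 2
        then show ?thesis using pos_left[of u v] h(3) W_blk(2)[of v] A_eq[of u] blk_less_imp[of "\<psi>' u" "\<psi>' v"] by simp
      next
        case 3
        then show ?thesis using pos_right[of v u] h(3) W_blk(2)[of u] A_eq[of v] blk_less_imp[of "\<psi>' u" "\<psi>' v"] by simp
      next
        case 4
        then show ?thesis using \<psi>0(1) h(3) unfolding low.copy_def \<psi>'_def by auto
      qed
    qed
    have cross: "c {\<psi>' u, \<psi>' w} = col" if "u \<in> A" "w \<in> J \<inter> W" "{u, w} \<in> E" for u w
    proof -
      have "\<psi>' w \<in> C' w" using \<psi>0(2)[OF that(2)] that unfolding \<psi>'_def by auto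
      then show ?thesis using that A_eq unfolding C'_def cand_def by auto
    qed
    show "c {\<psi>' u, \<psi>' v} = col" if h: "u \<in> J" "v \<in> J" "{u, v} \<in> E" for u v
    proof -
      consider "u \<in> A" "v \<in> A" | "u \<in> A" "v \<in> J \<inter> W" | "u \<in> J \<inter> W" "v \<in> A" | "u \<in> J \<inter> W" "v \<in> J \<inter> W"
        using split[OF h(1)] split[OF h(2)] by blast
      then show ?thesis
      proof cases
        case 1
        then show ?thesis using A_col h(3) A_eq by simp
      next
        case 2
        then show ?thesis using cross h(3) by blast
      next
        case 3
        then show ?thesis using cross[of v u] h(3) by (simp add: insert_commute)
      next
        case 4
        then show ?thesis using \<psi>0(1) h(3) unfolding low.copy_def \<psi>'_def by auto
      qed
    qed
  qed
qed

end

section \<open>The outer recursion\<close>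

text \<open>The inner recursion stops at weight \<open>\<theta> ^ 2\<close> and the outer one at
  weight \<open>\<Theta> ^ 2\<close>. The crude bound for back-degrees at most
  \<open>\<theta>\<close>, without its factor \<open>\<delta> + 1\<close>, is below
  \<open>exp \<kappa>\<close>. The last assumption says that the part of the price of an outer step
  which does not depend on the targets is at most \<open>exp \<Theta>\<close>.\<close>

locale ramsey_setup =
  fixes c :: "nat set \<Rightarrow> bool" and E :: "nat set set" and V Vs W :: "nat set" and n \<Delta> k :: nat
    and w d :: "nat \<Rightarrow> nat" and lam \<theta> \<Theta> \<Lambda> \<kappa> :: real
  assumes finite_V: "finite V" and fin_Vs: "finite Vs" and card_Vs: "card Vs \<le> n" and n_ge: "1 \<le> n"
    and edge_card: "\<And>e. e \<in> E \<Longrightarrow> card e = 2" and W: "W \<subseteq> Vs"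
    and low: "\<And>w. w \<in> W \<Longrightarrow> card {u \<in> Vs. {u, w} \<in> E} \<le> \<Delta>"
    and degen: "\<And>I v. I \<subseteq> Vs \<Longrightarrow> v \<in> I \<Longrightarrow> (card {u \<in> I. d v \<le> d u \<and> {u, v} \<in> E})\<^sup>2 \<le> sum w I"
    and w_le: "\<And>v. v \<in> Vs \<Longrightarrow> 4 * real (w v) \<le> \<theta>\<^sup>2"
    and lam: "1 \<le> lam" and theta: "1 \<le> \<theta>" "\<theta> \<le> \<Theta>" "8 * real n ^ 2 \<le> exp \<theta>"
    and card_V: "real (card V) \<le> exp \<Lambda>" and Lambda: "0 \<le> \<Lambda>"
    and drc: "4 * (real (card (Vs - W)) * \<Lambda> + 1) \<le> \<theta>\<^sup>2 * exp lam"
    and k: "n \<le> 2 ^ k"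
    and kappa: "(8 * real n ^ 2 * (2 * real n) ^ nat \<lfloor>\<theta>\<rfloor>) ^ k * (4 * real n * (2 * real n) ^ nat \<lfloor>\<theta>\<rfloor>) \<le> exp \<kappa>"
    and Theta: "(2 * real n) ^ (2 * \<Delta>) * (512 * real n ^ 4) * exp (2 * \<kappa>) \<le> exp \<Theta>"
begin

sublocale full: colouring c E V Vs n "\<lambda>_ _ _. True" 0
  by standard (use finite_V fin_Vs card_Vs n_ge edge_card in auto)

context
  notes of_nat_sum [simp del]
begin

lemma kappa_nonneg: "0 \<le> \<kappa>"
proof -
  have n1: "1 \<le> real n" using n_ge by simp
  have a: "1 \<le> (2 * real n) ^ nat \<lfloor>\<theta>\<rfloor>" using n1 by (intro one_le_power) simp
  have "1 \<le> real n ^ 2" using n1 by (rule one_le_power)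
  then have "1 * 1 \<le> (8 * real n ^ 2) * (2 * real n) ^ nat \<lfloor>\<theta>\<rfloor>" using a by (intro mult_mono) auto
  then have b: "1 \<le> (8 * real n ^ 2 * (2 * real n) ^ nat \<lfloor>\<theta>\<rfloor>) ^ k" by (intro one_le_power) simp
  have "1 * (1 * 1) \<le> (8 * real n ^ 2 * (2 * real n) ^ nat \<lfloor>\<theta>\<rfloor>) ^ k * (4 * real n * (2 * real n) ^ nat \<lfloor>\<theta>\<rfloor>)"
    using a b n1 by (intro mult_mono) auto
  from order_trans[OF this kappa] have "exp 0 \<le> exp \<kappa>" by simp
  then show ?thesis by simp
qed

text \<open>What matters is \<open>\<delta>\<close> relative to the size of \<open>S\<close>: it
  amounts to a bounded multiple of \<open>n\<close> blocks, while \<open>S\<close> has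
  \<open>M\<close> of them. With \<open>M\<close> about \<open>7 * n * exp g\<close> the set
  \<open>S\<close> has at least \<open>(\<delta> + 1) * exp g\<close> points, as the inner recursion
  requires. Both colours occur in \<open>robust\<close> because candidates of low degree vertices
  have to be protected for both targets.\<close>

lemma robust_copy:
  assumes IJ: "I \<subseteq> Vs" "J \<subseteq> Vs" and Z: "Z \<subseteq> V"
    and g: "g = \<kappa> + 50 * lam * sqrt (sqrt (real (sum w I) * real (sum w J)))"
    and large: "32 * real n ^ 2 * exp g \<le> real (card Z)"
    and robust: "\<And>col X Y. X \<subseteq> Z \<Longrightarrow> Y \<subseteq> Z \<Longrightarrow> before X Y \<or> before Y X \<Longrightarrow>
      real (card Z) / ((2 * real n) ^ (2 * \<Delta>) * (256 * real n ^ 4) * exp (2 * g)) \<le> real (card X) \<Longrightarrow>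
      real (card Z) / ((2 * real n) ^ (2 * \<Delta>) * (256 * real n ^ 4) * exp (2 * g)) \<le> real (card Y) \<Longrightarrow>
      \<not> sparse c col (1 / (2 * real n)) X Y"
    and AB: "I \<inter> A = {}" "J \<inter> B = {}"
  shows "(\<exists>\<psi>. full.copy col I A \<phi> Z \<psi>) \<or> (\<exists>\<psi>. full.copy (\<not> col) J B \<chi> Z \<psi>)"
proof -
  have n1: "1 \<le> real n" using n_ge by simp
  have n2: "1 \<le> real n ^ 2" using n1 by (rule one_le_power)
  have finZ: "finite Z" using Z finite_V finite_subset by blast
  have g0: "0 \<le> g" unfolding g using kappa_nonneg lam by simp
  have eg: "1 \<le> exp g" using g0 by simp
  define M where "M = nat \<lceil>7 * real n * exp g\<rceil>"
  have ne1: "1 * 1 \<le> real n * exp g" using n1 eg by (intro mult_mono) auto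
  have Mlow: "7 * real n * exp g \<le> real M" unfolding M_def by linarith
  have Mup: "real M \<le> 8 * real n * exp g"
  proof -
    have "real M \<le> 7 * real n * exp g + 1" unfolding M_def using n1 by (simp add: of_nat_ceiling)
    then show ?thesis using ne1 by linarith
  qed
  have M1: "1 \<le> M" using Mlow ne1 by linarith
  define len where "len = card Z div M"
  have lenZ: "real (card Z) \<le> 2 * real M * real len" and len2n: "2 * n \<le> len"
  proof -
    have "2 * real n * real M \<le> 2 * real n * (8 * real n * exp g)" using Mup n1 by (intro mult_left_mono) auto
    also have "\<dots> \<le> 32 * real n ^ 2 * exp g" by (simp add: power2_eq_square)
    finally have "2 * real n * real M \<le> real (card Z)" using large by linarith
    then have "2 * n * M \<le> card Z" by (metis of_nat_le_iff of_nat_mult of_nat_numeral)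
    then have "2 * n * M div M \<le> card Z div M" by (rule div_le_mono)
    then show l: "2 * n \<le> len" unfolding len_def using M1 by simp
    have "card Z = M * len + card Z mod M" unfolding len_def by simp
    moreover have "card Z mod M < M" using M1 by simp
    moreover have "M * 1 \<le> M * len" using l n_ge by (intro mult_left_mono) auto
    ultimately have "card Z \<le> 2 * M * len" by linarith
    then show "real (card Z) \<le> 2 * real M * real len" by (metis of_nat_le_iff of_nat_mult of_nat_numeral)
  qed
  have len1: "1 \<le> len" using len2n n_ge by linarith
  have "M * len \<le> card Z" unfolding len_def by simp
  then obtain S where S: "S \<subseteq> Z" "card S = M * len" "finite S" using obtain_subset_with_card_n by metis
  have ex: "\<exists>C. \<forall>b<M. (\<forall>w\<in>Vs. C b w \<subseteq> {x \<in> S. rank_in S x div len = b}) \<and>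
    (\<forall>w\<in>Vs. real len / (2 * real n) \<le> real (card (C b w))) \<and>
    (\<forall>v\<in>Vs. \<forall>w\<in>Vs. v < w \<longrightarrow> before (C b v) (C b w))"
  proof (intro choice allI)
    fix b
    show "\<exists>Cb. b < M \<longrightarrow> (\<forall>w\<in>Vs. Cb w \<subseteq> {x \<in> S. rank_in S x div len = b}) \<and>
      (\<forall>w\<in>Vs. real len / (2 * real n) \<le> real (card (Cb w))) \<and>
      (\<forall>v\<in>Vs. \<forall>w\<in>Vs. v < w \<longrightarrow> before (Cb v) (Cb w))"
    proof (cases "b < M")
      case True
      have "(b + 1) * len \<le> M * len" using True by (intro mult_right_mono) auto
      then have cb: "card {x \<in> S. rank_in S x div len = b} = len"
        using card_rank_block(2)[OF S(3), of len b] len1 S(2) by simp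
      have "finite {x \<in> S. rank_in S x div len = b}" using S(3) by simp
      then obtain Cb where Cb: "\<And>v. v \<in> Vs \<Longrightarrow> Cb v \<subseteq> {x \<in> S. rank_in S x div len = b}"
        "\<And>v. v \<in> Vs \<Longrightarrow> real (card {x \<in> S. rank_in S x div len = b}) / (2 * real n) \<le> real (card (Cb v))"
        "\<And>u v. u \<in> Vs \<Longrightarrow> v \<in> Vs \<Longrightarrow> u < v \<Longrightarrow> before (Cb u) (Cb v)"
        by (rule ordered_pieces[OF _ fin_Vs card_Vs n_ge]) (use len2n cb in auto)
      show ?thesis using Cb(1,3) Cb(2)[unfolded cb] by (intro exI[of _ Cb]) blast
    qed blast
  qed
  then obtain C where C': "\<forall>b<M. (\<forall>w\<in>Vs. C b w \<subseteq> {x \<in> S. rank_in S x div len = b}) \<and>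
    (\<forall>w\<in>Vs. real len / (2 * real n) \<le> real (card (C b w))) \<and>
    (\<forall>v\<in>Vs. \<forall>w\<in>Vs. v < w \<longrightarrow> before (C b v) (C b w))" ..
  have C: "\<And>b w. b < M \<Longrightarrow> w \<in> Vs \<Longrightarrow> C b w \<subseteq> {x \<in> S. rank_in S x div len = b}"
    "\<And>b w. b < M \<Longrightarrow> w \<in> Vs \<Longrightarrow> real len / (2 * real n) \<le> real (card (C b w))"
    "\<And>b v w. b < M \<Longrightarrow> v \<in> Vs \<Longrightarrow> w \<in> Vs \<Longrightarrow> v < w \<Longrightarrow> before (C b v) (C b w)"
    using C' by blast+
  define q where "q = 1 / (2 * real n)"
  define Q where "Q = (2 * real n) ^ (2 * \<Delta>)"
  have Q1: "1 \<le> Q" unfolding Q_def using n1 by (intro one_le_power) simp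
  have qQ: "q ^ (2 * \<Delta>) = 1 / Q" unfolding q_def Q_def by (simp add: power_one_over)
  \<comment> \<open>\<open>len / (2 * n ^ 2 * Q)\<close> is the largest value that the condition
    \<open>tau\<close> allows; the further division by \<open>M\<close> keeps the union over all
    blocks below \<open>n * len\<close>.\<close>
  define \<tau> where "\<tau> = real len / (2 * real n ^ 2 * real M * Q)"
  have pos: "0 < real n" "0 < real len" "0 < real M" "0 < Q" using n1 len1 M1 Q1 by auto
  have tau0: "0 < \<tau>" unfolding \<tau>_def using pos by simp
  have tau1: "\<tau> \<le> q ^ (2 * \<Delta>) * (real len / (2 * real n)) / real n"
  proof -
    have "\<tau> = real len / (2 * real n ^ 2 * Q) / real M" unfolding \<tau>_def by (simp add: ac_simps)
    also have "\<dots> \<le> real len / (2 * real n ^ 2 * Q) / 1" using pos M1 by (intro divide_left_mono) auto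
    finally show ?thesis unfolding qQ by (simp add: power2_eq_square ac_simps)
  qed
  have tau2: "2 * real M * real n * \<tau> \<le> real n * real len"
  proof -
    have "2 * real M * \<tau> = real len / (real n ^ 2 * Q)" unfolding \<tau>_def using pos by simp
    also have "\<dots> \<le> real len / 1"
    proof (rule divide_left_mono)
      have "1 * 1 \<le> real n ^ 2 * Q" using n2 Q1 by (intro mult_mono) auto
      then show "1 \<le> real n ^ 2 * Q" by simp
    qed (use pos in auto)
    finally have "2 * real M * \<tau> \<le> real len" by simp
    then have "real n * (2 * real M * \<tau>) \<le> real n * real len" by (intro mult_left_mono) auto
    then show ?thesis by (simp add: ac_simps)
  qed
  \<comment> \<open>By \<open>card Z \<le> 2 * M * len\<close> the ratio
    \<open>card Z / \<tau>\<close> is at most \<open>4 * n ^ 2 * Q * M ^ 2\<close>, and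
    \<open>M \<le> 8 * n * exp g\<close> gives the constant 256.\<close>
  have tau3: "real (card Z) / (Q * (256 * real n ^ 4) * exp (2 * g)) \<le> \<tau>"
  proof -
    have "real (card Z) * (2 * real n ^ 2 * real M * Q) \<le> 2 * real M * real len * (2 * real n ^ 2 * real M * Q)"
      using lenZ pos by (intro mult_right_mono) auto
    also have "\<dots> = real len * (4 * real n ^ 2 * Q * real M ^ 2)" by (simp add: power2_eq_square)
    also have "\<dots> \<le> real len * (4 * real n ^ 2 * Q * (8 * real n * exp g) ^ 2)"
      using Mup pos by (intro mult_left_mono power_mono) auto
    also have "\<dots> = real len * (Q * (256 * real n ^ 4) * exp (2 * g))"
      by (simp add: power_mult_distrib exp_double power2_eq_square power4_eq_xxxx)
    finally show ?thesis unfolding \<tau>_def using pos by (simp add: divide_simps mult_ac)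
  qed
  interpret rb: robust_blocks c E S Vs W n \<Delta> M len C "real len / (2 * real n)" \<tau> q
  proof
    show "\<not> sparse c col q X Y" if "X \<subseteq> S" "Y \<subseteq> S" "before X Y \<or> before Y X" "\<tau> \<le> real (card X)" "\<tau> \<le> real (card Y)" for col X Y
      unfolding q_def using that S(1) tau3 unfolding Q_def by (intro robust) auto
    show "0 < len" "0 < M" using len1 M1 by auto
    show "0 < q" "q \<le> 1" unfolding q_def using n1 by (auto simp: field_simps)
    show "0 < real len / (2 * real n)" using pos by simp
  qed (use S fin_Vs card_Vs n_ge edge_card W low C tau0 tau1 in auto)
  have delta: "rb.\<delta> + 1 \<le> 7 * real n * real len"
  proof -
    have "1 * 1 \<le> real n * real len" using n1 len1 by (intro mult_mono) auto
    then show ?thesis unfolding rb.\<delta>_def using tau2 by linarith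
  qed
  define N where "N = (rb.\<delta> + 1) * exp \<kappa>"
  have d0: "0 \<le> rb.\<delta>" by (rule rb.high.delta_nonneg)
  define D where "D = nat \<lfloor>\<theta>\<rfloor>"
  have crude: "(8 * real n ^ 2 * (2 * real n) ^ D) ^ k * (4 * real n * (rb.\<delta> + 1) * (2 * real n) ^ D) \<le> N"
  proof -
    have "(rb.\<delta> + 1) * ((8 * real n ^ 2 * (2 * real n) ^ D) ^ k * (4 * real n * (2 * real n) ^ D)) \<le> (rb.\<delta> + 1) * exp \<kappa>"
      using kappa d0 unfolding D_def by (intro mult_left_mono) auto
    then show ?thesis unfolding N_def by (simp only: mult_ac)
  qed
  have subw: "sum w (I' - W) \<le> sum w I'" if "I' \<subseteq> Vs" for I'
    using finite_subset[OF that fin_Vs] by (intro sum_mono2) auto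
  have inner: "rb.high.ram col (I - W) (J - W)
     (N * exp (50 * lam * sqrt (sqrt (real (sum w (I - W)) * real (sum w (J - W))))))"
  proof (rule rb.high.inner_ram[where \<theta> = \<theta> and \<Lambda> = \<Lambda> and d = d])
    show "(card {u \<in> I'. d v \<le> d u \<and> {u, v} \<in> E})\<^sup>2 \<le> sum w I'" if "I' \<subseteq> Vs - W" "v \<in> I'" for I' v
      using that by (intro degen) auto
    show "4 * real (w v) \<le> \<theta>\<^sup>2" if "v \<in> Vs - W" for v using that w_le by blast
    have "card S \<le> card V" using S Z finite_V by (intro card_mono) auto
    then show "real (card S) \<le> exp \<Lambda>" using card_V by linarith
    show "4 * real n * (rb.\<delta> + 1) \<le> N"
    proof -
      have a: "1 \<le> (2 * real n) ^ D" using n1 by (intro one_le_power) simp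
      have "1 * 1 \<le> (8 * real n ^ 2) * (2 * real n) ^ D" using a n2 by (intro mult_mono) auto
      then have b: "1 \<le> (8 * real n ^ 2 * (2 * real n) ^ D) ^ k" by (intro one_le_power) simp
      have "4 * real n * (rb.\<delta> + 1) = 1 * (4 * real n * (rb.\<delta> + 1) * 1)" by simp
      also have "\<dots> \<le> (8 * real n ^ 2 * (2 * real n) ^ D) ^ k * (4 * real n * (rb.\<delta> + 1) * (2 * real n) ^ D)"
        using a b d0 n1 by (intro mult_mono mult_nonneg_nonneg) auto
      finally show ?thesis using crude by (rule order_trans)
    qed
    show "rb.high.ram col' I' J' N" if h: "I' \<subseteq> Vs - W" "J' \<subseteq> Vs - W" "real (sum w I') \<le> \<theta>\<^sup>2" for col' I' J'
    proof (rule rb.high.ram_mono[OF _ crude], rule rb.high.crude_ram[where d = d])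
      show "card J' \<le> 2 ^ k" using card_mono[OF rb.high.fin_U h(2)] rb.high.card_U k by linarith
      fix v assume v: "v \<in> I'"
      have "(card {u \<in> I'. d v \<le> d u \<and> {u, v} \<in> E})\<^sup>2 \<le> sum w I'" using v h by (intro degen) auto
      then have "real (card {u \<in> I'. d v \<le> d u \<and> {u, v} \<in> E}) ^ 2 \<le> real (sum w I')"
        by (metis of_nat_le_iff of_nat_power)
      then have "real (card {u \<in> I'. d v \<le> d u \<and> {u, v} \<in> E}) ^ 2 \<le> \<theta>\<^sup>2" using h(3) by linarith
      then have "real (card {u \<in> I'. d v \<le> d u \<and> {u, v} \<in> E}) \<le> \<theta>" using theta(1) by - (rule power2_le_imp_le, auto)
      then show "card {u \<in> I'. d v \<le> d u \<and> {u, v} \<in> E} \<le> D" unfolding D_def by (simp add: le_nat_floor)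
    qed (use h in auto)
  qed (use lam theta Lambda drc IJ in auto)
  have "N * exp (50 * lam * sqrt (sqrt (real (sum w (I - W)) * real (sum w (J - W))))) \<le> real (card S)"
  proof -
    have "real (sum w (I - W)) * real (sum w (J - W)) \<le> real (sum w I) * real (sum w J)"
      using subw[OF IJ(1)] subw[OF IJ(2)] by (intro mult_mono) auto
    then have "50 * lam * sqrt (sqrt (real (sum w (I - W)) * real (sum w (J - W)))) \<le>
      50 * lam * sqrt (sqrt (real (sum w I) * real (sum w J)))" using lam by (intro mult_left_mono) auto
    then have "N * exp (50 * lam * sqrt (sqrt (real (sum w (I - W)) * real (sum w (J - W))))) \<le>
      N * exp (50 * lam * sqrt (sqrt (real (sum w I) * real (sum w J))))"
      unfolding N_def using d0 by (intro mult_left_mono) auto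
    also have "\<dots> = (rb.\<delta> + 1) * exp g" unfolding N_def g by (simp add: exp_add)
    also have "\<dots> \<le> 7 * real n * real len * exp g" using delta by (intro mult_right_mono) auto
    also have "\<dots> = (7 * real n * exp g) * real len" by simp
    also have "\<dots> \<le> real M * real len" using Mlow by (intro mult_right_mono) auto
    finally show ?thesis using S(2) by simp
  qed
  then have "(\<exists>\<psi>. rb.high.copy col (I - W) {} \<phi> S \<psi>) \<or> (\<exists>\<psi>. rb.high.copy (\<not> col) (J - W) {} \<chi> S \<psi>)"
    using inner[unfolded rb.high.ram_def, rule_format, of S "{}" "{}" \<phi> \<chi>] rb.Good_empty by blast
  \<comment> \<open>The inner recursion was run with nothing prescribed. As \<open>full\<close> has
    no admissibility condition, the prescribed values can be put back outside the target
    afterwards.\<close>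
  moreover have "\<exists>\<psi>'. full.copy col' I' A' \<phi>' Z \<psi>'"
    if h: "rb.high.copy col' (I' - W) {} \<phi>' S \<psi>" "I' \<subseteq> Vs" "I' \<inter> A' = {}" for col' I' A' \<phi>' \<psi>
  proof -
    obtain \<psi>' where \<psi>': "\<And>u. u \<in> I' \<Longrightarrow> \<psi>' u \<in> S" "\<And>u v. u \<in> I' \<Longrightarrow> v \<in> I' \<Longrightarrow> u < v \<Longrightarrow> \<psi>' u < \<psi>' v"
      "\<And>u v. u \<in> I' \<Longrightarrow> v \<in> I' \<Longrightarrow> {u, v} \<in> E \<Longrightarrow> c {\<psi>' u, \<psi>' v} = col'"
      using rb.complete_copy[OF h(2,1)] by metis
    have "full.copy col' I' A' \<phi>' Z (\<lambda>u. if u \<in> I' then \<psi>' u else \<phi>' u)"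
      unfolding full.copy_def using \<psi>' h(3) S(1) by auto
    then show ?thesis by blast
  qed
  ultimately show ?thesis using IJ AB by blast
qed

text \<open>Either \<open>Z\<close> is robust and contains a copy at once, or there is a pair of
  density below \<open>1 / (2 n)\<close>, whose colour decides which target is split, be it the
  heavier or the lighter one. This is harmless because the price is bounded through the symmetric
  potential \<open>x\<close>. A split releases \<open>1700 * (3 / 50) = 102\<close> units
  \<open>lam * x\<close>: 100 of them pay for the inner exponent in \<open>exp (2 * g)\<close>, the
  rest covers \<open>exp \<Theta>\<close>, as \<open>\<Theta> \<le> x\<close>.\<close>

lemma outer_ram:
  assumes N: "1 \<le> N"
    and base: "\<And>col I J. I \<subseteq> Vs \<Longrightarrow> J \<subseteq> Vs \<Longrightarrow> real (sum w I) \<le> \<Theta>\<^sup>2 \<Longrightarrow> full.ram col I J N"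
    and IJ: "I \<subseteq> Vs" "J \<subseteq> Vs"
  shows "full.ram col I J (N * exp (1700 * lam * sqrt (sqrt (real (sum w I) * real (sum w J)))))"
  using IJ
proof (induction "sum w I + sum w J" arbitrary: col I J rule: less_induct)
  case less
  define x where "x = sqrt (sqrt (real (sum w I) * real (sum w J)))"
  have n1: "1 \<le> real n" using n_ge by simp
  have n2: "1 \<le> real n ^ 2" "1 \<le> real n ^ 4" using n1 by (rule one_le_power)+
  have ge: "N \<le> N * exp (1700 * lam * x)"
    using N lam unfolding x_def by (simp add: mult_le_cancel_left1)
  show ?case
  proof (cases "real (sum w I) \<le> \<Theta>\<^sup>2 \<or> real (sum w J) \<le> \<Theta>\<^sup>2")
    case True
    then show ?thesis
    proof
      assume "real (sum w I) \<le> \<Theta>\<^sup>2"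
      then show ?thesis using base[OF less.prems] ge full.ram_mono unfolding x_def by blast
    next
      assume "real (sum w J) \<le> \<Theta>\<^sup>2"
      then show ?thesis
        using full.ram_swap[OF base[OF less.prems(2,1), of "\<not> col"]] ge full.ram_mono unfolding x_def by simp
    qed
  next
    case False
    have Th: "1 \<le> \<Theta>" using theta by linarith
    have xT: "\<Theta> \<le> x"
    proof -
      have "\<Theta>\<^sup>2 * \<Theta>\<^sup>2 \<le> real (sum w I) * real (sum w J)" using False by (intro mult_mono) auto
      then have "sqrt (sqrt (\<Theta>\<^sup>2 * \<Theta>\<^sup>2)) \<le> x" unfolding x_def by simp
      moreover have "sqrt (sqrt (\<Theta>\<^sup>2 * \<Theta>\<^sup>2)) = \<Theta>" using Th by (simp only: real_sqrt_mult real_sqrt_abs) simp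
      ultimately show ?thesis by simp
    qed
    have x1: "1 \<le> x" using xT Th by linarith
    have lx: "x \<le> lam * x" using lam x1 by simp
    define M where "M = N * exp (1598 * lam * x)"
    have MN: "N \<le> M" unfolding M_def using N lam x1 by (simp add: mult_le_cancel_left1)
    define g where "g = \<kappa> + 50 * lam * x"
    define Q where "Q = (2 * real n) ^ (2 * \<Delta>)"
    have Q1: "1 \<le> Q" unfolding Q_def using n1 by (intro one_le_power) simp
    have cost: "Q * (512 * real n ^ 4) * exp (2 * g) \<le> exp (102 * lam * x)"
    proof -
      have "Q * (512 * real n ^ 4) * exp (2 * g) = Q * (512 * real n ^ 4) * exp (2 * \<kappa>) * exp (100 * lam * x)"
        unfolding g_def by (simp add: exp_add[symmetric] algebra_simps)
      also have "\<dots> \<le> exp \<Theta> * exp (100 * lam * x)" using Theta unfolding Q_def by (intro mult_right_mono) auto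
      also have "\<dots> \<le> exp (lam * x) * exp (100 * lam * x)" using xT lx by (intro mult_right_mono) auto
      also have "\<dots> \<le> exp (102 * lam * x)" using lam x1 by (simp add: exp_add[symmetric])
      finally show ?thesis .
    qed
    have fin: "finite I" "finite J" using less.prems fin_Vs finite_subset by blast+
    have split: "\<exists>L R. K = L \<union> R \<and> before L R \<and> 4 * sum w L \<le> 3 * sum w K \<and> 4 * sum w R \<le> 3 * sum w K"
      if K: "K \<subseteq> Vs" "\<Theta>\<^sup>2 < real (sum w K)" for K
    proof -
      have "\<theta>\<^sup>2 \<le> \<Theta>\<^sup>2" using theta by (intro power_mono) auto
      then have a: "4 * w v \<le> sum w K" if "v \<in> K" for v
        using w_le[of v] that K by fastforce
      have "0 < \<Theta>\<^sup>2" using Th by simp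
      then have b: "0 < sum w K" using K(2) by linarith
      have "finite K" using K fin_Vs finite_subset by blast
      from split_by_weight[OF this a b] show ?thesis by metis
    qed
    have shrink: "N * exp (1700 * lam * sqrt (sqrt y)) \<le> M" if "y \<le> 3 / 4 * (real (sum w I) * real (sum w J))" for y
    proof -
      have "sqrt (sqrt y) \<le> 47 / 50 * x" unfolding x_def using that by (intro sqrt_sqrt_shrink) auto
      then have "1700 * lam * sqrt (sqrt y) \<le> 1700 * lam * (47 / 50 * x)" using lam by (intro mult_left_mono) auto
      then show ?thesis unfolding M_def using N by (intro mult_left_mono) auto
    qed
    show ?thesis
      unfolding full.ram_def x_def[symmetric]
    proof (intro allI impI)
      fix Z A \<phi> B \<chi>
      assume h: "Z \<subseteq> V" "N * exp (1700 * lam * x) \<le> real (card Z)" "A \<subseteq> Vs" "B \<subseteq> Vs" "I \<inter> A = {}" "J \<inter> B = {}" True True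
      have finZ: "finite Z" using h(1) finite_V finite_subset by blast
      define \<tau> where "\<tau> = real (card Z) / (Q * (256 * real n ^ 4) * exp (2 * g))"
      have tau: "2 * M \<le> \<tau>"
      proof -
        have "2 * M * (Q * (256 * real n ^ 4) * exp (2 * g)) = M * (Q * (512 * real n ^ 4) * exp (2 * g))" by simp
        also have "\<dots> \<le> M * exp (102 * lam * x)" using cost MN N by (intro mult_left_mono) auto
        also have "\<dots> = N * exp (1700 * lam * x)" unfolding M_def by (simp add: exp_add[symmetric] algebra_simps)
        finally have "2 * M * (Q * (256 * real n ^ 4) * exp (2 * g)) \<le> real (card Z)" using h(2) by linarith
        moreover have "0 < Q * (256 * real n ^ 4) * exp (2 * g)" using Q1 n1 by (intro mult_pos_pos) auto
        ultimately show ?thesis unfolding \<tau>_def by (simp add: pos_le_divide_eq)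
      qed
      show "(\<exists>\<psi>. full.copy col I A \<phi> Z \<psi>) \<or> (\<exists>\<psi>. full.copy (\<not> col) J B \<chi> Z \<psi>)"
      proof (cases "\<exists>col' X Y. X \<subseteq> Z \<and> Y \<subseteq> Z \<and> (before X Y \<or> before Y X) \<and> \<tau> \<le> real (card X) \<and> \<tau> \<le> real (card Y) \<and>
          sparse c col' (1 / (2 * real n)) X Y")
        case no: False
        show ?thesis
        proof (rule robust_copy[OF less.prems h(1) g_def[unfolded x_def]])
          have "32 * real n ^ 2 * exp g \<le> Q * (512 * real n ^ 4) * exp (2 * g)"
          proof -
            have "real n ^ 2 \<le> real n ^ 4" using n1 by (intro power_increasing) auto
            then have "32 * real n ^ 2 \<le> 512 * real n ^ 4" using n2 by linarith
            moreover have "1 * (512 * real n ^ 4) \<le> Q * (512 * real n ^ 4)" using Q1 by (intro mult_right_mono) auto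
            ultimately have "32 * real n ^ 2 \<le> Q * (512 * real n ^ 4)" by linarith
            moreover have "0 \<le> g" unfolding g_def using kappa_nonneg lam x1 by simp
            ultimately show ?thesis using Q1 by - (rule mult_mono, auto)
          qed
          also have "\<dots> \<le> exp (102 * lam * x)" by (rule cost)
          also have "\<dots> \<le> 1 * exp (1700 * lam * x)" using lam x1 by simp
          also have "\<dots> \<le> N * exp (1700 * lam * x)" using N by (intro mult_right_mono) auto
          finally show "32 * real n ^ 2 * exp g \<le> real (card Z)" using h(2) by linarith
        next
          fix col' X Y
          assume "X \<subseteq> Z" "Y \<subseteq> Z" "before X Y \<or> before Y X"
            "real (card Z) / ((2 * real n) ^ (2 * \<Delta>) * (256 * real n ^ 4) * exp (2 * g)) \<le> real (card X)"
            "real (card Z) / ((2 * real n) ^ (2 * \<Delta>) * (256 * real n ^ 4) * exp (2 * g)) \<le> real (card Y)"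
          then show "\<not> sparse c col' (1 / (2 * real n)) X Y"
            using no unfolding \<tau>_def Q_def by blast
        qed (use h in auto)
      next
        case True
        then obtain col' X Y where XY: "X \<subseteq> Z" "Y \<subseteq> Z" "before X Y \<or> before Y X" "\<tau> \<le> real (card X)" "\<tau> \<le> real (card Y)"
          "sparse c col' (1 / (2 * real n)) X Y" by blast
        have MX: "M \<le> real (card X)" using XY(4) tau MN N by linarith
        have MT: "M \<le> real (card {y \<in> Y. \<forall>x\<in>T. c {x, y} = (\<not> col')})" if T: "T \<subseteq> X" "card T \<le> n" for T
        proof -
          have "real (card T) * (1 / (2 * real n)) \<le> 1 / 2" using T(2) n1 by (simp add: field_simps)
          then have half: "(1 - 1 / 2) * real (card Y) \<le> (1 - real (card T) * (1 / (2 * real n))) * real (card Y)"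
            by (intro mult_right_mono) auto
          have "finite Y" "finite T" using XY(1,2) T(1) finZ by (meson finite_subset subset_trans)+
          then have "(1 - real (card T) * (1 / (2 * real n))) * real (card Y)
              \<le> real (card {y \<in> Y. \<forall>x\<in>T. c {x, y} = (\<not> col')})"
            using XY(6) T(1) by (intro full.sparse_common)
          with half have "(1 - 1 / 2) * real (card Y) \<le> real (card {y \<in> Y. \<forall>x\<in>T. c {x, y} = (\<not> col')})"
            by (rule order_trans)
          then show ?thesis using XY(5) tau by simp
        qed
        have cn: "card K \<le> n" if "K \<subseteq> Vs" for K using card_mono[OF fin_Vs that] card_Vs by simp
        show ?thesis
        proof (cases "col' = col")
          case True
          obtain L R where LR: "J = L \<union> R" "before L R" "4 * sum w L \<le> 3 * sum w J" "4 * sum w R \<le> 3 * sum w J"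
            using split[OF less.prems(2)] False by auto
          have ramM: "full.ram col I J' M" if J': "J' \<subseteq> Vs" "4 * sum w J' \<le> 3 * sum w J" for J'
          proof (rule full.ram_mono)
            have "0 < real (sum w J)" using False Th by (smt (verit) zero_le_power2)
            then show "full.ram col I J' (N * exp (1700 * lam * sqrt (sqrt (real (sum w I) * real (sum w J')))))"
              using J' less.prems by (intro less.hyps) auto
            have "4 * real (sum w J') \<le> 3 * real (sum w J)" using J'(2) by linarith
            then have "real (sum w I) * (4 * real (sum w J')) \<le> real (sum w I) * (3 * real (sum w J))"
              by (intro mult_left_mono) auto
            then show "N * exp (1700 * lam * sqrt (sqrt (real (sum w I) * real (sum w J')))) \<le> M"
              by (intro shrink) (auto simp: algebra_simps)
          qed
          have "(\<exists>\<psi>. full.copy col I A \<phi> Z \<psi>) \<or> (\<exists>\<psi>. full.copy (\<not> col) (L \<union> R) B \<chi> Z \<psi>)"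
          proof (rule full.ram_pair[OF ramM ramM _ _ LR(2) h(1) XY(1-3) MX])
            show "M \<le> real (card {y \<in> Y. \<forall>x\<in>T. c {x, y} = (\<not> col)})" if "T \<subseteq> X" "card T \<le> card (L \<union> R)" for T
              using MT[OF that(1)] that(2) cn[OF less.prems(2)] LR(1) \<open>col' = col\<close> by simp
          qed (use LR less.prems h in auto)
          then show ?thesis using LR(1) by simp
        next
          case ne: False
          obtain L R where LR: "I = L \<union> R" "before L R" "4 * sum w L \<le> 3 * sum w I" "4 * sum w R \<le> 3 * sum w I"
            using split[OF less.prems(1)] False by auto
          have ramM: "full.ram (\<not> col) J I' M" if I': "I' \<subseteq> Vs" "4 * sum w I' \<le> 3 * sum w I" for I'
          proof (rule full.ram_mono)
            have "0 < real (sum w I)" using False Th by (smt (verit) zero_le_power2)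
            then show "full.ram (\<not> col) J I' (N * exp (1700 * lam * sqrt (sqrt (real (sum w J) * real (sum w I')))))"
              using I' less.prems by (intro less.hyps) auto
            have "4 * real (sum w I') \<le> 3 * real (sum w I)" using I'(2) by linarith
            then have "real (sum w J) * (4 * real (sum w I')) \<le> real (sum w J) * (3 * real (sum w I))"
              by (intro mult_left_mono) auto
            then show "N * exp (1700 * lam * sqrt (sqrt (real (sum w J) * real (sum w I')))) \<le> M"
              by (intro shrink) (auto simp: algebra_simps)
          qed
          have "(\<exists>\<psi>. full.copy (\<not> col) J B \<chi> Z \<psi>) \<or> (\<exists>\<psi>. full.copy (\<not> \<not> col) (L \<union> R) A \<phi> Z \<psi>)"
          proof (rule full.ram_pair[OF ramM ramM _ _ LR(2) h(1) XY(1-3) MX])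
            show "M \<le> real (card {y \<in> Y. \<forall>x\<in>T. c {x, y} = (\<not> \<not> col)})" if "T \<subseteq> X" "card T \<le> card (L \<union> R)" for T
              using MT[OF that(1)] that(2) cn[OF less.prems(1)] LR(1) ne by auto
          qed (use LR less.prems h in auto)
          then show ?thesis using LR(1) by auto
        qed
      qed
    qed
  qed
qed

end

end

section \<open>Choice of the parameters\<close>

lemma ordered_ramsey_number_le:
  assumes graph: "ordered_graph n E"
    and emb: "\<And>c :: nat set \<Rightarrow> bool. \<exists>col \<psi>. (\<forall>u\<in>{1..n}. \<psi> u \<in> {1..N}) \<and> (\<forall>u\<in>{1..n}. \<forall>v\<in>{1..n}. u < v \<longrightarrow> \<psi> u < \<psi> v) \<and>
      (\<forall>u\<in>{1..n}. \<forall>v\<in>{1..n}. {u, v} \<in> E \<longrightarrow> c {\<psi> u, \<psi> v} = col)"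
  shows "ordered_ramsey_number n E \<le> N"
  unfolding ordered_ramsey_number_def
proof (rule Least_le, unfold ordered_ramsey_property_def, intro allI)
  fix c :: "nat set \<Rightarrow> bool"
  obtain col \<psi> where \<psi>: "\<forall>u\<in>{1..n}. \<psi> u \<in> {1..N}" "\<forall>u\<in>{1..n}. \<forall>v\<in>{1..n}. u < v \<longrightarrow> \<psi> u < \<psi> v"
    "\<forall>u\<in>{1..n}. \<forall>v\<in>{1..n}. {u, v} \<in> E \<longrightarrow> c {\<psi> u, \<psi> v} = col" using emb[of c] by blast
  have edge: "{\<psi> i, \<psi> j} \<in> {e \<in> nsets {1..N} 2. c e = col}" if h: "i \<in> {1..n}" "j \<in> {1..n}" "{i, j} \<in> E" for i j
  proof -
    have "card {i, j} = 2" using h(3) graph unfolding ordered_graph_def nsets_def by blast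
    then have "i \<noteq> j" by auto
    then have "\<psi> i \<noteq> \<psi> j" using \<psi>(2) h by (metis linorder_neqE_nat less_irrefl)
    then show ?thesis using \<psi>(1,3) h by (auto simp: nsets_def)
  qed
  have "ordered_contains N {e \<in> nsets {1..N} 2. c e = col} n E"
    unfolding ordered_contains_def using \<psi>(1,2) edge by (intro exI[of _ \<psi>]) blast
  then show "\<exists>b. ordered_contains N {e \<in> nsets {1..N} 2. c e = b} n E" by blast
qed

lemma power_of_two_near:
  assumes "1 \<le> (n :: nat)"
  obtains k where "n \<le> 2 ^ k" "2 ^ k \<le> 2 * n"
proof -
  define k where "k = (LEAST k. n \<le> 2 ^ k)"
  have "n \<le> 2 ^ n" by (simp add: less_imp_le)
  then have k: "n \<le> 2 ^ k" unfolding k_def by (rule LeastI)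
  have "2 ^ k \<le> 2 * n"
  proof (cases k)
    case 0
    then show ?thesis using assms by simp
  next
    case (Suc l)
    then have "\<not> n \<le> 2 ^ l" unfolding k_def using not_less_Least[of l "\<lambda>k. n \<le> 2 ^ k"] by simp
    then show ?thesis using Suc by simp
  qed
  then show ?thesis using that k by blast
qed

text \<open>Everything is estimated by powers of \<open>B = 4 * m\<close>: the product is at most
  \<open>B ^ ((D + 3) * (k + 1))\<close>. The constant is \<open>21 = 7 * 3\<close>, from
  \<open>k + 1 \<le> 7 * L\<close> and \<open>ln B \<le> 3 * L\<close>.\<close>

lemma crude_bound:
  fixes n m D k :: nat and x L :: real
  assumes n: "1 \<le> n" "n \<le> 2 * m" and m: "3 \<le> m" and k: "2 ^ k \<le> 2 * n"
    and L: "L = ln (real m)" "1 \<le> L" and D: "real D + 3 \<le> x"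
  shows "(8 * real n ^ 2 * (2 * real n) ^ D) ^ k * (4 * real n * (2 * real n) ^ D) \<le> exp (21 * L\<^sup>2 * x)"
    and "ln (4 * real m) \<le> 3 * L"
proof -
  define B where "B = 4 * real m"
  define b where "b = ln B"
  have B: "12 \<le> B" unfolding B_def using m by simp
  have nB: "2 * real n \<le> B" unfolding B_def using n by linarith
  have "ln (4 :: real) = 2 * ln 2" using ln_realpow[of 2 2] by simp
  then have "ln (4 :: real) \<le> 2" using ln_2_less_1 by linarith
  moreover have "b = ln 4 + L" unfolding b_def B_def L(1) using m by (simp add: ln_mult)
  ultimately have bL: "b \<le> 3 * L" using L(2) by linarith
  then show "ln (4 * real m) \<le> 3 * L" unfolding b_def B_def .
  have b0: "0 < b" unfolding b_def using B by simp
  have "real (2 ^ k) \<le> real (2 * n)" using k by (simp only: of_nat_le_iff)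
  then have "2 ^ k \<le> B" using nB by simp
  then have "ln (2 ^ k) \<le> b" unfolding b_def using B by (subst ln_le_cancel_iff) auto
  then have "real k * ln 2 \<le> b" by (simp add: ln_realpow)
  moreover have "1 / 2 \<le> ln (2 :: real)"
  proof -
    have "exp (1 / 2 :: real) \<le> 2" using exp_bound[of "1 / 2 :: real"] by (simp add: power2_eq_square)
    then show ?thesis by (subst ln_ge_iff) auto
  qed
  then have "real k * (1 / 2) \<le> real k * ln 2" by (intro mult_left_mono) auto
  ultimately have kb: "real k + 1 \<le> 7 * L" using bL L(2) by linarith
  have kb2: "(real k + 1) * b \<le> 21 * L\<^sup>2"
  proof -
    have "(real k + 1) * b \<le> 7 * L * (3 * L)" using kb bL b0 L(2) by (intro mult_mono) auto
    then show ?thesis by (simp add: power2_eq_square)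
  qed
  have "8 * real n ^ 2 = 2 * (2 * real n) ^ 2" by (simp add: power_mult_distrib)
  also have "\<dots> \<le> B * B ^ 2" using nB B by (intro mult_mono power_mono) auto
  finally have p2: "8 * real n ^ 2 \<le> B ^ 3" by (simp add: power2_eq_square power3_eq_cube)
  have "4 * real n = 2 * (2 * real n)" by simp
  also have "\<dots> \<le> B * B" using nB B by (intro mult_mono) auto
  also have "B * B * 1 \<le> B * B * B" using B by (intro mult_left_mono) auto
  finally have p3: "4 * real n \<le> B ^ 3" by (simp add: power3_eq_cube)
  have "(8 * real n ^ 2 * (2 * real n) ^ D) ^ k * (4 * real n * (2 * real n) ^ D) \<le> (B ^ 3 * B ^ D) ^ k * (B ^ 3 * B ^ D)"
    using nB p2 p3 B by (intro mult_mono power_mono mult_nonneg_nonneg zero_le_power) auto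
  also have "\<dots> = B ^ ((D + 3) * (k + 1))" by (simp add: power_add[symmetric] power_mult[symmetric] algebra_simps)
  also have "\<dots> = exp (b * (real ((D + 3) * (k + 1))))"
    unfolding b_def using B by (subst exp_of_nat2_mult) simp
  also have "\<dots> \<le> exp (21 * L\<^sup>2 * x)"
  proof -
    have "b * (real ((D + 3) * (k + 1))) = ((real k + 1) * b) * (real D + 3)" by (simp add: algebra_simps)
    also have "\<dots> \<le> 21 * L\<^sup>2 * x" using kb2 D b0 by - (rule mult_mono, auto)
    finally show ?thesis by simp
  qed
  finally show "(8 * real n ^ 2 * (2 * real n) ^ D) ^ k * (4 * real n * (2 * real n) ^ D) \<le> exp (21 * L\<^sup>2 * x)" .
qed

section \<open>Degrees and weights of the given graph\<close>

locale ordered_graph_m =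
  fixes n m :: nat and E :: "nat set set"
  assumes graph: "ordered_graph n E" and no_iso: "no_isolated_vertices n E"
    and card_E: "card E = m" and m_ge: "3 \<le> m"
begin

definition deg :: "nat \<Rightarrow> nat" where
  "deg v = card {e \<in> E. v \<in> e}"

definition s :: nat where
  "s = nat \<lfloor>sqrt (2 * real m)\<rfloor>"

text \<open>Back-degrees never exceed \<open>sqrt (2 * m)\<close>, so nothing is lost by cutting
  degrees off at \<open>s\<close>. The cut keeps a single vertex, such as the centre of a star, from
  carrying a large part of the weight, which would make balanced splits impossible.\<close>

definition w :: "nat \<Rightarrow> nat" where
  "w v = min (deg v) s"

lemma finite_E: "finite E"
  using card_E m_ge card.infinite by fastforce

lemma edge_sub: "e \<in> E \<Longrightarrow> e \<subseteq> {1..n} \<and> card e = 2"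
  using graph unfolding ordered_graph_def nsets_def by blast

lemma sum_deg: "sum deg {1..n} = 2 * m"
proof -
  have "(\<Sum>v\<in>{1..n}. real (card {e \<in> E. v \<in> e})) = (\<Sum>e\<in>E. real (card {v \<in> {1..n}. v \<in> e}))"
    by (rule sum_card_swap[OF finite_E]) simp
  also have "\<dots> = (\<Sum>e\<in>E. 2)"
  proof (rule sum.cong[OF refl])
    fix e assume "e \<in> E"
    then have "{v \<in> {1..n}. v \<in> e} = e" "card e = 2" using edge_sub[of e] by auto
    then show "real (card {v \<in> {1..n}. v \<in> e}) = 2" by simp
  qed
  finally have "real (sum deg {1..n}) = 2 * real m" unfolding deg_def using card_E by simp
  then show ?thesis by linarith
qed

lemma deg_pos: "v \<in> {1..n} \<Longrightarrow> 1 \<le> deg v"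
  using no_iso finite_E unfolding no_isolated_vertices_def deg_def
  by (metis (mono_tags, lifting) One_nat_def Suc_leI card_gt_0_iff empty_iff finite_Collect_conjI finite_subset mem_Collect_eq subsetI)

lemma n_le: "n \<le> 2 * m"
proof -
  have "(\<Sum>v\<in>{1..n}. 1) \<le> sum deg {1..n}" using deg_pos by (intro sum_mono) auto
  then show ?thesis using sum_deg by simp
qed

lemma n_ge: "1 \<le> n"
  using sum_deg m_ge by (cases n) auto

lemma sum_w: "sum w I \<le> 2 * m" if "I \<subseteq> {1..n}"
proof -
  have "sum w I \<le> sum deg I" unfolding w_def by (intro sum_mono) auto
  also have "\<dots> \<le> sum deg {1..n}" using that by (intro sum_mono2) auto
  finally show ?thesis using sum_deg by simp
qed

lemma card_neighbours:
  assumes "finite T" "\<And>u. u \<in> T \<Longrightarrow> {u, v} \<in> E"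
  shows "card T \<le> deg v"
proof -
  have "inj_on (\<lambda>u. {u, v}) T" by (rule inj_onI) (auto simp: doubleton_eq_iff)
  moreover have "(\<lambda>u. {u, v}) ` T \<subseteq> {e \<in> E. v \<in> e}" using assms(2) by auto
  ultimately show ?thesis unfolding deg_def using card_inj_on_le finite_E by (metis (no_types, lifting) finite_Collect_conjI finite_subset mem_Collect_eq subsetI)
qed

text \<open>Each back-neighbour in \<open>T\<close> has degree at least \<open>deg v\<close>, hence
  at least \<open>card T\<close>, so \<open>(card T) ^ 2\<close> is at most the sum of the degrees
  over \<open>T\<close> and thus at most \<open>2 * m\<close>. Therefore
  \<open>card T \<le> s\<close>, the truncation does no harm on \<open>T\<close>, and the same count
  works with \<open>w\<close>.\<close>

lemma degen:
  assumes "I \<subseteq> {1..n}" "v \<in> I"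
  shows "(card {u \<in> I. deg v \<le> deg u \<and> {u, v} \<in> E})\<^sup>2 \<le> sum w I"
proof -
  define T where "T = {u \<in> I. deg v \<le> deg u \<and> {u, v} \<in> E}"
  have finI: "finite I" using assms(1) finite_subset by blast
  have finT: "finite T" unfolding T_def using finI by simp
  have TI: "T \<subseteq> I" unfolding T_def by auto
  have "card T \<le> deg v" using finT by (rule card_neighbours) (auto simp: T_def)
  then have dT: "card T \<le> deg u" if "u \<in> T" for u using that unfolding T_def by auto
  have "card T * card T \<le> sum deg T" using sum_bounded_below[of T "card T" deg] dT by simp
  also have "\<dots> \<le> sum deg {1..n}" using TI assms(1) by (intro sum_mono2) auto
  finally have "card T * card T \<le> 2 * m" using sum_deg by simp
  then have "real (card T * card T) \<le> real (2 * m)" by (simp only: of_nat_le_iff)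
  then have "real (card T) \<le> sqrt (2 * real m)" by (intro real_le_rsqrt) (simp add: power2_eq_square)
  then have "card T \<le> s" unfolding s_def by (simp add: le_nat_floor)
  then have "card T \<le> w u" if "u \<in> T" for u unfolding w_def using dT[OF that] by simp
  then have "card T * card T \<le> sum w T" using sum_bounded_below[of T "card T" w] by simp
  also have "\<dots> \<le> sum w I" using TI finI by (intro sum_mono2) auto
  finally show ?thesis unfolding T_def by (simp add: power2_eq_square)
qed

text \<open>Meant for bounded \<open>ln m\<close>: the whole graph is the target in both colours,
  and all back-degrees are at most \<open>s\<close>. The constant is \<open>85 = 21 * 4 + 1\<close>,
  where the 1 pays for rounding up to an integer.\<close>

lemma crude_ramsey_number:
  assumes L: "L = ln (real m)" "1 \<le> L"
  shows "real (ordered_ramsey_number n E) \<le> exp (85 * L\<^sup>2 * sqrt (real m))"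
proof -
  obtain k where k: "n \<le> 2 ^ k" "2 ^ k \<le> 2 * n" using power_of_two_near[OF n_ge] by blast
  define N0 where "N0 = (8 * real n ^ 2 * (2 * real n) ^ s) ^ k * (4 * real n * (2 * real n) ^ s)"
  have sx: "real s + 3 \<le> 4 * sqrt (real m)"
  proof -
    have "real s \<le> sqrt (2 * real m)" unfolding s_def by simp
    also have "\<dots> = sqrt 2 * sqrt (real m)" by (simp add: real_sqrt_mult)
    also have "\<dots> \<le> 3 / 2 * sqrt (real m)"
      by (intro mult_right_mono real_le_lsqrt) (auto simp: power2_eq_square)
    finally have 1: "real s \<le> 3 / 2 * sqrt (real m)" .
    have "6 / 5 \<le> sqrt (real m)" using m_ge by (intro real_le_rsqrt) (simp add: power2_eq_square)
    then show ?thesis using 1 by linarith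
  qed
  have N0: "N0 \<le> exp (21 * L\<^sup>2 * (4 * sqrt (real m)))"
    unfolding N0_def by (rule crude_bound(1)[OF n_ge n_le m_ge k(2) L sx])
  define N where "N = nat \<lceil>N0\<rceil>"
  have "ordered_ramsey_number n E \<le> N"
  proof (rule ordered_ramsey_number_le[OF graph])
    fix c :: "nat set \<Rightarrow> bool"
    interpret full: colouring c E "{1..N}" "{1..n}" n "\<lambda>_ _ _. True" 0
      by standard (use n_ge edge_sub in auto)
    have "full.ram True {1..n} {1..n} ((8 * real n ^ 2 * (2 * real n) ^ s) ^ k * (4 * real n * (0 + 1) * (2 * real n) ^ s))"
    proof (rule full.crude_ram[where d = deg])
      show "card {u \<in> {1..n}. deg v \<le> deg u \<and> {u, v} \<in> E} \<le> s" if "v \<in> {1..n}" for v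
      proof -
        have "(card {u \<in> {1..n}. deg v \<le> deg u \<and> {u, v} \<in> E})\<^sup>2 \<le> 2 * m"
          using degen[OF order_refl that] sum_w[OF order_refl] by linarith
        then have "real ((card {u \<in> {1..n}. deg v \<le> deg u \<and> {u, v} \<in> E})\<^sup>2) \<le> real (2 * m)" by (simp only: of_nat_le_iff)
        then have "real (card {u \<in> {1..n}. deg v \<le> deg u \<and> {u, v} \<in> E}) \<le> sqrt (2 * real m)"
          by (intro real_le_rsqrt) simp
        then show ?thesis unfolding s_def by (simp add: le_nat_floor)
      qed
    qed (use k in auto)
    then have "full.ram True {1..n} {1..n} N0" unfolding N0_def by simp
    moreover have "N0 \<le> real (card {1..N})" unfolding N_def by simp linarith
    ultimately have "(\<exists>\<psi>. full.copy True {1..n} {} id {1..N} \<psi>) \<or> (\<exists>\<psi>. full.copy (\<not> True) {1..n} {} id {1..N} \<psi>)"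
      unfolding full.ram_def by blast
    then show "\<exists>col \<psi>. (\<forall>u\<in>{1..n}. \<psi> u \<in> {1..N}) \<and> (\<forall>u\<in>{1..n}. \<forall>v\<in>{1..n}. u < v \<longrightarrow> \<psi> u < \<psi> v) \<and>
      (\<forall>u\<in>{1..n}. \<forall>v\<in>{1..n}. {u, v} \<in> E \<longrightarrow> c {\<psi> u, \<psi> v} = col)"
      unfolding full.copy_def by blast
  qed
  then have "real (ordered_ramsey_number n E) \<le> real N" by simp
  also have "\<dots> \<le> N0 + 1"
  proof -
    have "0 \<le> N0" unfolding N0_def by simp
    then show ?thesis unfolding N_def by (simp add: of_nat_ceiling)
  qed
  also have "\<dots> \<le> 2 * exp (21 * L\<^sup>2 * (4 * sqrt (real m)))"
  proof -
    have "1 \<le> exp (21 * L\<^sup>2 * (4 * sqrt (real m)))" by simp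
    then show ?thesis using N0 by linarith
  qed
  also have "\<dots> \<le> exp 1 * exp (21 * L\<^sup>2 * (4 * sqrt (real m)))"
    using exp_ge_add_one_self[of 1] by (intro mult_right_mono) auto
  also have "\<dots> = exp (1 + 21 * L\<^sup>2 * (4 * sqrt (real m)))" by (rule exp_add[symmetric])
  also have "\<dots> \<le> exp (85 * L\<^sup>2 * sqrt (real m))"
  proof -
    have "1 * 1 \<le> L\<^sup>2 * sqrt (real m)" using L(2) m_ge by (intro mult_mono one_le_power) auto
    then have "1 + 21 * L\<^sup>2 * (4 * sqrt (real m)) \<le> 85 * L\<^sup>2 * sqrt (real m)" by (simp add: mult.commute mult.left_commute)
    then show ?thesis by simp
  qed
  finally show ?thesis .
qed

end

section \<open>The bound for large \<open>m\<close>\<close>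

context ordered_graph_m
begin

text \<open>Powers of \<open>L\<close> are balanced as follows. At most
  \<open>2 * m / \<theta> = 2 * \<theta> * L ^ 10\<close> vertices have degree above
  \<open>\<Delta>\<close>; with \<open>\<Lambda> = \<theta> * L ^ 8\<close> as bound for the ambient
  logarithm, \<open>drc\<close> asks for \<open>exp lam\<close> above a multiple of
  \<open>L ^ 18\<close>, hence \<open>lam = 19 * l\<close>. The crude bound turns a back-degree into
  an exponent at the price of a factor \<open>84 * L ^ 2\<close>: at \<open>\<theta>\<close> this
  gives \<open>\<kappa>\<close>, smaller than \<open>\<Theta> = \<theta> * L ^ 3\<close> by a factor
  of order \<open>L\<close>, and at \<open>\<Theta> = R / L ^ 2\<close> it gives
  \<open>84 * R\<close>, the price of ending the outer recursion.\<close>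

lemma large_ramsey_number:
  assumes L: "L = ln (real m)" "2500 \<le> L" and l: "l = ln L"
  shows "real (ordered_ramsey_number n E) \<le> exp (50000 * l * sqrt (real m))"
proof -
  define R where "R = sqrt (real m)"
  have mpos: "0 < real m" using m_ge by simp
  have Rm: "real m = R\<^sup>2" unfolding R_def by simp
  have l1: "1 \<le> l"
  proof -
    have "exp 1 \<le> (3 :: real)" by (rule exp_le)
    then have "exp 1 \<le> L" using L(2) by linarith
    then show ?thesis unfolding l using L(2) by (subst ln_ge_iff) auto
  qed
  have lL: "l \<le> L" unfolding l using ln_le_minus_one[of L] L(2) by linarith
  \<comment> \<open>This amounts to \<open>24 * ln L \<le> L\<close>. Since
    \<open>ln L \<le> 2 * sqrt L\<close>, it is enough that \<open>sqrt L \<ge> 48\<close>, and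
    \<open>L \<ge> 2500\<close> gives 50.\<close>
  have L12: "L ^ 12 \<le> R"
  proof -
    have "(50 :: real) = sqrt 2500" by simp
    also have "\<dots> \<le> sqrt L" using L(2) by (rule real_sqrt_le_mono)
    finally have s50: "50 \<le> sqrt L" .
    have "l = 2 * ln (sqrt L)" unfolding l using L(2) by (simp add: ln_sqrt)
    then have "l \<le> 2 * sqrt L" using ln_le_minus_one[of "sqrt L"] L(2) by simp
    moreover have "50 * sqrt L \<le> sqrt L * sqrt L" using s50 L(2) by (intro mult_right_mono) auto
    moreover have "sqrt L * sqrt L = L" using L(2) by simp
    ultimately have "24 * l \<le> L" using L(2) by linarith
    then have "12 * l \<le> L / 2" by simp
    then have "exp (12 * l) \<le> exp (L / 2)" by simp
    moreover have "exp (12 * l) = L ^ 12" unfolding l using L(2) by (subst exp_of_nat_mult[of 12, simplified]) simp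
    moreover have "exp (L / 2) = R"
    proof -
      have "exp (L / 2) ^ 2 = real m" unfolding L(1) using mpos by (simp add: exp_double[symmetric])
      then show ?thesis unfolding R_def by (metis exp_ge_zero real_sqrt_unique)
    qed
    ultimately show ?thesis by simp
  qed
  define \<theta> where "\<theta> = R / L ^ 5"
  have L0: "0 < L" "1 \<le> L" using L(2) by linarith+
  have R_eq: "R = \<theta> * L ^ 5" unfolding \<theta>_def using L0 by simp
  have m_eq: "real m = \<theta>\<^sup>2 * L ^ 10" unfolding Rm R_eq by (simp add: power_mult_distrib)
  have th7: "L ^ 7 \<le> \<theta>"
  proof -
    have "L ^ 7 * L ^ 5 \<le> R" using L12 by (simp add: power_add[symmetric])
    then show ?thesis unfolding \<theta>_def using L0 by (simp add: pos_le_divide_eq)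
  qed
  have thL: "2500 * L ^ 5 \<le> \<theta>" "9 * L \<le> \<theta>"
  proof -
    have "2500 * L ^ 5 \<le> L * L ^ 5" using L(2) L0 by (intro mult_right_mono) auto
    also have "\<dots> = L ^ 6 * 1" by (simp add: eval_nat_numeral)
    also have "\<dots> \<le> L ^ 6 * L" using L0 by (intro mult_left_mono) auto
    also have "\<dots> = L ^ 7" by (simp add: eval_nat_numeral)
    finally show 1: "2500 * L ^ 5 \<le> \<theta>" using th7 by linarith
    have "L * 1 \<le> L * L ^ 4" using L0 by (intro mult_left_mono one_le_power) auto
    then have "L \<le> L ^ 5" by (simp add: eval_nat_numeral)
    then show "9 * L \<le> \<theta>" using 1 L0 by linarith
  qed
  have th1: "1 \<le> \<theta>" using thL(2) L0 by linarith
  define \<Theta> where "\<Theta> = \<theta> * L ^ 3"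
  define \<Lambda> where "\<Lambda> = \<theta> * L ^ 8"
  define lam where "lam = 19 * l"
  define \<kappa> where "\<kappa> = 21 * L\<^sup>2 * (4 * \<theta>)"
  define \<Delta> where "\<Delta> = nat \<lfloor>\<theta>\<rfloor>"
  define W where "W = {v \<in> {1..n}. deg v \<le> \<Delta>}"
  have elam: "exp lam = L ^ 19"
    unfolding lam_def l using L0 by (subst exp_of_nat_mult[of 19, simplified]) simp
  have Theta_R: "L\<^sup>2 * \<Theta> = R" unfolding \<Theta>_def R_eq by (simp add: eval_nat_numeral)
  have th_Th: "\<theta> \<le> \<Theta>"
  proof -
    have "\<theta> * 1 \<le> \<theta> * L ^ 3" using th1 L0 by (intro mult_left_mono one_le_power) auto
    then show ?thesis unfolding \<Theta>_def by simp
  qed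
  obtain k where k: "n \<le> 2 ^ k" "2 ^ k \<le> 2 * n" using power_of_two_near[OF n_ge] by blast
  have crude: "(8 * real n ^ 2 * (2 * real n) ^ nat \<lfloor>y\<rfloor>) ^ k * (4 * real n * (2 * real n) ^ nat \<lfloor>y\<rfloor>) \<le> exp (21 * L\<^sup>2 * (4 * y))"
    if "1 \<le> y" for y
  proof (rule crude_bound(1)[OF n_ge n_le m_ge k(2) L(1) L0(2)])
    show "real (nat \<lfloor>y\<rfloor>) + 3 \<le> 4 * y" using that by linarith
  qed
  have b: "ln (4 * real m) \<le> 3 * L"
    using crude_bound(2)[OF n_ge n_le m_ge k(2) L(1) L0(2), of 0 3] by simp
  have n_exp: "2 * real n \<le> exp (3 * L)"
  proof -
    have "2 * real n \<le> 4 * real m" using n_le by linarith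
    also have "\<dots> = exp (ln (4 * real m))" using mpos by simp
    also have "\<dots> \<le> exp (3 * L)" using b by simp
    finally show ?thesis .
  qed
  have e3: "32 \<le> exp (3 * L)" using exp_ge_add_one_self[of "3 * L"] L(2) by linarith
  have sqrt2m: "sqrt (2 * real m) \<le> 3 / 2 * R"
  proof -
    have "sqrt (2 * real m) = sqrt 2 * R" unfolding R_def by (simp add: real_sqrt_mult)
    also have "\<dots> \<le> 3 / 2 * R" unfolding R_def
      by (intro mult_right_mono real_le_lsqrt) (auto simp: power2_eq_square)
    finally show ?thesis .
  qed
  have s_le: "real s \<le> 3 / 2 * R"
  proof -
    have "real s \<le> sqrt (2 * real m)" unfolding s_def by simp
    then show ?thesis using sqrt2m by linarith
  qed
  have R1: "1 \<le> R" using L12 one_le_power[OF L0(2), of 12] by linarith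
  \<comment> \<open>The first term is the base case of the outer recursion. In the second,
    \<open>48450 = 1700 * 19 * (3 / 2)\<close>: the outer constant, the 19 in \<open>lam\<close>,
    and \<open>sqrt (2 * m) \<le> 3 / 2 * R\<close>.\<close>
  define X where "X = 84 * R + 48450 * l * R"
  define N where "N = nat \<lceil>exp X\<rceil>"
  have N_le: "real N \<le> exp (50000 * l * R)"
  proof -
    have "real N \<le> exp X + 1" unfolding N_def by (simp add: of_nat_ceiling)
    also have "\<dots> \<le> 2 * exp X" unfolding X_def using l1 R1 by simp
    also have "\<dots> \<le> exp 1 * exp X" using exp_ge_add_one_self[of 1] by (intro mult_right_mono) auto
    also have "\<dots> = exp (1 + X)" by (rule exp_add[symmetric])
    also have "\<dots> \<le> exp (50000 * l * R)"
    proof -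
      have "1 * R \<le> l * R" using l1 R1 by (intro mult_right_mono) auto
      then have "1 + X \<le> 50000 * l * R" unfolding X_def using R1 by linarith
      then show ?thesis by simp
    qed
    finally show ?thesis .
  qed
  have "ordered_ramsey_number n E \<le> N"
  proof (rule ordered_ramsey_number_le[OF graph])
    fix c :: "nat set \<Rightarrow> bool"
    interpret rs: ramsey_setup c E "{1..N}" "{1..n}" W n \<Delta> k w deg lam \<theta> \<Theta> \<Lambda> \<kappa>
    proof
      show "card e = 2" if "e \<in> E" for e using edge_sub that by blast
      show "W \<subseteq> {1..n}" unfolding W_def by auto
      show "card {u \<in> {1..n}. {u, v} \<in> E} \<le> \<Delta>" if "v \<in> W" for v
      proof -
        have "card {u \<in> {1..n}. {u, v} \<in> E} \<le> deg v" by (rule card_neighbours) auto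
        then show ?thesis using that unfolding W_def by simp
      qed
      show "4 * real (w v) \<le> \<theta>\<^sup>2" for v
      proof -
        have "4 * real (w v) \<le> 4 * real s" unfolding w_def by simp
        also have "\<dots> \<le> 6 * (\<theta> * L ^ 5)" using s_le unfolding R_eq by simp
        also have "\<dots> = \<theta> * (6 * L ^ 5)" by simp
        also have "\<dots> \<le> \<theta> * \<theta>" using thL(1) L0 th1 by (intro mult_left_mono) auto
        finally show ?thesis by (simp add: power2_eq_square)
      qed
      show "1 \<le> lam" unfolding lam_def using l1 by simp
      show "8 * real n ^ 2 \<le> exp \<theta>"
      proof -
        have "8 * real n ^ 2 = 2 * (2 * real n) ^ 2" by (simp add: power_mult_distrib)
        also have "\<dots> \<le> exp (3 * L) * exp (3 * L) ^ 2" using n_exp e3 by (intro mult_mono power_mono) auto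
        also have "\<dots> = exp (9 * L)" by (simp add: exp_double[symmetric] exp_add[symmetric])
        also have "\<dots> \<le> exp \<theta>" using thL(2) by simp
        finally show ?thesis .
      qed
      \<comment> \<open>Dependent random choice needs an upper bound on the ambient set, so
        \<open>N\<close> had to be fixed before the recursions. Its logarithm, of order
        \<open>l * R\<close>, lies within \<open>\<Lambda> = L ^ 3 * R\<close>.\<close>
      show "real (card {1..N}) \<le> exp \<Lambda>"
      proof -
        have "50000 * l * R \<le> L * L * L * R"
        proof (rule mult_right_mono)
          have "2500 * 2500 \<le> L * L" using L(2) by (intro mult_mono) auto
          then have "50000 \<le> L * L" by simp
          then show "50000 * l \<le> L * L * L" using lL l1 L0 by (intro mult_mono) auto
        qed (use R1 in simp)
        also have "\<dots> = \<Lambda>" unfolding \<Lambda>_def R_eq by (simp add: eval_nat_numeral)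
        finally have "exp (50000 * l * R) \<le> exp \<Lambda>" by simp
        with N_le have "real N \<le> exp \<Lambda>" by (rule order_trans)
        then show ?thesis by simp
      qed
      show "0 \<le> \<Lambda>" unfolding \<Lambda>_def using th1 L0 by simp
      show "4 * (real (card ({1..n} - W)) * \<Lambda> + 1) \<le> \<theta>\<^sup>2 * exp lam"
      proof -
        have "card ({1..n} - W) * (\<Delta> + 1) \<le> sum deg ({1..n} - W)"
          using sum_bounded_below[of "{1..n} - W" "\<Delta> + 1" deg] unfolding W_def by fastforce
        also have "\<dots> \<le> sum deg {1..n}" by (intro sum_mono2) auto
        finally have "card ({1..n} - W) * (\<Delta> + 1) \<le> 2 * m" using sum_deg by simp
        then have "real (card ({1..n} - W) * (\<Delta> + 1)) \<le> real (2 * m)" by (simp only: of_nat_le_iff)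
        then have c1: "real (card ({1..n} - W)) * (real \<Delta> + 1) \<le> 2 * (\<theta>\<^sup>2 * L ^ 10)" using m_eq by (simp add: algebra_simps)
        have "\<theta> \<le> real \<Delta> + 1" unfolding \<Delta>_def by linarith
        then have "real (card ({1..n} - W)) * \<theta> \<le> real (card ({1..n} - W)) * (real \<Delta> + 1)" by (intro mult_left_mono) auto
        then have c2: "real (card ({1..n} - W)) * \<theta> \<le> 2 * (\<theta>\<^sup>2 * L ^ 10)" using c1 by (rule order_trans)
        have "real (card ({1..n} - W)) * \<Lambda> = real (card ({1..n} - W)) * \<theta> * L ^ 8" unfolding \<Lambda>_def by simp
        also have "\<dots> \<le> 2 * (\<theta>\<^sup>2 * L ^ 10) * L ^ 8" using c2 L0 by (intro mult_right_mono) auto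
        also have "\<dots> = 2 * (\<theta>\<^sup>2 * L ^ 18)" by (simp add: power_add[symmetric])
        finally have "real (card ({1..n} - W)) * \<Lambda> \<le> 2 * (\<theta>\<^sup>2 * L ^ 18)" .
        moreover have "1 \<le> \<theta>\<^sup>2 * L ^ 18"
          using mult_mono[OF one_le_power[OF th1] one_le_power[OF L0(2)], of 2 18] by simp
        ultimately have "4 * (real (card ({1..n} - W)) * \<Lambda> + 1) \<le> \<theta>\<^sup>2 * L ^ 18 * 12"
          unfolding distrib_left by linarith
        also have "\<dots> \<le> \<theta>\<^sup>2 * L ^ 18 * L" using L(2) L0 by (intro mult_left_mono) auto
        also have "\<dots> = \<theta>\<^sup>2 * exp lam" unfolding elam by (simp add: eval_nat_numeral)
        finally show ?thesis .
      qed
      show "(8 * real n ^ 2 * (2 * real n) ^ nat \<lfloor>\<theta>\<rfloor>) ^ k * (4 * real n * (2 * real n) ^ nat \<lfloor>\<theta>\<rfloor>) \<le> exp \<kappa>"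
        unfolding \<kappa>_def by (rule crude[OF th1])
      show "(2 * real n) ^ (2 * \<Delta>) * (512 * real n ^ 4) * exp (2 * \<kappa>) \<le> exp \<Theta>"
      proof -
        have "(2 * real n) ^ (2 * \<Delta>) \<le> exp (3 * L) ^ (2 * \<Delta>)" using n_exp by (intro power_mono) auto
        also have "\<dots> = exp (real (2 * \<Delta>) * (3 * L))" by (rule exp_of_nat_mult[symmetric])
        also have "\<dots> \<le> exp (6 * L * \<theta>)"
        proof -
          have "real \<Delta> \<le> \<theta>" unfolding \<Delta>_def using th1 by linarith
          then have "6 * L * real \<Delta> \<le> 6 * L * \<theta>" using L0 by (intro mult_left_mono) auto
          then show ?thesis by (simp add: mult.commute)
        qed
        finally have t1: "(2 * real n) ^ (2 * \<Delta>) \<le> exp (6 * L * \<theta>)" .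
        have "512 * real n ^ 4 = 32 * (2 * real n) ^ 4" by (simp add: power_mult_distrib)
        also have "\<dots> \<le> exp (3 * L) * exp (3 * L) ^ 4" using n_exp e3 by (intro mult_mono power_mono) auto
        also have "\<dots> = exp (15 * L)" by (simp add: exp_of_nat_mult[symmetric] exp_add[symmetric])
        finally have t2: "512 * real n ^ 4 \<le> exp (15 * L)" .
        have "(2 * real n) ^ (2 * \<Delta>) * (512 * real n ^ 4) * exp (2 * \<kappa>) \<le> exp (6 * L * \<theta>) * exp (15 * L) * exp (2 * \<kappa>)"
          using t1 t2 by (intro mult_mono mult_nonneg_nonneg) auto
        also have "\<dots> = exp (6 * L * \<theta> + 15 * L + 2 * \<kappa>)" by (simp add: exp_add)
        also have "\<dots> \<le> exp \<Theta>"
        proof -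
          have a: "L * \<theta> \<le> L\<^sup>2 * \<theta>" "L \<le> L\<^sup>2 * \<theta>"
          proof -
            have "L * 1 \<le> L * L" using L0 by (intro mult_left_mono) auto
            then have LL: "L \<le> L\<^sup>2" by (simp add: power2_eq_square)
            then show "L * \<theta> \<le> L\<^sup>2 * \<theta>" using th1 by (intro mult_right_mono) auto
            have "L * 1 \<le> L\<^sup>2 * \<theta>" using LL th1 L0 by (intro mult_mono) auto
            then show "L \<le> L\<^sup>2 * \<theta>" by simp
          qed
          have "6 * L * \<theta> + 15 * L + 2 * \<kappa> \<le> 2500 * (L\<^sup>2 * \<theta>)"
          proof -
            have "6 * L * \<theta> = 6 * (L * \<theta>)" "2 * \<kappa> = 168 * (L\<^sup>2 * \<theta>)" unfolding \<kappa>_def by simp_all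
            moreover have "0 \<le> L\<^sup>2 * \<theta>" using th1 by simp
            ultimately show ?thesis using a by linarith
          qed
          also have "\<dots> \<le> L * (L\<^sup>2 * \<theta>)" using L(2) th1 by (intro mult_right_mono) auto
          also have "\<dots> = \<Theta>" unfolding \<Theta>_def by (simp add: eval_nat_numeral)
          finally show ?thesis by simp
        qed
        finally show ?thesis .
      qed
    qed (use n_ge k th1 th_Th degen in auto)
    have base: "rs.full.ram col I J (exp (84 * R))"
      if h: "I \<subseteq> {1..n}" "J \<subseteq> {1..n}" "real (sum w I) \<le> \<Theta>\<^sup>2" for col I J
    proof (rule rs.full.ram_mono)
      show "rs.full.ram col I J ((8 * real n ^ 2 * (2 * real n) ^ nat \<lfloor>\<Theta>\<rfloor>) ^ k * (4 * real n * (0 + 1) * (2 * real n) ^ nat \<lfloor>\<Theta>\<rfloor>))"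
      proof (rule rs.full.crude_ram[where d = deg])
        show "card J \<le> 2 ^ k" using card_mono[OF _ h(2)] k(1) by simp
        fix v assume v: "v \<in> I"
        have "(card {u \<in> I. deg v \<le> deg u \<and> {u, v} \<in> E})\<^sup>2 \<le> sum w I" using degen[OF h(1) v] .
        then have "real ((card {u \<in> I. deg v \<le> deg u \<and> {u, v} \<in> E})\<^sup>2) \<le> real (sum w I)" by (simp only: of_nat_le_iff)
        then have "real (card {u \<in> I. deg v \<le> deg u \<and> {u, v} \<in> E}) ^ 2 \<le> \<Theta>\<^sup>2" using h(3) by simp
        then have "real (card {u \<in> I. deg v \<le> deg u \<and> {u, v} \<in> E}) \<le> \<Theta>"
          by (rule power2_le_imp_le) (use th1 th_Th in simp)
        then show "card {u \<in> I. deg v \<le> deg u \<and> {u, v} \<in> E} \<le> nat \<lfloor>\<Theta>\<rfloor>" by (simp add: le_nat_floor)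
      qed (use h in auto)
      have "21 * L\<^sup>2 * (4 * \<Theta>) = 84 * R" using Theta_R by simp
      then show "(8 * real n ^ 2 * (2 * real n) ^ nat \<lfloor>\<Theta>\<rfloor>) ^ k * (4 * real n * (0 + 1) * (2 * real n) ^ nat \<lfloor>\<Theta>\<rfloor>) \<le> exp (84 * R)"
        using crude[of \<Theta>] th1 th_Th by simp
    qed
    define Sw where "Sw = real (sum w {1..n})"
    have Sw: "0 \<le> Sw" "Sw \<le> 2 * real m" unfolding Sw_def using sum_w[OF order_refl] by linarith+
    have "rs.full.ram True {1..n} {1..n} (exp (84 * R) * exp (1700 * lam * sqrt (sqrt (Sw * Sw))))"
      unfolding Sw_def by (rule rs.outer_ram[OF _ base]) (use R1 in auto)
    moreover have "exp (84 * R) * exp (1700 * lam * sqrt (sqrt (Sw * Sw))) \<le> exp X"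
    proof -
      have "sqrt (sqrt (Sw * Sw)) = sqrt Sw" using Sw(1) by simp
      also have "\<dots> \<le> sqrt (2 * real m)" using Sw(2) by (rule real_sqrt_le_mono)
      also have "\<dots> \<le> 3 / 2 * R" by (rule sqrt2m)
      finally have "1700 * lam * sqrt (sqrt (Sw * Sw)) \<le> 1700 * lam * (3 / 2 * R)"
        unfolding lam_def using l1 by (intro mult_left_mono) auto
      also have "\<dots> = 48450 * l * R" unfolding lam_def by simp
      finally have "84 * R + 1700 * lam * sqrt (sqrt (Sw * Sw)) \<le> X" unfolding X_def by linarith
      then show ?thesis unfolding exp_add[symmetric] by simp
    qed
    ultimately have "rs.full.ram True {1..n} {1..n} (exp X)" by (rule rs.full.ram_mono)
    moreover have "exp X \<le> real (card {1..N})" unfolding N_def by simp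
    ultimately have "(\<exists>\<psi>. rs.full.copy True {1..n} {} id {1..N} \<psi>) \<or> (\<exists>\<psi>. rs.full.copy (\<not> True) {1..n} {} id {1..N} \<psi>)"
      unfolding rs.full.ram_def by blast
    then show "\<exists>col \<psi>. (\<forall>u\<in>{1..n}. \<psi> u \<in> {1..N}) \<and> (\<forall>u\<in>{1..n}. \<forall>v\<in>{1..n}. u < v \<longrightarrow> \<psi> u < \<psi> v) \<and>
      (\<forall>u\<in>{1..n}. \<forall>v\<in>{1..n}. {u, v} \<in> E \<longrightarrow> c {\<psi> u, \<psi> v} = col)"
      unfolding rs.full.copy_def by blast
  qed
  then have "real (ordered_ramsey_number n E) \<le> real N" by simp
  then show ?thesis using N_le unfolding R_def by linarith
qed

end

text \<open>For \<open>L \<ge> 2500\<close> the bound with the first power of \<open>ln L\<close> is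
  even stronger, as \<open>ln L \<ge> 1\<close>. The factor \<open>10 ^ 9\<close> is spent on
  smaller \<open>L\<close>, where the crude bound has to suffice: \<open>85 * 2500 ^ 2\<close> is
  about \<open>5.3 * 10 ^ 8\<close>. For the smallest \<open>m\<close> the double logarithm is close
  to 0 and must be bounded away from it.\<close>

theorem theorem1p2:
  fixes n m :: nat and E :: "nat set set"
  assumes "ordered_graph n E"
    and "no_isolated_vertices n E"
    and "card E = m"
    and "m \<ge> 3"
  shows "real (ordered_ramsey_number n E)
           \<le> exp (10 ^ 9 * sqrt (real m) * ln (ln (real m)) powr (3 / 2))"
proof -
  interpret ordered_graph_m n m E by standard (use assms in auto)
  define L where "L = ln (real m)"
  define l where "l = ln L"
  \<comment> \<open>\<open>ln 3\<close> is about 1.0986, and any bound above 1 keeps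
    \<open>ln L\<close> away from 0. The quadratic estimate of \<open>exp\<close> holds only for
    arguments up to 1, so it is applied to a twentieth of the argument, where it is also sharp
    enough.\<close>
  have L1: "103 / 100 \<le> L"
  proof -
    have "exp (103 / 100 :: real) = exp (103 / 2000) ^ 20" by (simp add: exp_of_nat_mult[symmetric])
    also have "\<dots> \<le> (1 + 103 / 2000 + (103 / 2000)\<^sup>2) ^ 20"
      using exp_bound[of "103 / 2000 :: real"] by (intro power_mono) auto
    also have "\<dots> \<le> real m" using assms(4) by (simp add: power2_eq_square power_divide)
    finally show ?thesis unfolding L_def using assms(4) by (subst ln_ge_iff) auto
  qed
  have "85 * L\<^sup>2 \<le> 10 ^ 9 * l powr (3 / 2)" if L: "L \<le> 2500"
  proof (cases "1 \<le> l")
    case True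
    have "L\<^sup>2 \<le> 2500\<^sup>2" using L L1 by (intro power_mono) auto
    moreover have "1 \<le> l powr (3 / 2)" using True by (rule ge_one_powr_ge_zero) simp
    ultimately show ?thesis by simp
  next
    case False
    have "L < exp 1" using False L1 unfolding l_def by (subst (asm) ln_ge_iff) auto
    then have "L \<le> 3" using exp_le by linarith
    then have L3: "L\<^sup>2 \<le> 3\<^sup>2" using L1 by (intro power_mono) auto
    \<comment> \<open>From \<open>ln L \<ge> 1 - 1 / L\<close>, as \<open>1 - 100 / 103\<close>
      exceeds \<open>1 / 50\<close>.\<close>
    have "1 / 50 \<le> l"
    proof -
      have "ln (1 / L) \<le> 1 / L - 1" using L1 by (intro ln_le_minus_one) auto
      moreover have "ln (1 / L) = - l" unfolding l_def using L1 by (simp add: ln_div)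
      moreover have "1 / L \<le> 1 / (103 / 100)" using L1 by (intro divide_left_mono) auto
      ultimately show ?thesis by simp
    qed
    \<comment> \<open>As \<open>l < 1\<close>, the square is a lower bound for
      \<open>l powr (3 / 2)\<close>, and \<open>10 ^ 9 / 2500\<close> still exceeds
      \<open>85 * 9\<close>.\<close>
    then have "(1 / 50)\<^sup>2 \<le> l\<^sup>2" by (intro power_mono) auto
    also have "l\<^sup>2 = l powr 2" using \<open>1 / 50 \<le> l\<close> by simp
    also have "\<dots> \<le> l powr (3 / 2)" using False \<open>1 / 50 \<le> l\<close> by (intro powr_mono') auto
    finally show ?thesis using L3 by (simp add: power2_eq_square)
  qed
  moreover have "50000 * l \<le> 10 ^ 9 * l powr (3 / 2)" if L: "2500 \<le> L"
  proof -
    have "exp 1 \<le> L" using exp_le L by linarith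
    then have l1: "1 \<le> l" unfolding l_def using L by (subst ln_ge_iff) auto
    then have "l powr 1 \<le> l powr (3 / 2)" by (intro powr_mono) auto
    then show ?thesis using l1 by simp
  qed
  ultimately consider "2500 \<le> L" "50000 * l \<le> 10 ^ 9 * l powr (3 / 2)" | "85 * L\<^sup>2 \<le> 10 ^ 9 * l powr (3 / 2)"
    by linarith
  then show ?thesis
  proof cases
    case 1
    have "50000 * l * sqrt (real m) \<le> 10 ^ 9 * l powr (3 / 2) * sqrt (real m)" using 1(2) by (intro mult_right_mono) auto
    then show ?thesis
      using large_ramsey_number[OF L_def 1(1) l_def] unfolding l_def L_def
      by (smt (verit) exp_le_cancel_iff mult.assoc mult.commute)
  next
    case 2
    have "85 * L\<^sup>2 * sqrt (real m) \<le> 10 ^ 9 * l powr (3 / 2) * sqrt (real m)" using 2 by (intro mult_right_mono) auto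
    moreover have "1 \<le> L" using L1 by simp
    ultimately show ?thesis
      using crude_ramsey_number[OF L_def] unfolding l_def L_def
      by (smt (verit) exp_le_cancel_iff mult.assoc mult.commute)
  qed
qed

end
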